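(* (Subject reduction) If $\Gamma\Vdash P\rhd\Delta$ and $P\to Q$, then $\Gamma\Vdash Q\rhd\Delta$.
   Context: TYPES. Ground types $G$ are, e.g., $\mathtt{Nat},\mathtt{Bool}$. Labels range over $\mathcal L$; polarities are $p\in\{+,-\}$ with $\overline{+}=-$ and $\overline{-}=+$. Session types are $$S ::= \mathsf{end}\mid ?G.S\mid !G.S\mid ?(S_1^p).S_2\mid !(S_1^p).S_2\mid\oplus\{l_i{:}S_i\}_{i\in I}\mid\&\{l_i{:}S_i\}_{i\in I}\mid\langle\!\langle l_i{:}S_i\rangle\!\rangle_{i\in I}$$ (selection, branching, speculative selection; labels pairwise distinct). ORCHESTRATORS. $\mathsf f ::= \mathfrak 1\mid\bullet.\mathsf f\mid l.\mathsf f\mid l.\mathsf f+l'.\mathsf g\mid l.\mathsf f\oplus l'.\mathsf g$, with $n$-ary forms $\sum_i l_i.\mathsf f_i$ and $\bigoplus_i l_i.\mathsf f_i$. COMPLIANCE. $\mathsf f:S\dashv S'$ is the least relation with: (1) $\mathfrak 1:\mathsf{end}\dashv S$; (2) $\mathsf f:S\dashv S'$ implies $\bullet.\mathsf f:?G.S\dashv !G.S'$ and $\bullet.\mathsf f:!G.S\dashv ?G.S'$; (2') $\mathsf f:S_2\dashv S'_2$ implies $\bullet.\mathsf f:?(S_1^p).S_2\dashv !(S_1^p).S'_2$ and $\bullet.\mathsf f:!(S_1^p).S_2\dashv ?(S_1^p).S'_2$; (3) if $\mathsf f_i:S_i\dashv S'_i$ for all $i\in I$, then for any $J$: $\sum_{i\in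 I}l_i.\mathsf f_i:\oplus\{l_i{:}S_i\}_{i\in I}\dashv\&\{l_j{:}S'_j\}_{j\in I\cup J}$ and $\sum_{i\in I}l_i.\mathsf f_i:\&\{l_j{:}S_j\}_{j\in I\cup J}\dashv\oplus\{l_i{:}S'_i\}_{i\in I}$; (4) if $\emptyset\ne H\subseteq I\cap J$ and $\mathsf f_h:S_h\dashv S'_h$ for $h\in H$, then $\bigoplus_{h\in H}l_h.\mathsf f_h:\langle\!\langle l_i{:}S_i\rangle\!\rangle_{i\in I}\dashv\&\{l_j{:}S'_j\}_{j\in J}$ and $\bigoplus_{h\in H}l_h.\mathsf f_h:\&\{l_j{:}S_j\}_{j\in J}\dashv\langle\!\langle l_i{:}S'_i\rangle\!\rangle_{i\in I}$. PROCESSES. User-defined: $P ::= \mathbf 0\mid P\mid Q\mid\mathtt{request}(a{:}S)(k).P\mid\mathtt{accept}(a{:}S)(k).P\mid k!\langle e\rangle.P\mid k?(x).P\mid\mathtt{throw}\,k\langle k'\rangle.P\mid\mathtt{catch}\,k(k').P\mid k\triangleleft l.P\mid k\triangleright\{l_i{:}P_i\}_{i\in I}\mid k\triangleleft\langle\!\langle l_i{:}P_i\rangle\!\rangle_{i\in I}$. Run-time: $R ::= (\nu k)(k[\mathsf f]\mid P)\mid(\nu k)(k[\mathsf f]\mid R)\mid P\mid R\mid R\mid P\mid R\mid R'$, with polarized channels $k^p$; $(\nu k)$ binds $k,k^\pm$. TYPING. $\Gamma$ maps variables to ground types and $\Gamma\vdash e:G$ types expressions (assumed preserved by evaluation). $\Delta$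 maps polarized channels to session types; $\Delta\cdot\Delta'$ is disjoint union. $\Gamma\Vdash P\rhd\Delta$ is defined by the rules: - $\mathbf 0$ gets any $\Delta$ with all types $\mathsf{end}$; - $P\mid Q$ gets $\Delta\cdot\Delta'$ from $P{:}\Delta$, $Q{:}\Delta'$; - $\mathtt{accept}(a{:}S)(k).P$ gets $\Delta$ if $P\{k^+/k\}$ gets $\Delta\cdot k^+{:}S$ (and $k^-$ for $\mathtt{request}$); - $k^p?(x).P$ gets $\Delta\cdot k^p{:}?G.S$ if $\Gamma,x{:}G\Vdash P\rhd\Delta\cdot k^p{:}S$; - $k^p!\langle e\rangle.P$ gets $\Delta\cdot k^p{:}!G.S$ if $\Gamma\vdash e:G$ and $P$ gets $\Delta\cdot k^p{:}S$; - $\mathtt{catch}\,k^p(k').P$ gets $\Delta\cdot k^p{:}?(S_1^q).S_2$ if $P\{k'^q/k'\}$ gets $\Delta\cdot k^p{:}S_2\cdot k'^q{:}S_1$; - $\mathtt{throw}\,k^p\langle k'^q\rangle.P$ gets $\Delta\cdot k^p{:}!(S_1^q).S_2\cdot k'^q{:}S_1$ if $P$ gets $\Delta\cdot k^p{:}S_2$; - $k^p\triangleright\{l_i{:}P_i\}_{i\in I}$ gets $\Delta\cdot k^p{:}\&\{l_j{:}S_j\}_{j\in J}$ if $J\subseteq I$ and every $P_i$ gets $\Delta\cdot k^p{:}S_i$; - $k^p\triangleleft l_j.P$ gets $\Delta\cdot k^p{:}\oplus\{l_i{:}S_i\}_{i\in I}$ if $j\in I$ and $P$ gets $\Delta\cdot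 k^p{:}S_j$; - $k^p\triangleleft\langle\!\langle l_i{:}P_i\rangle\!\rangle_{i\in I}$ gets $\Delta\cdot k^p{:}\langle\!\langle l_i{:}S_i\rangle\!\rangle_{i\in I}$ if every $P_i$ gets $\Delta\cdot k^p{:}S_i$; - $(\nu k)(k[\mathsf f]\mid P)$ gets $\Delta$ if $P$ gets $\Delta\cdot k^-{:}S_1\cdot k^+{:}S_2$ and $\mathsf f:S_1\dashv S_2$; - $(\nu k)P$ gets $\Delta$ if $P$ gets $\Delta$ with $k^\pm\notin\mathrm{dom}\,\Delta$. REDUCTION. Structural congruence $\equiv$ is the least congruence with: - $\alpha$-conversion of bound channels; - $(\nu k)(k[\mathsf f]\mid Q\mid(\nu k')(k'[\mathsf g]\mid Q'\mid R))\equiv(\nu k')(k'[\mathsf g]\mid(\nu k)(k[\mathsf f]\mid Q\mid Q')\mid R)$ when $k\notin fc(R)$ and $k'\notin fc(Q)$; - commutativity and associativity of $\mid$ among processes that are not named orchestrators. $\to$ is given by the axioms: - $\mathtt{request}(a{:}S)(k).P\mid\mathtt{accept}(b{:}S')(k).Q\to(\nu k)(k[\mathsf f]\mid P\{k^-/k\}\mid Q\{k^+/k\})$ if $\mathsf f:S\dashv S'$; - $(\nu k)(k[\bullet.\mathsf f]\mid k^p!\langle e\rangle.P\mid k^{\overline p}?(x).Q)\to(\nu k)(k[\mathsf f]\mid P\mid Q\{v/x\})$ if $e$ evaluates to $v$; - $(\nu k)(k[\bullet.\mathsf f]\mid\mathtt{throw}\,k^p\langle k'^q\rangle.P\mid\mathtt{catch}\,k^{\overline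 p}(k').Q)\to(\nu k)(k[\mathsf f]\mid P\mid Q\{k'^q/k'\})$; - $(\nu k)(k[\sum_{h\in H}l_h.\mathsf f_h]\mid k^p\triangleleft l_c.P\mid k^{\overline p}\triangleright\{l_i{:}Q_i\}_{i\in I})\to(\nu k)(k[\mathsf f_c]\mid P\mid Q_c)$ if $c\in H\cap I$; - $(\nu k)(k[\bigoplus_{h\in H}l_h.\mathsf f_h]\mid k^p\triangleleft\langle\!\langle l_j{:}P_j\rangle\!\rangle_{j\in J}\mid k^{\overline p}\triangleright\{l_i{:}Q_i\}_{i\in I})\to(\nu k)(k[\mathsf f_c]\mid P_c\mid Q_c)$ if $c\in H\cap I\cap J$. It is closed under $P\to P'\Rightarrow P\mid Q\to P'\mid Q$, under $P\to P'\Rightarrow(\nu k)P\to(\nu k)P'$, and under $\equiv$ on both sides. *)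

theory Defs
  imports Main "HOL-Library.Finite_Map"
begin

section \<open>Types and orchestrators\<close>

text \<open>
  Labelled families \<open>{l\<^sub>i : X\<^sub>i}\<close> with pairwise distinct labels and finite index set are finite maps
  from labels to \<open>X\<close>: the index set is the domain of the map. As usual for such families, index
  sets are nonempty; this is imposed where it matters, in compliance and typing.
\<close>

type_synonym name = nat
type_synonym shared = nat
type_synonym var = nat

datatype pol = Plus | Minus

primrec co :: "pol \<Rightarrow> pol" where
  "co Plus = Minus"
| "co Minus = Plus"

datatype ('l, 'g) stype =
  End
| InG 'g "('l, 'g) stype"
| OutG 'g "('l, 'g) stype"
| InS "('l, 'g) stype" pol "('l, 'g) stype"   \<comment> \<open>\<open>InS S p S'\<close> is \<open>?(S\<^sup>p).S'\<close>\<close>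
| OutS "('l, 'g) stype" pol "('l, 'g) stype"
| Sel "('l, ('l, 'g) stype) fmap"             \<comment> \<open>\<open>\<oplus>{\<dots>}\<close>\<close>
| Bra "('l, ('l, 'g) stype) fmap"             \<comment> \<open>\<open>&{\<dots>}\<close>\<close>
| Spec "('l, ('l, 'g) stype) fmap"            \<comment> \<open>speculative selection\<close>

text \<open>
  \<open>OSum\<close> and \<open>OPlus\<close> are meant for at least two branches. The n-ary forms are \<open>osum\<close> and \<open>oplus\<close>
  below: on a single branch both are the prefix \<open>l.f\<close>, which the grammar does not classify as
  either kind of choice.
\<close>

datatype 'l orch =
  One
| Tick "'l orch"
| OPre 'l "'l orch"
| OSum "('l, 'l orch) fmap"
| OPlus "('l, 'l orch) fmap"

definition nary :: "(('l, 'l orch) fmap \<Rightarrow> 'l orch) \<Rightarrow> ('l, 'l orch) fmap \<Rightarrow> 'l orch" where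
  "nary C m =
     (if \<exists>l f. m = fmupd l f fmempty
      then (THE h. \<exists>l f. m = fmupd l f fmempty \<and> h = OPre l f)
      else C m)"

abbreviation osum :: "('l, 'l orch) fmap \<Rightarrow> 'l orch" where
  "osum \<equiv> nary OSum"

abbreviation oplus :: "('l, 'l orch) fmap \<Rightarrow> 'l orch" where
  "oplus \<equiv> nary OPlus"

lemma fmupd_fmempty_eq_iff:
  "fmupd l f fmempty = fmupd l' f' fmempty \<longleftrightarrow> l = l' \<and> f = f'"
proof
  assume eq: "fmupd l f fmempty = fmupd l' f' fmempty"
  have "fmlookup (fmupd l f fmempty) l = fmlookup (fmupd l' f' fmempty) l"
    using eq by simp
  then show "l = l' \<and> f = f'"
    by (simp split: if_splits)
qed simp

lemma nary_single [simp]: "nary C (fmupd l f fmempty) = OPre l f"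
  unfolding nary_def by (auto simp: fmupd_fmempty_eq_iff)

section \<open>Compliance\<close>

text \<open>\<open>comply f S S'\<close> is \<open>f : S \<stileturn> S'\<close>. A domain \<open>I \<union> J\<close> for arbitrary \<open>J\<close> is a superset of \<open>I\<close>.\<close>

inductive comply :: "'l orch \<Rightarrow> ('l, 'g) stype \<Rightarrow> ('l, 'g) stype \<Rightarrow> bool" where
  comply_end: "comply One End S"
| comply_in: "comply f S S' \<Longrightarrow> comply (Tick f) (InG G S) (OutG G S')"
| comply_out: "comply f S S' \<Longrightarrow> comply (Tick f) (OutG G S) (InG G S')"
| comply_catch: "comply f S S' \<Longrightarrow> comply (Tick f) (InS T p S) (OutS T p S')"
| comply_throw: "comply f S S' \<Longrightarrow> comply (Tick f) (OutS T p S) (InS T p S')"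
| comply_sel:
    "\<lbrakk>m \<noteq> fmempty; fmdom m = fmdom s; fmdom s |\<subseteq>| fmdom s';
      \<And>l f S S'. \<lbrakk>fmlookup m l = Some f; fmlookup s l = Some S; fmlookup s' l = Some S'\<rbrakk>
        \<Longrightarrow> comply f S S'\<rbrakk>
     \<Longrightarrow> comply (osum m) (Sel s) (Bra s')"
| comply_bra:
    "\<lbrakk>m \<noteq> fmempty; fmdom m = fmdom s'; fmdom s' |\<subseteq>| fmdom s;
      \<And>l f S S'. \<lbrakk>fmlookup m l = Some f; fmlookup s l = Some S; fmlookup s' l = Some S'\<rbrakk>
        \<Longrightarrow> comply f S S'\<rbrakk>
     \<Longrightarrow> comply (osum m) (Bra s) (Sel s')"
| comply_spec_bra:
    "\<lbrakk>m \<noteq> fmempty; fmdom m |\<subseteq>| fmdom s |\<inter>| fmdom s';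
      \<And>l f S S'. \<lbrakk>fmlookup m l = Some f; fmlookup s l = Some S; fmlookup s' l = Some S'\<rbrakk>
        \<Longrightarrow> comply f S S'\<rbrakk>
     \<Longrightarrow> comply (oplus m) (Spec s) (Bra s')"
| comply_bra_spec:
    "\<lbrakk>m \<noteq> fmempty; fmdom m |\<subseteq>| fmdom s |\<inter>| fmdom s';
      \<And>l f S S'. \<lbrakk>fmlookup m l = Some f; fmlookup s l = Some S; fmlookup s' l = Some S'\<rbrakk>
        \<Longrightarrow> comply f S S'\<rbrakk>
     \<Longrightarrow> comply (oplus m) (Bra s) (Spec s')"

section \<open>Processes\<close>

datatype chan = Bare name | Pol name pol

text \<open>
  \<open>Sess k f P\<close> is \<open>(\<nu>k)(k[f] | P)\<close>, so a named orchestrator is never itself a process.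
  \<open>Res k P\<close> is the plain restriction \<open>(\<nu>k)P\<close>, which the run-time grammar does not generate but which
  has a typing rule and a reduction context of its own.
\<close>

datatype ('l, 'g, 'e) proc =
  PNil
| Par "('l, 'g, 'e) proc" "('l, 'g, 'e) proc"
| Request shared "('l, 'g) stype" name "('l, 'g, 'e) proc"
| Accept shared "('l, 'g) stype" name "('l, 'g, 'e) proc"
| Out chan 'e "('l, 'g, 'e) proc"
| In chan var "('l, 'g, 'e) proc"
| Throw chan chan "('l, 'g, 'e) proc"
| Catch chan name "('l, 'g, 'e) proc"
| Select chan 'l "('l, 'g, 'e) proc"
| Branch chan "('l, ('l, 'g, 'e) proc) fmap"
| Speculate chan "('l, ('l, 'g, 'e) proc) fmap"
| Sess name "'l orch" "('l, 'g, 'e) proc"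
| Res name "('l, 'g, 'e) proc"

inductive user :: "('l, 'g, 'e) proc \<Rightarrow> bool" where
  "user PNil"
| "user P \<Longrightarrow> user Q \<Longrightarrow> user (Par P Q)"
| "user P \<Longrightarrow> user (Request a S k P)"
| "user P \<Longrightarrow> user (Accept a S k P)"
| "user P \<Longrightarrow> user (Out c e P)"
| "user P \<Longrightarrow> user (In c x P)"
| "user P \<Longrightarrow> user (Throw c d P)"
| "user P \<Longrightarrow> user (Catch c k P)"
| "user P \<Longrightarrow> user (Select c l P)"
| "(\<And>l P. fmlookup b l = Some P \<Longrightarrow> user P) \<Longrightarrow> user (Branch c b)"
| "(\<And>l P. fmlookup b l = Some P \<Longrightarrow> user P) \<Longrightarrow> user (Speculate c b)"

text \<open>User-defined and run-time processes together: restrictions never occur under a prefix.\<close>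

inductive process :: "('l, 'g, 'e) proc \<Rightarrow> bool" where
  "user P \<Longrightarrow> process P"
| "process P \<Longrightarrow> process Q \<Longrightarrow> process (Par P Q)"
| "process P \<Longrightarrow> process (Sess k f P)"
| "process P \<Longrightarrow> process (Res k P)"

text \<open>
  \<open>Request\<close>, \<open>Accept\<close> and \<open>Catch\<close> bind only the unpolarized \<open>k\<close>, whereas restriction binds
  \<open>k\<close>, \<open>k\<^sup>+\<close> and \<open>k\<^sup>-\<close>.
\<close>

definition chans :: "name \<Rightarrow> chan set" where
  "chans k = {Bare k, Pol k Plus, Pol k Minus}"

primrec fc :: "('l, 'g, 'e) proc \<Rightarrow> chan set" where
  "fc PNil = {}"
| "fc (Par P Q) = fc P \<union> fc Q"
| "fc (Request a S k P) = fc P - {Bare k}"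
| "fc (Accept a S k P) = fc P - {Bare k}"
| "fc (Out c e P) = insert c (fc P)"
| "fc (In c x P) = insert c (fc P)"
| "fc (Throw c d P) = insert c (insert d (fc P))"
| "fc (Catch c k P) = insert c (fc P - {Bare k})"
| "fc (Select c l P) = insert c (fc P)"
| "fc (Branch c b) = insert c (\<Union> (fmran' (fmmap fc b)))"
| "fc (Speculate c b) = insert c (\<Union> (fmran' (fmmap fc b)))"
| "fc (Sess k f P) = fc P - chans k"
| "fc (Res k P) = fc P - chans k"

primrec bn :: "('l, 'g, 'e) proc \<Rightarrow> name set" where
  "bn PNil = {}"
| "bn (Par P Q) = bn P \<union> bn Q"
| "bn (Request a S k P) = insert k (bn P)"
| "bn (Accept a S k P) = insert k (bn P)"
| "bn (Out c e P) = bn P"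
| "bn (In c x P) = bn P"
| "bn (Throw c d P) = bn P"
| "bn (Catch c k P) = insert k (bn P)"
| "bn (Select c l P) = bn P"
| "bn (Branch c b) = \<Union> (fmran' (fmmap bn b))"
| "bn (Speculate c b) = \<Union> (fmran' (fmmap bn b))"
| "bn (Sess k f P) = insert k (bn P)"
| "bn (Res k P) = insert k (bn P)"

text \<open>
  Simultaneous channel substitution. It leaves bound occurrences alone but does not rename binders;
  every use below is free of capture.
\<close>

definition fix_on :: "chan set \<Rightarrow> (chan \<Rightarrow> chan) \<Rightarrow> chan \<Rightarrow> chan" where
  "fix_on A \<sigma> c = (if c \<in> A then c else \<sigma> c)"

primrec csub :: "('l, 'g, 'e) proc \<Rightarrow> (chan \<Rightarrow> chan) \<Rightarrow> ('l, 'g, 'e) proc" where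
  "csub PNil \<sigma> = PNil"
| "csub (Par P Q) \<sigma> = Par (csub P \<sigma>) (csub Q \<sigma>)"
| "csub (Request a S k P) \<sigma> = Request a S k (csub P (fix_on {Bare k} \<sigma>))"
| "csub (Accept a S k P) \<sigma> = Accept a S k (csub P (fix_on {Bare k} \<sigma>))"
| "csub (Out c e P) \<sigma> = Out (\<sigma> c) e (csub P \<sigma>)"
| "csub (In c x P) \<sigma> = In (\<sigma> c) x (csub P \<sigma>)"
| "csub (Throw c d P) \<sigma> = Throw (\<sigma> c) (\<sigma> d) (csub P \<sigma>)"
| "csub (Catch c k P) \<sigma> = Catch (\<sigma> c) k (csub P (fix_on {Bare k} \<sigma>))"
| "csub (Select c l P) \<sigma> = Select (\<sigma> c) l (csub P \<sigma>)"
| "csub (Branch c b) \<sigma> = Branch (\<sigma> c) (fmmap (\<lambda>P. csub P \<sigma>) b)"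
| "csub (Speculate c b) \<sigma> = Speculate (\<sigma> c) (fmmap (\<lambda>P. csub P \<sigma>) b)"
| "csub (Sess k f P) \<sigma> = Sess k f (csub P (fix_on (chans k) \<sigma>))"
| "csub (Res k P) \<sigma> = Res k (csub P (fix_on (chans k) \<sigma>))"

text \<open>\<open>polarize k p P\<close> is \<open>P{k\<^sup>p/k}\<close>; \<open>rename_bare k k' P\<close> is \<open>P{k'/k}\<close>, with \<open>k\<^sup>\<plusminus>\<close> untouched.\<close>

definition polarize :: "name \<Rightarrow> pol \<Rightarrow> ('l, 'g, 'e) proc \<Rightarrow> ('l, 'g, 'e) proc" where
  "polarize k p P = csub P (id(Bare k := Pol k p))"

definition rename_bare :: "name \<Rightarrow> name \<Rightarrow> ('l, 'g, 'e) proc \<Rightarrow> ('l, 'g, 'e) proc" where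
  "rename_bare k k' P = csub P (id(Bare k := Bare k'))"

definition rename_all :: "name \<Rightarrow> name \<Rightarrow> ('l, 'g, 'e) proc \<Rightarrow> ('l, 'g, 'e) proc" where
  "rename_all k k' P =
     csub P (id(Bare k := Bare k', Pol k Plus := Pol k' Plus, Pol k Minus := Pol k' Minus))"

section \<open>Structural congruence\<close>

text \<open>The least congruence containing the relation \<open>A\<close>.\<close>

inductive congr ::
  "(('l, 'g, 'e) proc \<Rightarrow> ('l, 'g, 'e) proc \<Rightarrow> bool)
     \<Rightarrow> ('l, 'g, 'e) proc \<Rightarrow> ('l, 'g, 'e) proc \<Rightarrow> bool"
  for A
where
  congr_base: "A P Q \<Longrightarrow> congr A P Q"
| congr_refl: "congr A P P"
| congr_sym: "congr A P Q \<Longrightarrow> congr A Q P"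
| congr_trans: "congr A P Q \<Longrightarrow> congr A Q R \<Longrightarrow> congr A P R"
| congr_par: "congr A P P' \<Longrightarrow> congr A Q Q' \<Longrightarrow> congr A (Par P Q) (Par P' Q')"
| congr_request: "congr A P P' \<Longrightarrow> congr A (Request a S k P) (Request a S k P')"
| congr_accept: "congr A P P' \<Longrightarrow> congr A (Accept a S k P) (Accept a S k P')"
| congr_out: "congr A P P' \<Longrightarrow> congr A (Out c e P) (Out c e P')"
| congr_in: "congr A P P' \<Longrightarrow> congr A (In c x P) (In c x P')"
| congr_throw: "congr A P P' \<Longrightarrow> congr A (Throw c d P) (Throw c d P')"
| congr_catch: "congr A P P' \<Longrightarrow> congr A (Catch c k P) (Catch c k P')"
| congr_select: "congr A P P' \<Longrightarrow> congr A (Select c l P) (Select c l P')"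
| congr_branch:
    "congr A P P' \<Longrightarrow> congr A (Branch c (fmupd l P b)) (Branch c (fmupd l P' b))"
| congr_speculate:
    "congr A P P' \<Longrightarrow> congr A (Speculate c (fmupd l P b)) (Speculate c (fmupd l P' b))"
| congr_sess: "congr A P P' \<Longrightarrow> congr A (Sess k f P) (Sess k f P')"
| congr_res: "congr A P P' \<Longrightarrow> congr A (Res k P) (Res k P')"

text \<open>
  The condition on \<open>bn\<close> rules out capture; a name bound deeper inside can be renamed first.
  For the binders of an unpolarized \<open>k\<close> the new name \<open>k'\<close> may occur polarized in the body. Delegation
  needs this when the receiver already owns the other endpoint of the delegated session.
\<close>

inductive alpha_step :: "('l, 'g, 'e) proc \<Rightarrow> ('l, 'g, 'e) proc \<Rightarrow> bool" where
  alpha_request: "Bare k' \<notin> fc P \<Longrightarrow> k' \<notin> bn P \<Longrightarrow>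
    alpha_step (Request a S k P) (Request a S k' (rename_bare k k' P))"
| alpha_accept: "Bare k' \<notin> fc P \<Longrightarrow> k' \<notin> bn P \<Longrightarrow>
    alpha_step (Accept a S k P) (Accept a S k' (rename_bare k k' P))"
| alpha_catch: "Bare k' \<notin> fc P \<Longrightarrow> k' \<notin> bn P \<Longrightarrow>
    alpha_step (Catch c k P) (Catch c k' (rename_bare k k' P))"
| alpha_sess: "chans k' \<inter> fc P = {} \<Longrightarrow> k' \<notin> bn P \<Longrightarrow>
    alpha_step (Sess k f P) (Sess k' f (rename_all k k' P))"
| alpha_res: "chans k' \<inter> fc P = {} \<Longrightarrow> k' \<notin> bn P \<Longrightarrow>
    alpha_step (Res k P) (Res k' (rename_all k k' P))"

text \<open>
  In \<open>struct_extrude\<close>, \<open>k \<noteq> k'\<close> is the usual convention that distinct binders bind distinct names: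
  otherwise the occurrences of \<open>k'\<close> in \<open>Q'\<close> would change binder.
\<close>

inductive struct_step :: "('l, 'g, 'e) proc \<Rightarrow> ('l, 'g, 'e) proc \<Rightarrow> bool" where
  struct_alpha: "alpha_step P Q \<Longrightarrow> struct_step P Q"
| struct_extrude: "k \<noteq> k' \<Longrightarrow> chans k \<inter> fc R = {} \<Longrightarrow> chans k' \<inter> fc Q = {} \<Longrightarrow>
    struct_step (Sess k f (Par Q (Sess k' g (Par Q' R))))
                (Sess k' g (Par (Sess k f (Par Q Q')) R))"
| struct_comm: "struct_step (Par P Q) (Par Q P)"
| struct_assoc: "struct_step (Par (Par P Q) R) (Par P (Par Q R))"

abbreviation alpha_eq :: "('l, 'g, 'e) proc \<Rightarrow> ('l, 'g, 'e) proc \<Rightarrow> bool" where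
  "alpha_eq \<equiv> congr alpha_step"

abbreviation struct_congr :: "('l, 'g, 'e) proc \<Rightarrow> ('l, 'g, 'e) proc \<Rightarrow> bool" where
  "struct_congr \<equiv> congr struct_step"

section \<open>Expressions\<close>

text \<open>
  The expression language is a parameter: a typing judgement, an evaluation relation and
  the substitution \<open>esub e x v\<close> of \<open>v\<close> for \<open>x\<close> in \<open>e\<close>. Typing is preserved by evaluation;
  results of evaluation are closed, so their types do not depend on the environment; and
  substituting such a result for a variable of its type preserves typing.
\<close>

locale expression_language =
  fixes etyp :: "(var \<rightharpoonup> 'g) \<Rightarrow> 'e \<Rightarrow> 'g \<Rightarrow> bool"
    and eval :: "'e \<Rightarrow> 'e \<Rightarrow> bool"
    and esub :: "'e \<Rightarrow> var \<Rightarrow> 'e \<Rightarrow> 'e"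
  assumes preservation: "etyp \<Gamma> e G \<Longrightarrow> eval e v \<Longrightarrow> etyp \<Gamma> v G"
    and value_closed: "eval e v \<Longrightarrow> etyp \<Gamma> v G \<Longrightarrow> etyp \<Gamma>' v G"
    and substitution:
      "eval e v \<Longrightarrow> etyp \<Gamma> v G \<Longrightarrow> etyp (\<Gamma>(x \<mapsto> G)) e' G' \<Longrightarrow> etyp \<Gamma> (esub e' x v) G'"

primrec vsub ::
  "('e \<Rightarrow> var \<Rightarrow> 'e \<Rightarrow> 'e) \<Rightarrow> var \<Rightarrow> 'e \<Rightarrow> ('l, 'g, 'e) proc \<Rightarrow> ('l, 'g, 'e) proc"
where
  "vsub esub x v PNil = PNil"
| "vsub esub x v (Par P Q) = Par (vsub esub x v P) (vsub esub x v Q)"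
| "vsub esub x v (Request a S k P) = Request a S k (vsub esub x v P)"
| "vsub esub x v (Accept a S k P) = Accept a S k (vsub esub x v P)"
| "vsub esub x v (Out c e P) = Out c (esub e x v) (vsub esub x v P)"
| "vsub esub x v (In c y P) = In c y (if y = x then P else vsub esub x v P)"
| "vsub esub x v (Throw c d P) = Throw c d (vsub esub x v P)"
| "vsub esub x v (Catch c k P) = Catch c k (vsub esub x v P)"
| "vsub esub x v (Select c l P) = Select c l (vsub esub x v P)"
| "vsub esub x v (Branch c b) = Branch c (fmmap (vsub esub x v) b)"
| "vsub esub x v (Speculate c b) = Speculate c (fmmap (vsub esub x v) b)"
| "vsub esub x v (Sess k f P) = Sess k f (vsub esub x v P)"
| "vsub esub x v (Res k P) = Res k (vsub esub x v P)"

section \<open>Typing\<close>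

type_synonym ('l, 'g) senv = "(name \<times> pol, ('l, 'g) stype) fmap"

text \<open>
  \<open>\<Delta>\<cdot>\<Delta>'\<close> is a disjoint union, whence the domain conditions. Processes are typed up to
  \<open>\<alpha>\<close>-conversion (\<open>t_alpha\<close>): otherwise a bound name occurring by accident in \<open>\<Delta>\<close>, which may contain
  unused channels of type \<open>End\<close>, would make the judgement depend on the choice of bound names.
  In the rules for the binders of an unpolarized \<open>k\<close>, the condition on \<open>fc\<close> is the convention that
  the \<open>k\<^sup>p\<close> substituted for \<open>k\<close> is not already free in the body.
\<close>

inductive typed ::
  "((var \<rightharpoonup> 'g) \<Rightarrow> 'e \<Rightarrow> 'g \<Rightarrow> bool) \<Rightarrow> (var \<rightharpoonup> 'g) \<Rightarrow> ('l, 'g, 'e) proc \<Rightarrow> ('l, 'g) senv \<Rightarrow> bool"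
  for etyp
where
  t_nil: "(\<forall>S \<in> fmran' \<Delta>. S = End) \<Longrightarrow> typed etyp \<Gamma> PNil \<Delta>"
| t_par:
    "\<lbrakk>typed etyp \<Gamma> P \<Delta>; typed etyp \<Gamma> Q \<Delta>'; fmdom \<Delta> |\<inter>| fmdom \<Delta>' = {||}\<rbrakk>
     \<Longrightarrow> typed etyp \<Gamma> (Par P Q) (\<Delta> ++\<^sub>f \<Delta>')"
| t_accept:
    "\<lbrakk>Pol k Plus \<notin> fc P; (k, Plus) |\<notin>| fmdom \<Delta>;
      typed etyp \<Gamma> (polarize k Plus P) (fmupd (k, Plus) S \<Delta>)\<rbrakk>
     \<Longrightarrow> typed etyp \<Gamma> (Accept a S k P) \<Delta>"
| t_request:
    "\<lbrakk>Pol k Minus \<notin> fc P; (k, Minus) |\<notin>| fmdom \<Delta>;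
      typed etyp \<Gamma> (polarize k Minus P) (fmupd (k, Minus) S \<Delta>)\<rbrakk>
     \<Longrightarrow> typed etyp \<Gamma> (Request a S k P) \<Delta>"
| t_in:
    "\<lbrakk>(k, p) |\<notin>| fmdom \<Delta>; typed etyp (\<Gamma>(x \<mapsto> G)) P (fmupd (k, p) S \<Delta>)\<rbrakk>
     \<Longrightarrow> typed etyp \<Gamma> (In (Pol k p) x P) (fmupd (k, p) (InG G S) \<Delta>)"
| t_out:
    "\<lbrakk>(k, p) |\<notin>| fmdom \<Delta>; etyp \<Gamma> e G; typed etyp \<Gamma> P (fmupd (k, p) S \<Delta>)\<rbrakk>
     \<Longrightarrow> typed etyp \<Gamma> (Out (Pol k p) e P) (fmupd (k, p) (OutG G S) \<Delta>)"
| t_catch: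
    "\<lbrakk>Pol k' q \<notin> fc P; (k, p) |\<notin>| fmdom \<Delta>; (k', q) |\<notin>| fmdom \<Delta>; (k, p) \<noteq> (k', q);
      typed etyp \<Gamma> (polarize k' q P) (fmupd (k', q) S\<^sub>1 (fmupd (k, p) S\<^sub>2 \<Delta>))\<rbrakk>
     \<Longrightarrow> typed etyp \<Gamma> (Catch (Pol k p) k' P) (fmupd (k, p) (InS S\<^sub>1 q S\<^sub>2) \<Delta>)"
| t_throw:
    "\<lbrakk>(k, p) |\<notin>| fmdom \<Delta>; (k', q) |\<notin>| fmdom \<Delta>; (k, p) \<noteq> (k', q);
      typed etyp \<Gamma> P (fmupd (k, p) S\<^sub>2 \<Delta>)\<rbrakk>
     \<Longrightarrow> typed etyp \<Gamma> (Throw (Pol k p) (Pol k' q) P)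
           (fmupd (k', q) S\<^sub>1 (fmupd (k, p) (OutS S\<^sub>1 q S\<^sub>2) \<Delta>))"
  \<comment> \<open>\<open>s\<close> is the family \<open>S\<^sub>i\<close> for all \<open>i \<in> I\<close>, and \<open>s'\<close> its restriction to \<open>J\<close>.\<close>
| t_branch:
    "\<lbrakk>(k, p) |\<notin>| fmdom \<Delta>; fmdom s = fmdom b; s' \<noteq> fmempty; s' \<subseteq>\<^sub>f s;
      \<And>l P S. \<lbrakk>fmlookup b l = Some P; fmlookup s l = Some S\<rbrakk>
        \<Longrightarrow> typed etyp \<Gamma> P (fmupd (k, p) S \<Delta>)\<rbrakk>
     \<Longrightarrow> typed etyp \<Gamma> (Branch (Pol k p) b) (fmupd (k, p) (Bra s') \<Delta>)"
| t_select:
    "\<lbrakk>(k, p) |\<notin>| fmdom \<Delta>; fmlookup s l = Some S; typed etyp \<Gamma> P (fmupd (k, p) S \<Delta>)\<rbrakk>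
     \<Longrightarrow> typed etyp \<Gamma> (Select (Pol k p) l P) (fmupd (k, p) (Sel s) \<Delta>)"
| t_speculate:
    "\<lbrakk>(k, p) |\<notin>| fmdom \<Delta>; fmdom s = fmdom b; s \<noteq> fmempty;
      \<And>l P S. \<lbrakk>fmlookup b l = Some P; fmlookup s l = Some S\<rbrakk>
        \<Longrightarrow> typed etyp \<Gamma> P (fmupd (k, p) S \<Delta>)\<rbrakk>
     \<Longrightarrow> typed etyp \<Gamma> (Speculate (Pol k p) b) (fmupd (k, p) (Spec s) \<Delta>)"
| t_sess:
    "\<lbrakk>(k, Minus) |\<notin>| fmdom \<Delta>; (k, Plus) |\<notin>| fmdom \<Delta>; comply f S\<^sub>1 S\<^sub>2;
      typed etyp \<Gamma> P (fmupd (k, Plus) S\<^sub>2 (fmupd (k, Minus) S\<^sub>1 \<Delta>))\<rbrakk>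
     \<Longrightarrow> typed etyp \<Gamma> (Sess k f P) \<Delta>"
| t_res:
    "\<lbrakk>(k, Minus) |\<notin>| fmdom \<Delta>; (k, Plus) |\<notin>| fmdom \<Delta>; typed etyp \<Gamma> P \<Delta>\<rbrakk>
     \<Longrightarrow> typed etyp \<Gamma> (Res k P) \<Delta>"
| t_alpha: "alpha_eq P P' \<Longrightarrow> typed etyp \<Gamma> P' \<Delta> \<Longrightarrow> typed etyp \<Gamma> P \<Delta>"

section \<open>Reduction\<close>

text \<open>
  The condition on \<open>fc\<close> in \<open>red_link\<close> keeps the new restriction from capturing free channels; it can
  always be met by \<open>\<alpha>\<close>-conversion. The shared names \<open>a\<close> and \<open>b\<close> need not agree: interaction is
  governed by compliance alone.
\<close>

inductive red ::
  "('e \<Rightarrow> 'e \<Rightarrow> bool) \<Rightarrow> ('e \<Rightarrow> var \<Rightarrow> 'e \<Rightarrow> 'e) \<Rightarrow> ('l, 'g, 'e) proc \<Rightarrow> ('l, 'g, 'e) proc \<Rightarrow> bool"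
  for eval esub
where
  red_link:
    "\<lbrakk>comply f S S'; {Pol k Plus, Pol k Minus} \<inter> (fc P \<union> fc Q) = {}\<rbrakk>
     \<Longrightarrow> red eval esub (Par (Request a S k P) (Accept b S' k Q))
           (Sess k f (Par (polarize k Minus P) (polarize k Plus Q)))"
| red_comm:
    "eval e v \<Longrightarrow>
     red eval esub (Sess k (Tick f) (Par (Out (Pol k p) e P) (In (Pol k (co p)) x Q)))
       (Sess k f (Par P (vsub esub x v Q)))"
| red_deleg:
    "red eval esub
       (Sess k (Tick f) (Par (Throw (Pol k p) (Pol k' q) P) (Catch (Pol k (co p)) k' Q)))
       (Sess k f (Par P (polarize k' q Q)))"
| red_select:
    "\<lbrakk>fmlookup m l = Some f; fmlookup b l = Some Q\<rbrakk>
     \<Longrightarrow> red eval esub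
           (Sess k (osum m) (Par (Select (Pol k p) l P) (Branch (Pol k (co p)) b)))
           (Sess k f (Par P Q))"
| red_speculate:
    "\<lbrakk>fmlookup m l = Some f; fmlookup b l = Some P; fmlookup b' l = Some Q\<rbrakk>
     \<Longrightarrow> red eval esub
           (Sess k (oplus m) (Par (Speculate (Pol k p) b) (Branch (Pol k (co p)) b')))
           (Sess k f (Par P Q))"
| red_par: "red eval esub P P' \<Longrightarrow> red eval esub (Par P Q) (Par P' Q)"
| red_sess: "red eval esub P P' \<Longrightarrow> red eval esub (Sess k f P) (Sess k f P')"
| red_res: "red eval esub P P' \<Longrightarrow> red eval esub (Res k P) (Res k P')"
| red_struct:
    "\<lbrakk>struct_congr P P'; red eval esub P' Q'; struct_congr Q' Q\<rbrakk> \<Longrightarrow> red eval esub P Q"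

end

theory Submission
  imports Defs
begin

text \<open>
  The rule \<open>t_alpha\<close> makes \<open>typed\<close> awkward to invert, so typing is replaced by an equivalent
  syntax-directed judgement \<open>ityped\<close>, in which a process is typed under an interpretation \<open>\<rho>\<close> of its
  channels as endpoints. Substitution of channels becomes composition with \<open>\<rho>\<close>, whence invariance
  under \<open>\<alpha>\<close>-conversion. Endpoints of the environment can be renamed injectively, and those not used by
  the process necessarily have type \<open>End\<close>, so they can be added, dropped, or moved between parallel
  components; this gives invariance under scope extrusion. Subject reduction for \<open>ityped\<close> is then a case
  analysis in which compliance relates the types of the two endpoints of the session. Conversely,
  \<open>ityped\<close> implies \<open>typed\<close> by renaming every binder to a fresh name.
\<close>

text \<open>A derivation of \<open>typed\<close> may end in \<open>t_alpha\<close>, so inverting it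
  speaks only of some \<alpha>-variant of the process; the rules of \<open>ityped\<close> instead
  hide an existentially chosen endpoint at each binder. The obstacle is then that two derivations to
  be combined may have chosen different endpoints, or ones that clash with the environment needed
  next. The remedy is a single transport result, \<open>ityped_map\<close>, whose generality comes
  from its own induction: a binder extends the renaming by a pair of an old and a new endpoint, and
  a parallel composition cuts down the set of retained endpoints and puts the extra ones on one
  side. Only endpoints of type \<open>End\<close> can be added or moved, since every other type has
  to be consumed by a prefix and \<open>PNil\<close> accepts nothing but \<open>End\<close>.
  Environments of \<open>ityped\<close> are partial functions, so that splitting one is restriction
  to a set and to its complement. Finiteness, which guarantees fresh names, is demanded at
  \<open>PNil\<close> and inherited upwards.\<close>

definition bind_all :: "name \<Rightarrow> name \<Rightarrow> (chan \<Rightarrow> chan) \<Rightarrow> chan \<Rightarrow> chan" where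
  "bind_all k n \<rho> = \<rho>(Bare k := Bare n, Pol k Plus := Pol n Plus, Pol k Minus := Pol n Minus)"

lemma Pol_in_chans [simp]: "Pol k p \<in> chans n \<longleftrightarrow> k = n"
  by (cases p) (auto simp: chans_def)

lemma Bare_in_chans [simp]: "Bare k \<in> chans n \<longleftrightarrow> k = n"
  by (auto simp: chans_def)

lemma bind_all_Pol [simp]: "bind_all k n \<rho> (Pol k p) = Pol n p"
  by (cases p) (auto simp: bind_all_def)

lemma bind_all_Bare [simp]: "bind_all k n \<rho> (Bare k) = Bare n"
  by (auto simp: bind_all_def)

lemma bind_all_other [simp]: "c \<notin> chans k \<Longrightarrow> bind_all k n \<rho> c = \<rho> c"
  by (auto simp: bind_all_def chans_def)

text \<open>The same construction is the interpretation below a restriction and the renaming of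
  \<alpha>-conversion. As an interpretation it sends \<open>Bare k\<close> to \<open>Bare n\<close>,
  which is no endpoint, so bare occurrences of a restricted name stay untypable.\<close>

lemma rename_all_bind_all: "rename_all k k' P = csub P (bind_all k k' id)"
  by (simp add: rename_all_def bind_all_def)

lemma chans_cases:
  assumes "c \<in> chans k"
  obtains "c = Bare k" | p where "c = Pol k p"
  using assms by (auto simp: chans_def)

text \<open>
  \<open>ityped etyp \<Gamma> \<rho> P \<Delta>\<close> stands for the typing of \<open>P\<close> after capture-avoiding substitution of \<open>\<rho>\<close>:
  \<open>\<rho>\<close> sends the channels of \<open>P\<close> to endpoints in \<open>\<Delta>\<close>, and a binder extends \<open>\<rho>\<close> by an endpoint fresh
  for \<open>\<Delta>\<close> and for the image of \<open>\<rho>\<close>. The name of the binder is thus immaterial, and no \<open>\<alpha>\<close>-rule is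
  needed.
\<close>

inductive ityped ::
  "((var \<rightharpoonup> 'g) \<Rightarrow> 'e \<Rightarrow> 'g \<Rightarrow> bool) \<Rightarrow> (var \<rightharpoonup> 'g) \<Rightarrow> (chan \<Rightarrow> chan) \<Rightarrow> ('l, 'g, 'e) proc
     \<Rightarrow> (name \<times> pol \<rightharpoonup> ('l, 'g) stype) \<Rightarrow> bool"
  for etyp
where
  i_nil: "\<lbrakk>finite (dom \<Delta>); \<forall>S \<in> ran \<Delta>. S = End\<rbrakk> \<Longrightarrow> ityped etyp \<Gamma> \<rho> PNil \<Delta>"
| i_par:
    "\<lbrakk>ityped etyp \<Gamma> \<rho> P (\<Delta> |` A); ityped etyp \<Gamma> \<rho> Q (\<Delta> |` (- A))\<rbrakk>
     \<Longrightarrow> ityped etyp \<Gamma> \<rho> (Par P Q) \<Delta>"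
| i_accept:
    "\<lbrakk>(n, Plus) \<notin> dom \<Delta>; \<forall>c \<in> fc P - {Bare k}. \<rho> c \<noteq> Pol n Plus;
      ityped etyp \<Gamma> (\<rho>(Bare k := Pol n Plus)) P (\<Delta>((n, Plus) \<mapsto> S))\<rbrakk>
     \<Longrightarrow> ityped etyp \<Gamma> \<rho> (Accept a S k P) \<Delta>"
| i_request:
    "\<lbrakk>(n, Minus) \<notin> dom \<Delta>; \<forall>c \<in> fc P - {Bare k}. \<rho> c \<noteq> Pol n Minus;
      ityped etyp \<Gamma> (\<rho>(Bare k := Pol n Minus)) P (\<Delta>((n, Minus) \<mapsto> S))\<rbrakk>
     \<Longrightarrow> ityped etyp \<Gamma> \<rho> (Request a S k P) \<Delta>"
| i_in:
    "\<lbrakk>\<rho> c = Pol k p; \<Delta> (k, p) = Some (InG G S);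
      ityped etyp (\<Gamma>(x \<mapsto> G)) \<rho> P (\<Delta>((k, p) \<mapsto> S))\<rbrakk>
     \<Longrightarrow> ityped etyp \<Gamma> \<rho> (In c x P) \<Delta>"
| i_out:
    "\<lbrakk>\<rho> c = Pol k p; \<Delta> (k, p) = Some (OutG G S); etyp \<Gamma> e G;
      ityped etyp \<Gamma> \<rho> P (\<Delta>((k, p) \<mapsto> S))\<rbrakk>
     \<Longrightarrow> ityped etyp \<Gamma> \<rho> (Out c e P) \<Delta>"
| i_catch:
    "\<lbrakk>\<rho> c = Pol k p; \<Delta> (k, p) = Some (InS S\<^sub>1 q S\<^sub>2);
      (n, q) \<notin> dom \<Delta>; \<forall>d \<in> fc P - {Bare k'}. \<rho> d \<noteq> Pol n q;
      ityped etyp \<Gamma> (\<rho>(Bare k' := Pol n q)) P (\<Delta>((k, p) \<mapsto> S\<^sub>2, (n, q) \<mapsto> S\<^sub>1))\<rbrakk>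
     \<Longrightarrow> ityped etyp \<Gamma> \<rho> (Catch c k' P) \<Delta>"
| i_throw:
    "\<lbrakk>\<rho> c = Pol k p; \<rho> d = Pol k' q; (k, p) \<noteq> (k', q);
      \<Delta> (k, p) = Some (OutS S\<^sub>1 q S\<^sub>2); \<Delta> (k', q) = Some S\<^sub>1;
      ityped etyp \<Gamma> \<rho> P (\<Delta>((k, p) \<mapsto> S\<^sub>2, (k', q) := None))\<rbrakk>
     \<Longrightarrow> ityped etyp \<Gamma> \<rho> (Throw c d P) \<Delta>"
| i_branch:
    "\<lbrakk>\<rho> c = Pol k p; \<Delta> (k, p) = Some (Bra s'); fmdom s = fmdom b; s' \<noteq> fmempty; s' \<subseteq>\<^sub>f s;
      \<And>l P S. \<lbrakk>fmlookup b l = Some P; fmlookup s l = Some S\<rbrakk>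
        \<Longrightarrow> ityped etyp \<Gamma> \<rho> P (\<Delta>((k, p) \<mapsto> S))\<rbrakk>
     \<Longrightarrow> ityped etyp \<Gamma> \<rho> (Branch c b) \<Delta>"
| i_select:
    "\<lbrakk>\<rho> c = Pol k p; \<Delta> (k, p) = Some (Sel s); fmlookup s l = Some S;
      ityped etyp \<Gamma> \<rho> P (\<Delta>((k, p) \<mapsto> S))\<rbrakk>
     \<Longrightarrow> ityped etyp \<Gamma> \<rho> (Select c l P) \<Delta>"
| i_speculate:
    "\<lbrakk>\<rho> c = Pol k p; \<Delta> (k, p) = Some (Spec s); fmdom s = fmdom b; s \<noteq> fmempty;
      \<And>l P S. \<lbrakk>fmlookup b l = Some P; fmlookup s l = Some S\<rbrakk>
        \<Longrightarrow> ityped etyp \<Gamma> \<rho> P (\<Delta>((k, p) \<mapsto> S))\<rbrakk>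
     \<Longrightarrow> ityped etyp \<Gamma> \<rho> (Speculate c b) \<Delta>"
| i_sess:
    "\<lbrakk>(n, Minus) \<notin> dom \<Delta>; (n, Plus) \<notin> dom \<Delta>; \<forall>c \<in> fc P - chans k. \<forall>p. \<rho> c \<noteq> Pol n p;
      comply f S\<^sub>1 S\<^sub>2;
      ityped etyp \<Gamma> (bind_all k n \<rho>) P (\<Delta>((n, Minus) \<mapsto> S\<^sub>1, (n, Plus) \<mapsto> S\<^sub>2))\<rbrakk>
     \<Longrightarrow> ityped etyp \<Gamma> \<rho> (Sess k f P) \<Delta>"
| i_res:
    "\<lbrakk>(n, Minus) \<notin> dom \<Delta>; (n, Plus) \<notin> dom \<Delta>; ityped etyp \<Gamma> (bind_all k n \<rho>) P \<Delta>\<rbrakk>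
     \<Longrightarrow> ityped etyp \<Gamma> \<rho> (Res k P) \<Delta>"

inductive_simps ityped_nil: "ityped etyp \<Gamma> \<rho> PNil \<Delta>"
inductive_simps ityped_par: "ityped etyp \<Gamma> \<rho> (Par P Q) \<Delta>"
inductive_simps ityped_accept: "ityped etyp \<Gamma> \<rho> (Accept a S k P) \<Delta>"
inductive_simps ityped_request: "ityped etyp \<Gamma> \<rho> (Request a S k P) \<Delta>"
inductive_simps ityped_in: "ityped etyp \<Gamma> \<rho> (In c x P) \<Delta>"
inductive_simps ityped_out: "ityped etyp \<Gamma> \<rho> (Out c e P) \<Delta>"
inductive_simps ityped_catch: "ityped etyp \<Gamma> \<rho> (Catch c k P) \<Delta>"
inductive_simps ityped_throw: "ityped etyp \<Gamma> \<rho> (Throw c d P) \<Delta>"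
inductive_simps ityped_branch: "ityped etyp \<Gamma> \<rho> (Branch c b) \<Delta>"
inductive_simps ityped_select: "ityped etyp \<Gamma> \<rho> (Select c l P) \<Delta>"
inductive_simps ityped_speculate: "ityped etyp \<Gamma> \<rho> (Speculate c b) \<Delta>"
inductive_simps ityped_sess: "ityped etyp \<Gamma> \<rho> (Sess k f P) \<Delta>"
inductive_simps ityped_res: "ityped etyp \<Gamma> \<rho> (Res k P) \<Delta>"

lemmas ityped_simps = ityped_nil ityped_par ityped_accept ityped_request ityped_in ityped_out
  ityped_catch ityped_throw ityped_branch ityped_select ityped_speculate ityped_sess ityped_res

lemma finite_fmran' [simp]: "finite (fmran' m)"
  by (metis fmran'_alt_def finite_fset)

text \<open>The premises for \<open>Branch\<close> and \<open>Speculate\<close> quantify over labels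
  and would be vacuous on an empty family. The label obtained here provides one typed branch from
  which facts about the environment can be read off.\<close>

lemma nonempty_common_label:
  assumes "s \<noteq> fmempty" "fmdom s = fmdom b"
  obtains l S P where "fmlookup s l = Some S" "fmlookup b l = Some P"
proof -
  from assms(1) obtain l S where "fmlookup s l = Some S"
    by (metis fmempty_lookup fmap_ext not_Some_eq)
  moreover then obtain P where "fmlookup b l = Some P"
    using assms(2) by (metis fmlookup_dom_iff)
  ultimately show thesis using that by blast
qed

lemma fmsubset_lookup: "s' \<subseteq>\<^sub>f s \<Longrightarrow> fmlookup s' l = Some S \<Longrightarrow> fmlookup s l = Some S"
  by (auto simp: fmsubset.rep_eq map_le_def dom_def)

lemma fmsubset_nonempty: "s' \<noteq> fmempty \<Longrightarrow> s' \<subseteq>\<^sub>f s \<Longrightarrow> s \<noteq> fmempty"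
  using fmsubset_lookup[of s' fmempty] by (auto intro!: fmap_ext) fastforce

text \<open>Each prefix rule looks up the endpoint of its channel in \<open>\<Delta>\<close>. The
  endpoints that binders add on the way are excluded by the side conditions on
  \<open>\<rho>\<close>: no channel other than the bound one is interpreted as the new
  endpoint.\<close>

lemma ityped_fc:
  assumes "ityped etyp \<Gamma> \<rho> P \<Delta>" "c \<in> fc P"
  shows "\<exists>k p. \<rho> c = Pol k p \<and> (k, p) \<in> dom \<Delta>"
  using assms
proof (induction arbitrary: c rule: ityped.induct)
  case (i_par \<Gamma> \<rho> P \<Delta> A Q)
  then show ?case by fastforce
next
  case (i_accept n \<Delta> P k \<rho> \<Gamma> S a)
  then have c: "c \<in> fc P" "c \<noteq> Bare k" by auto
  then obtain m r where "\<rho> c = Pol m r" "(m, r) \<in> dom (\<Delta>((n, Plus) \<mapsto> S))"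
    using i_accept.IH[of c] by (fastforce simp del: dom_fun_upd)
  moreover have "\<rho> c \<noteq> Pol n Plus" using i_accept.hyps(2) c by blast
  ultimately show ?case by auto
next
  case (i_request n \<Delta> P k \<rho> \<Gamma> S a)
  then have c: "c \<in> fc P" "c \<noteq> Bare k" by auto
  then obtain m r where "\<rho> c = Pol m r" "(m, r) \<in> dom (\<Delta>((n, Minus) \<mapsto> S))"
    using i_request.IH[of c] by (fastforce simp del: dom_fun_upd)
  moreover have "\<rho> c \<noteq> Pol n Minus" using i_request.hyps(2) c by blast
  ultimately show ?case by auto
next
  case (i_in \<rho> c' k p \<Delta> G S \<Gamma> x P)
  then show ?case by (fastforce split: if_splits)
next
  case (i_out \<rho> c k p \<Delta> G S \<Gamma> e P)
  then show ?case by (fastforce split: if_splits)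
next
  case (i_catch \<rho> c' k p \<Delta> S\<^sub>1 q S\<^sub>2 n P k' \<Gamma>)
  show ?case
  proof (cases "c = c'")
    case False
    then have "c \<in> fc P" "c \<noteq> Bare k'" using i_catch.prems by auto
    then show ?thesis using i_catch.IH[of c] i_catch.hyps by (auto split: if_splits)
  qed (use i_catch.hyps in auto)
next
  case (i_throw \<rho> c' k p d k' q \<Delta> S\<^sub>1 S\<^sub>2 \<Gamma> P)
  show ?case
  proof (cases "c = c' \<or> c = d")
    case False
    then have "c \<in> fc P" using i_throw.prems by auto
    then show ?thesis using i_throw.IH[of c] i_throw.hyps by (auto split: if_splits)
  qed (use i_throw.hyps in auto)
next
  case (i_branch \<rho> c' k p \<Delta> s' s b \<Gamma>)
  show ?case
  proof (cases "c = c'")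
    case False
    then obtain l P where "fmlookup b l = Some P" "c \<in> fc P"
      using i_branch.prems by (auto simp: fmlookup_ran'_iff)
    \<comment> \<open>\<open>s\<close> covers all labels of \<open>b\<close>, including those
      missing from \<open>s'\<close>, so the branch that contains \<open>c\<close> has an induction
      hypothesis.\<close>
    moreover then obtain S where "fmlookup s l = Some S"
      using i_branch.hyps by (metis fmlookup_dom_iff)
    ultimately show ?thesis using i_branch.IH[of l P S c] i_branch.hyps(1,2)
      by (auto split: if_splits)
  qed (use i_branch.hyps in auto)
next
  case (i_select \<rho> c k p \<Delta> s l S \<Gamma> P)
  then show ?case by (fastforce split: if_splits)
next
  case (i_speculate \<rho> c' k p \<Delta> s b \<Gamma>)
  show ?case
  proof (cases "c = c'")
    case False
    then obtain l P where "fmlookup b l = Some P" "c \<in> fc P"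
      using i_speculate.prems by (auto simp: fmlookup_ran'_iff)
    moreover then obtain S where "fmlookup s l = Some S"
      using i_speculate.hyps by (metis fmlookup_dom_iff)
    ultimately show ?thesis using i_speculate.IH[of l P S c] i_speculate.hyps(1,2)
      by (auto split: if_splits)
  qed (use i_speculate.hyps in auto)
next
  case (i_sess n \<Delta> P k \<rho> f S\<^sub>1 S\<^sub>2 \<Gamma>)
  then have "c \<in> fc P" "c \<notin> chans k" by auto
  then show ?case using i_sess.IH[of c] i_sess.hyps(3) by (auto split: if_splits)
next
  case (i_res n \<Delta> \<Gamma> k \<rho> P)
  then have "c \<in> fc P" "c \<notin> chans k" by auto
  then show ?case using i_res.IH[of c] by auto
qed simp_all

text \<open>Finiteness is a premise of \<open>i_nil\<close> only; the other rules change the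
  environment at finitely many endpoints or split it in two.\<close>

lemma ityped_finite: "ityped etyp \<Gamma> \<rho> P \<Delta> \<Longrightarrow> finite (dom \<Delta>)"
proof (induction rule: ityped.induct)
  case (i_par \<Gamma> \<rho> P \<Delta> A Q)
  then have "finite (dom \<Delta> \<inter> A \<union> dom \<Delta> \<inter> - A)" by simp
  then show ?case by (simp flip: Int_Un_distrib)
next
  case (i_throw \<rho> c k p d k' q \<Delta> S\<^sub>1 S\<^sub>2 \<Gamma> P)
  then show ?case by (simp del: fun_upd_apply)
next
  case (i_branch \<rho> c k p \<Delta> s' s b \<Gamma>)
  obtain l S P where "fmlookup s l = Some S" "fmlookup b l = Some P"
    using nonempty_common_label i_branch.hyps(3-5) fmsubset_nonempty by metis
  then show ?case using i_branch.IH by fastforce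
next
  case (i_speculate \<rho> c k p \<Delta> s b \<Gamma>)
  obtain l S P where "fmlookup s l = Some S" "fmlookup b l = Some P"
    using nonempty_common_label i_speculate.hyps(3,4) by metis
  then show ?case using i_speculate.IH by fastforce
qed (simp_all del: fun_upd_apply)

lemma ityped_unused:
  assumes "ityped etyp \<Gamma> \<rho> P \<Delta>" "\<Delta> (m, r) = Some T" "\<forall>c \<in> fc P. \<rho> c \<noteq> Pol m r"
  shows "T = End"
  using assms
proof (induction arbitrary: T rule: ityped.induct)
  case (i_nil \<Delta> \<Gamma> \<rho>)
  then show ?case by (auto simp: ran_def)
next
  case (i_par \<Gamma> \<rho> P \<Delta> A Q)
  then show ?case by (cases "(m, r) \<in> A") (auto simp: restrict_map_def)
next
  case (i_accept n \<Delta> P k \<rho> \<Gamma> S a)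
  have "(m, r) \<noteq> (n, Plus)" using i_accept.prems i_accept.hyps by auto
  then show ?case using i_accept.prems by (intro i_accept.IH) auto
next
  case (i_request n \<Delta> P k \<rho> \<Gamma> S a)
  have "(m, r) \<noteq> (n, Minus)" using i_request.prems i_request.hyps by auto
  then show ?case using i_request.prems by (intro i_request.IH) auto
next
  case (i_catch \<rho> c' k p \<Delta> S\<^sub>1 q S\<^sub>2 n P k' \<Gamma>)
  have "(m, r) \<noteq> (n, q)" "(m, r) \<noteq> (k, p)" using i_catch.prems i_catch.hyps by auto
  then show ?case using i_catch.prems i_catch.hyps by (intro i_catch.IH) auto
next
  case (i_throw \<rho> c' k p d k' q \<Delta> S\<^sub>1 S\<^sub>2 \<Gamma> P)
  have "(m, r) \<noteq> (k', q)" "(m, r) \<noteq> (k, p)" using i_throw.prems i_throw.hyps by auto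
  then show ?case using i_throw.prems i_throw.hyps by (intro i_throw.IH) auto
next
  case (i_branch \<rho> c k p \<Delta> s' s b \<Gamma>)
  obtain l S P where l: "fmlookup s l = Some S" "fmlookup b l = Some P"
    using nonempty_common_label i_branch.hyps(3-5) fmsubset_nonempty by metis
  show ?case
    using i_branch.prems i_branch.hyps(1) fmran'I[OF l(2)]
    by (intro i_branch.IH[OF l(2,1)]) (auto simp: fmap.set_map)
next
  case (i_speculate \<rho> c k p \<Delta> s b \<Gamma>)
  obtain l S P where l: "fmlookup s l = Some S" "fmlookup b l = Some P"
    using nonempty_common_label i_speculate.hyps(3,4) by metis
  show ?case
    using i_speculate.prems i_speculate.hyps(1) fmran'I[OF l(2)]
    by (intro i_speculate.IH[OF l(2,1)]) (auto simp: fmap.set_map)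
next
  case (i_sess n \<Delta> P k \<rho> f S\<^sub>1 S\<^sub>2 \<Gamma>)
  then have mn: "m \<noteq> n" by (cases r) auto
  have "bind_all k n \<rho> c \<noteq> Pol m r" if "c \<in> fc P" for c
    using that mn i_sess.prems by (cases "c \<in> chans k") (auto elim!: chans_cases)
  then show ?case using i_sess.prems mn by (intro i_sess.IH) auto
next
  case (i_res n \<Delta> \<Gamma> k \<rho> P)
  then have mn: "m \<noteq> n" by (cases r) auto
  have "bind_all k n \<rho> c \<noteq> Pol m r" if "c \<in> fc P" for c
    using that mn i_res.prems by (cases "c \<in> chans k") (auto elim!: chans_cases)
  then show ?case using i_res.prems mn by (intro i_res.IH) auto
qed auto

section \<open>Changing the environment\<close>

text \<open>
  Renaming, weakening and strengthening at once: endpoints outside \<open>K\<close> are dropped, those in \<open>K\<close>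
  are renamed by \<open>\<pi>\<close>, and the other endpoints of \<open>\<Delta>'\<close> are new and unused, hence of type \<open>End\<close>.
  Polarities are preserved because a type \<open>InS S q S'\<close> records the polarity of what it receives.
\<close>

definition env_map ::
  "(name \<times> pol \<Rightarrow> name \<times> pol) \<Rightarrow> (name \<times> pol) set
     \<Rightarrow> (name \<times> pol \<rightharpoonup> ('l, 'g) stype) \<Rightarrow> (name \<times> pol \<rightharpoonup> ('l, 'g) stype) \<Rightarrow> bool" where
  "env_map \<pi> K \<Delta> \<Delta>' \<longleftrightarrow>
     finite (dom \<Delta>') \<and> K \<subseteq> dom \<Delta> \<and> inj_on \<pi> K \<and> (\<forall>e \<in> K. snd (\<pi> e) = snd e \<and> \<Delta>' (\<pi> e) = \<Delta> e) \<and>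
     (\<forall>e \<in> dom \<Delta>' - \<pi> ` K. \<Delta>' e = Some End)"

text \<open>\<open>X\<close> stands for the free channels of a process. Membership in
  \<open>K\<close> says that no endpoint in use is dropped, and the polarity can be written as
  \<open>p\<close> because \<open>env_map\<close> makes \<open>\<pi>\<close> preserve it.\<close>

definition chan_map ::
  "(name \<times> pol \<Rightarrow> name \<times> pol) \<Rightarrow> (name \<times> pol) set \<Rightarrow> chan set
     \<Rightarrow> (chan \<Rightarrow> chan) \<Rightarrow> (chan \<Rightarrow> chan) \<Rightarrow> bool" where
  "chan_map \<pi> K X \<rho> \<rho>' \<longleftrightarrow>
     (\<forall>c \<in> X. \<forall>k p. \<rho> c = Pol k p \<longrightarrow> (k, p) \<in> K \<and> \<rho>' c = Pol (fst (\<pi> (k, p))) p)"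

lemma env_map_upd:
  assumes "env_map \<pi> K \<Delta> \<Delta>'" "e \<in> K"
  shows "env_map \<pi> K (\<Delta>(e \<mapsto> S)) (\<Delta>'(\<pi> e \<mapsto> S))"
  using assms unfolding env_map_def
  by (auto dest: inj_onD)

lemma env_map_delete:
  assumes "env_map \<pi> K \<Delta> \<Delta>'" "e \<in> K"
  shows "env_map \<pi> (K - {e}) (\<Delta>(e := None)) (\<Delta>'(\<pi> e := None))"
  using assms unfolding env_map_def
  by (auto dest: inj_onD intro: inj_on_subset)

lemma env_map_insert:
  assumes "env_map \<pi> K \<Delta> \<Delta>'" "e \<notin> dom \<Delta>" "e' \<notin> dom \<Delta>'" "snd e' = snd e"
  shows "env_map (\<pi>(e := e')) (insert e K) (\<Delta>(e \<mapsto> S)) (\<Delta>'(e' \<mapsto> S))"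
proof -
  have "\<pi> x \<noteq> e'" if "x \<in> K" for x
    using assms(1,3) that unfolding env_map_def by (metis domIff subsetD)
  moreover have "e \<notin> K" using assms(1,2) unfolding env_map_def by auto
  ultimately show ?thesis
    using assms unfolding env_map_def by (auto simp: inj_on_def image_iff)
qed

text \<open>A split of \<open>\<Delta>\<close> has to induce a split of \<open>\<Delta>'\<close>.
  The additional \<open>End\<close> endpoints of \<open>\<Delta>'\<close> belong to neither image
  and all go to the left, which is why the left share is the complement of the image of
  \<open>K - A\<close> instead of the image of \<open>K \<inter> A\<close>.\<close>

lemma env_map_restrict:
  assumes "env_map \<pi> K \<Delta> \<Delta>'"
  shows "env_map \<pi> (K \<inter> A) (\<Delta> |` A) (\<Delta>' |` (- (\<pi> ` (K - A))))"
    and "env_map \<pi> (K \<inter> - A) (\<Delta> |` (- A)) (\<Delta>' |` (\<pi> ` (K - A)))"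
proof -
  note a = assms[unfolded env_map_def]
  have rest: "\<Delta>' e = Some End" if "e \<in> dom \<Delta>'" "e \<notin> \<pi> ` (K - A)" "e \<notin> \<pi> ` (K \<inter> A)" for e
    using that a by blast
  have in_A: "\<pi> e \<notin> \<pi> ` (K - A)" if "e \<in> K \<inter> A" for e
    using that a inj_on_image_mem_iff[of \<pi> K e "K - A"] by auto
  have inj: "inj_on \<pi> (K \<inter> A)" "inj_on \<pi> (K \<inter> - A)"
    using a by (meson inj_on_subset Int_lower1)+
  have dom: "K \<inter> A \<subseteq> dom (\<Delta> |` A)" "K \<inter> - A \<subseteq> dom (\<Delta> |` (- A))"
    using a by auto
  show "env_map \<pi> (K \<inter> A) (\<Delta> |` A) (\<Delta>' |` (- (\<pi> ` (K - A))))"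
    unfolding env_map_def
  proof (intro conjI ballI)
    fix e assume "e \<in> dom (\<Delta>' |` (- (\<pi> ` (K - A)))) - \<pi> ` (K \<inter> A)"
    then show "(\<Delta>' |` (- (\<pi> ` (K - A)))) e = Some End" using rest[of e] by auto
  qed (use a inj dom in_A in simp_all)
  show "env_map \<pi> (K \<inter> - A) (\<Delta> |` (- A)) (\<Delta>' |` (\<pi> ` (K - A)))"
    unfolding env_map_def using a inj dom by (simp add: Diff_eq)
qed

lemma chan_map_mono: "chan_map \<pi> K X \<rho> \<rho>' \<Longrightarrow> Y \<subseteq> X \<Longrightarrow> chan_map \<pi> K Y \<rho> \<rho>'"
  unfolding chan_map_def by blast

text \<open>After a split, \<open>env_map\<close> requires \<open>K\<close> to lie in the domain of
  the share. Cutting \<open>K\<close> down loses nothing, since the component uses only endpoints of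
  its share by \<open>ityped_fc\<close>.\<close>

lemma chan_map_restrict:
  assumes "chan_map \<pi> K (fc P) \<rho> \<rho>'" "ityped etyp \<Gamma> \<rho> P \<Delta>"
  shows "chan_map \<pi> (K \<inter> dom \<Delta>) (fc P) \<rho> \<rho>'"
  using assms ityped_fc[OF assms(2)] unfolding chan_map_def by fastforce

text \<open>Redirecting \<open>\<pi>\<close> at \<open>(n, p)\<close> is invisible to the other
  channels because none of them is interpreted as that endpoint.\<close>

lemma chan_map_bind:
  assumes "chan_map \<pi> K (X - {c}) \<rho> \<rho>'" "\<forall>d \<in> X - {c}. \<rho> d \<noteq> Pol n p"
  shows "chan_map (\<pi>((n, p) := (n', p))) (insert (n, p) K) X (\<rho>(c := Pol n p)) (\<rho>'(c := Pol n' p))"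
  using assms unfolding chan_map_def by auto

lemma chan_map_bind_all:
  assumes "chan_map \<pi> K (X - chans k) \<rho> \<rho>'" "\<forall>c \<in> X - chans k. \<forall>p. \<rho> c \<noteq> Pol n p"
  shows "chan_map (\<pi>((n, Minus) := (n', Minus), (n, Plus) := (n', Plus)))
           (insert (n, Plus) (insert (n, Minus) K)) X (bind_all k n \<rho>) (bind_all k n' \<rho>')"
  unfolding chan_map_def
proof (intro ballI allI impI)
  fix c m r
  assume c: "c \<in> X" "bind_all k n \<rho> c = Pol m r"
  show "(m, r) \<in> insert (n, Plus) (insert (n, Minus) K) \<and>
    bind_all k n' \<rho>' c = Pol (fst ((\<pi>((n, Minus) := (n', Minus), (n, Plus) := (n', Plus))) (m, r))) r"
  proof (cases "c \<in> chans k")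
    case True
    with c show ?thesis by (cases r) (auto elim!: chans_cases)
  next
    case False
    with c assms(2) have "m \<noteq> n" by auto
    with False c assms(1) show ?thesis unfolding chan_map_def by auto
  qed
qed

text \<open>The channels in use are sent by \<open>\<rho>'\<close> to images under
  \<open>\<pi>\<close>, which lie in the domain of \<open>\<Delta>'\<close>. So freshness for the
  new environment implies freshness for the new interpretation, which is the side condition of the
  binder rules.\<close>

lemma chan_map_fresh:
  assumes "chan_map \<pi> K X \<rho> \<rho>'" "env_map \<pi> K \<Delta> \<Delta>'" "(n', q) \<notin> dom \<Delta>'"
    and "\<And>c. c \<in> X \<Longrightarrow> \<exists>k p. \<rho> c = Pol k p \<and> (k, p) \<in> dom \<Delta>"
  shows "\<forall>c \<in> X. \<rho>' c \<noteq> Pol n' q"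
proof
  fix c assume c: "c \<in> X"
  then obtain k p where "\<rho> c = Pol k p" using assms(4) by blast
  then have kp: "(k, p) \<in> K" "\<rho>' c = Pol (fst (\<pi> (k, p))) p"
    using assms(1) c unfolding chan_map_def by auto
  then have "snd (\<pi> (k, p)) = p" "\<pi> (k, p) \<in> dom \<Delta>'"
    using assms(2) unfolding env_map_def by auto
  then show "\<rho>' c \<noteq> Pol n' q"
    using kp assms(3) by (cases "\<pi> (k, p)") auto
qed

lemma fresh_name:
  assumes "finite (dom (\<Delta> :: name \<times> pol \<rightharpoonup> 'a))" "finite (X :: chan set)" "finite (B :: name set)"
  obtains n where "\<And>p. (n, p) \<notin> dom \<Delta>" "\<And>p. Pol n p \<notin> X" "Bare n \<notin> X" "n \<notin> B"
proof -
  define nm where "nm c = (case c of Bare k \<Rightarrow> k | Pol k p \<Rightarrow> k)" for c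
  have "finite (fst ` dom \<Delta> \<union> nm ` X \<union> B)" using assms by auto
  then obtain n where "n \<notin> fst ` dom \<Delta> \<union> nm ` X \<union> B"
    using ex_new_if_finite infinite_UNIV_nat by metis
  then show thesis
    by (intro that[of n]) (force simp: nm_def image_iff)+
qed

lemma env_chan_map:
  assumes "env_map \<pi> K \<Delta> \<Delta>'" "chan_map \<pi> K X \<rho> \<rho>'" "c \<in> X" "\<rho> c = Pol k p"
  obtains k' where
    "(k, p) \<in> K" "\<rho>' c = Pol k' p" "\<pi> (k, p) = (k', p)" "\<Delta>' (k', p) = \<Delta> (k, p)"
proof -
  have kp: "(k, p) \<in> K" "\<rho>' c = Pol (fst (\<pi> (k, p))) p"
    using assms(2-4) unfolding chan_map_def by auto
  moreover have "snd (\<pi> (k, p)) = p" "\<Delta>' (\<pi> (k, p)) = \<Delta> (k, p)"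
    using assms(1) kp unfolding env_map_def by auto
  ultimately show thesis
    using that[of "fst (\<pi> (k, p))"] by (metis prod.collapse)
qed

lemma env_map_fresh:
  assumes "env_map \<pi> K \<Delta> \<Delta>'"
  obtains n where "\<And>p. (n, p) \<notin> dom \<Delta>'"
proof -
  have "finite (dom \<Delta>')" using assms by (simp add: env_map_def)
  from fresh_name[OF this finite.emptyI finite.emptyI] that show thesis by metis
qed

text \<open>At a binder the endpoint of the given derivation may already occur in
  \<open>\<Delta>'\<close>; it is traded for one fresh for \<open>\<Delta>'\<close> and the pair is
  recorded in \<open>\<pi>\<close>. This is why \<open>\<pi>\<close>, \<open>K\<close>,
  \<open>\<Delta>'\<close> and \<open>\<rho>'\<close> vary in the induction.\<close>

lemma ityped_map:
  assumes "ityped etyp \<Gamma> \<rho> P \<Delta>" "env_map \<pi> K \<Delta> \<Delta>'" "chan_map \<pi> K (fc P) \<rho> \<rho>'"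
  shows "ityped etyp \<Gamma> \<rho>' P \<Delta>'"
  using assms
proof (induction arbitrary: \<pi> K \<Delta>' \<rho>' rule: ityped.induct)
  case (i_nil \<Delta> \<Gamma> \<rho>)
  have "S = End" if "\<Delta>' e = Some S" for e S
  proof (cases "e \<in> \<pi> ` K")
    case True
    then obtain e' where "e' \<in> K" "e = \<pi> e'" by blast
    then have "\<Delta> e' = Some S" using that i_nil.prems(1) unfolding env_map_def by simp
    then show ?thesis using i_nil.hyps(2) by (meson ranI)
  next
    case False
    then have "\<Delta>' e = Some End" using that i_nil.prems(1) unfolding env_map_def by blast
    then show ?thesis using that by simp
  qed
  then show ?case using i_nil by (intro ityped.i_nil) (auto simp: ran_def env_map_def)
next
  case (i_par \<Gamma> \<rho> P \<Delta> A Q)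
  have K: "K \<subseteq> dom \<Delta>" using i_par.prems by (simp add: env_map_def)
  have "chan_map \<pi> (K \<inter> dom (\<Delta> |` A)) (fc P) \<rho> \<rho>'"
    "chan_map \<pi> (K \<inter> dom (\<Delta> |` (- A))) (fc Q) \<rho> \<rho>'"
    by (intro chan_map_restrict[OF _ i_par.hyps(1)] chan_map_restrict[OF _ i_par.hyps(2)]
        chan_map_mono[OF i_par.prems(2)]; simp)+
  then have c: "chan_map \<pi> (K \<inter> A) (fc P) \<rho> \<rho>'" "chan_map \<pi> (K \<inter> - A) (fc Q) \<rho> \<rho>'"
    using K by (simp_all add: Int_absorb2 flip: Int_assoc)
  have "ityped etyp \<Gamma> \<rho>' P (\<Delta>' |` (- (\<pi> ` (K - A))))"
    by (rule i_par.IH(1)[OF env_map_restrict(1)[OF i_par.prems(1)] c(1)])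
  moreover have "ityped etyp \<Gamma> \<rho>' Q (\<Delta>' |` (- (- (\<pi> ` (K - A)))))"
    using i_par.IH(2)[OF env_map_restrict(2)[OF i_par.prems(1)] c(2)] by simp
  ultimately show ?case by (rule ityped.i_par)
next
  case (i_accept n \<Delta> P k \<rho> \<Gamma> S a)
  obtain n' where n': "\<And>p. (n', p) \<notin> dom \<Delta>'"
    using env_map_fresh[OF i_accept.prems(1)] by blast
  have c: "chan_map \<pi> K (fc P - {Bare k}) \<rho> \<rho>'" using i_accept.prems(2) by simp
  show ?case
  proof (rule ityped.i_accept[OF n'])
    show "\<forall>c\<in>fc P - {Bare k}. \<rho>' c \<noteq> Pol n' Plus"
      by (rule chan_map_fresh[OF c i_accept.prems(1) n'])
        (auto intro!: ityped_fc[OF ityped.i_accept[OF i_accept.hyps]])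
    show "ityped etyp \<Gamma> (\<rho>'(Bare k := Pol n' Plus)) P (\<Delta>'((n', Plus) \<mapsto> S))"
      by (rule i_accept.IH[OF env_map_insert[OF i_accept.prems(1) i_accept.hyps(1) n']
            chan_map_bind[OF c i_accept.hyps(2)]]) simp
  qed
next
  case (i_request n \<Delta> P k \<rho> \<Gamma> S a)
  obtain n' where n': "\<And>p. (n', p) \<notin> dom \<Delta>'"
    using env_map_fresh[OF i_request.prems(1)] by blast
  have c: "chan_map \<pi> K (fc P - {Bare k}) \<rho> \<rho>'" using i_request.prems(2) by simp
  show ?case
  proof (rule ityped.i_request[OF n'])
    show "\<forall>c\<in>fc P - {Bare k}. \<rho>' c \<noteq> Pol n' Minus"
      by (rule chan_map_fresh[OF c i_request.prems(1) n'])
        (auto intro!: ityped_fc[OF ityped.i_request[OF i_request.hyps]])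
    show "ityped etyp \<Gamma> (\<rho>'(Bare k := Pol n' Minus)) P (\<Delta>'((n', Minus) \<mapsto> S))"
      by (rule i_request.IH[OF env_map_insert[OF i_request.prems(1) i_request.hyps(1) n']
            chan_map_bind[OF c i_request.hyps(2)]]) simp
  qed
next
  case (i_in \<rho> c k p \<Delta> G S \<Gamma> x P)
  obtain k' where k': "(k, p) \<in> K" "\<rho>' c = Pol k' p" "\<pi> (k, p) = (k', p)" "\<Delta>' (k', p) = \<Delta> (k, p)"
    by (rule env_chan_map[OF i_in.prems _ i_in.hyps(1)]) auto
  show ?case
    using k' i_in.hyps(2) i_in.IH[OF env_map_upd[OF i_in.prems(1) k'(1)] chan_map_mono[OF i_in.prems(2)]]
    by (intro ityped.i_in[of \<rho>' c k' p]) (auto simp del: fun_upd_apply)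
next
  case (i_out \<rho> c k p \<Delta> G S \<Gamma> e P)
  obtain k' where k': "(k, p) \<in> K" "\<rho>' c = Pol k' p" "\<pi> (k, p) = (k', p)" "\<Delta>' (k', p) = \<Delta> (k, p)"
    by (rule env_chan_map[OF i_out.prems _ i_out.hyps(1)]) auto
  show ?case
    using k' i_out.hyps(2,3) i_out.IH[OF env_map_upd[OF i_out.prems(1) k'(1)] chan_map_mono[OF i_out.prems(2)]]
    by (intro ityped.i_out[of \<rho>' c k' p]) (auto simp del: fun_upd_apply)
next
  case (i_catch \<rho> c k p \<Delta> S\<^sub>1 q S\<^sub>2 n P x \<Gamma>)
  obtain k' where k': "(k, p) \<in> K" "\<rho>' c = Pol k' p" "\<pi> (k, p) = (k', p)" "\<Delta>' (k', p) = \<Delta> (k, p)"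
    by (rule env_chan_map[OF i_catch.prems _ i_catch.hyps(1)]) auto
  obtain n' where n': "\<And>p. (n', p) \<notin> dom \<Delta>'"
    using env_map_fresh[OF i_catch.prems(1)] by blast
  have nk: "(n, q) \<noteq> (k, p)" "(n', q) \<noteq> (k', p)" using i_catch.hyps(2,3) n' k'(4) by auto
  have n'k: "(n', q) \<notin> dom (\<Delta>'(\<pi> (k, p) \<mapsto> S\<^sub>2))" "(n, q) \<notin> dom (\<Delta>((k, p) \<mapsto> S\<^sub>2))"
    using n' nk k'(3) i_catch.hyps(3) by auto
  have cm: "chan_map \<pi> K (fc P - {Bare x}) \<rho> \<rho>'"
    by (rule chan_map_mono[OF i_catch.prems(2)]) auto
  show ?case
  proof (rule ityped.i_catch[of \<rho>' c k' p \<Delta>' S\<^sub>1 q S\<^sub>2 n'])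
    show "\<forall>d\<in>fc P - {Bare x}. \<rho>' d \<noteq> Pol n' q"
      by (rule chan_map_fresh[OF cm i_catch.prems(1) n'])
        (auto intro!: ityped_fc[OF ityped.i_catch[OF i_catch.hyps]])
    show "ityped etyp \<Gamma> (\<rho>'(Bare x := Pol n' q)) P (\<Delta>'((k', p) \<mapsto> S\<^sub>2, (n', q) \<mapsto> S\<^sub>1))"
      using i_catch.IH[OF env_map_insert[OF env_map_upd[OF i_catch.prems(1) k'(1)] n'k(2,1)]
            chan_map_bind[OF cm i_catch.hyps(4)]] k'(3) by (simp del: fun_upd_apply)
  qed (use k' n' i_catch.hyps in auto)
next
  case (i_throw \<rho> c k p d m q \<Delta> S\<^sub>1 S\<^sub>2 \<Gamma> P)
  obtain k' where k': "(k, p) \<in> K" "\<rho>' c = Pol k' p" "\<pi> (k, p) = (k', p)" "\<Delta>' (k', p) = \<Delta> (k, p)"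
    by (rule env_chan_map[OF i_throw.prems _ i_throw.hyps(1)]) auto
  obtain m' where m': "(m, q) \<in> K" "\<rho>' d = Pol m' q" "\<pi> (m, q) = (m', q)" "\<Delta>' (m', q) = \<Delta> (m, q)"
    by (rule env_chan_map[OF i_throw.prems _ i_throw.hyps(2)]) auto
  \<comment> \<open>Injectivity keeps the delegated endpoint distinct from the one that carries
    it.\<close>
  have "inj_on \<pi> K" using i_throw.prems(1) by (simp add: env_map_def)
  then have neq: "(k', p) \<noteq> (m', q)"
    using k'(1,3) m'(1,3) i_throw.hyps(3) by (metis inj_onD)
  have "env_map \<pi> (K - {(m, q)}) (\<Delta>((k, p) \<mapsto> S\<^sub>2, (m, q) := None))
      (\<Delta>'((k', p) \<mapsto> S\<^sub>2, (m', q) := None))"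
    using env_map_delete[OF env_map_upd[OF i_throw.prems(1) k'(1)] m'(1)] k'(3) m'(3) by (simp del: fun_upd_apply)
  \<comment> \<open>The continuation is typed without \<open>(m, q)\<close>, so by
    \<open>ityped_fc\<close> none of its free channels is interpreted as the endpoint given
    away.\<close>
  moreover have "chan_map \<pi> (K - {(m, q)}) (fc P) \<rho> \<rho>'"
    using i_throw.prems(2) ityped_fc[OF i_throw.hyps(6)] unfolding chan_map_def by fastforce
  ultimately have "ityped etyp \<Gamma> \<rho>' P (\<Delta>'((k', p) \<mapsto> S\<^sub>2, (m', q) := None))"
    by (rule i_throw.IH)
  then show ?case
    using neq k'(2,4) m'(2,4) i_throw.hyps(4,5) by (intro ityped.i_throw[of \<rho>' c k' p d m' q]) simp_all
next
  case (i_branch \<rho> c k p \<Delta> s' s b \<Gamma>)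
  obtain k' where k': "(k, p) \<in> K" "\<rho>' c = Pol k' p" "\<pi> (k, p) = (k', p)" "\<Delta>' (k', p) = \<Delta> (k, p)"
    by (rule env_chan_map[OF i_branch.prems _ i_branch.hyps(1)]) auto
  show ?case
  proof (rule ityped.i_branch[of \<rho>' c k' p \<Delta>' s' s])
    fix l P S
    assume l: "fmlookup b l = Some P" "fmlookup s l = Some S"
    have "fc P \<subseteq> fc (Branch c b)" using fmran'I[OF l(1)] by (auto simp: fmap.set_map)
    then show "ityped etyp \<Gamma> \<rho>' P (\<Delta>'((k', p) \<mapsto> S))"
      using i_branch.IH[OF l env_map_upd[OF i_branch.prems(1) k'(1)] chan_map_mono[OF i_branch.prems(2)]]
        k'(3) by (auto simp del: fun_upd_apply)
  qed (use k' i_branch.hyps in auto)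
next
  case (i_select \<rho> c k p \<Delta> s l S \<Gamma> P)
  obtain k' where k': "(k, p) \<in> K" "\<rho>' c = Pol k' p" "\<pi> (k, p) = (k', p)" "\<Delta>' (k', p) = \<Delta> (k, p)"
    by (rule env_chan_map[OF i_select.prems _ i_select.hyps(1)]) auto
  show ?case
    using k' i_select.hyps(2,3)
      i_select.IH[OF env_map_upd[OF i_select.prems(1) k'(1)] chan_map_mono[OF i_select.prems(2)]]
    by (intro ityped.i_select[of \<rho>' c k' p \<Delta>' s l S]) (auto simp del: fun_upd_apply)
next
  case (i_speculate \<rho> c k p \<Delta> s b \<Gamma>)
  obtain k' where k': "(k, p) \<in> K" "\<rho>' c = Pol k' p" "\<pi> (k, p) = (k', p)" "\<Delta>' (k', p) = \<Delta> (k, p)"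
    by (rule env_chan_map[OF i_speculate.prems _ i_speculate.hyps(1)]) auto
  show ?case
  proof (rule ityped.i_speculate[of \<rho>' c k' p \<Delta>' s])
    fix l P S
    assume l: "fmlookup b l = Some P" "fmlookup s l = Some S"
    have "fc P \<subseteq> fc (Speculate c b)" using fmran'I[OF l(1)] by (auto simp: fmap.set_map)
    then show "ityped etyp \<Gamma> \<rho>' P (\<Delta>'((k', p) \<mapsto> S))"
      using i_speculate.IH[OF l env_map_upd[OF i_speculate.prems(1) k'(1)]
          chan_map_mono[OF i_speculate.prems(2)]] k'(3) by (auto simp del: fun_upd_apply)
  qed (use k' i_speculate.hyps in auto)
next
  case (i_sess n \<Delta> P k \<rho> f S\<^sub>1 S\<^sub>2 \<Gamma>)
  obtain n' where n': "\<And>p. (n', p) \<notin> dom \<Delta>'"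
    using env_map_fresh[OF i_sess.prems(1)] by blast
  have c: "chan_map \<pi> K (fc P - chans k) \<rho> \<rho>'" using i_sess.prems(2) by simp
  show ?case
  proof (rule ityped.i_sess[OF n' n' _ i_sess.hyps(4)])
    show "\<forall>c\<in>fc P - chans k. \<forall>p. \<rho>' c \<noteq> Pol n' p"
      using chan_map_fresh[OF c i_sess.prems(1) n'] ityped_fc[OF ityped.i_sess[OF i_sess.hyps]]
      by simp
    have "env_map (\<pi>((n, Minus) := (n', Minus), (n, Plus) := (n', Plus)))
        (insert (n, Plus) (insert (n, Minus) K))
        (\<Delta>((n, Minus) \<mapsto> S\<^sub>1, (n, Plus) \<mapsto> S\<^sub>2)) (\<Delta>'((n', Minus) \<mapsto> S\<^sub>1, (n', Plus) \<mapsto> S\<^sub>2))"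
      using i_sess.hyps(1,2) n' by (intro env_map_insert i_sess.prems(1)) auto
    then show "ityped etyp \<Gamma> (bind_all k n' \<rho>') P (\<Delta>'((n', Minus) \<mapsto> S\<^sub>1, (n', Plus) \<mapsto> S\<^sub>2))"
      by (rule i_sess.IH[OF _ chan_map_bind_all[OF c i_sess.hyps(3)]])
  qed
next
  case (i_res n \<Delta> \<Gamma> k \<rho> P)
  obtain n' where n': "\<And>p. (n', p) \<notin> dom \<Delta>'"
    using env_map_fresh[OF i_res.prems(1)] by blast
  have n: "\<Delta> (n, p) = None" for p
    using i_res.hyps(1,2) by (cases p) auto
  \<comment> \<open>A plain restriction adds no endpoint to the environment: a free channel of
    \<open>k\<close> in the body would need an endpoint of \<open>n\<close> in
    \<open>\<Delta>\<close>, or would be bare.\<close>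
  have "c \<notin> chans k" if c: "c \<in> fc P" for c
  proof
    assume "c \<in> chans k"
    then show False
      using ityped_fc[OF i_res.hyps(3) c] n by (auto elim!: chans_cases)
  qed
  then have "chan_map \<pi> K (fc P) (bind_all k n \<rho>) (bind_all k n' \<rho>')"
    using i_res.prems(2) unfolding chan_map_def by auto
  then show ?case by (intro ityped.i_res[OF n' n'] i_res.IH[OF i_res.prems(1)])
qed

lemma ityped_resize:
  assumes "ityped etyp \<Gamma> \<rho> P \<Delta>" "finite (dom \<Delta>')"
    and "\<And>c. c \<in> fc P \<Longrightarrow> \<rho>' c = \<rho> c"
    and "\<And>k p. Pol k p \<in> \<rho> ` fc P \<Longrightarrow> \<Delta>' (k, p) = \<Delta> (k, p)"
    and "\<And>k p S. Pol k p \<notin> \<rho> ` fc P \<Longrightarrow> \<Delta>' (k, p) = Some S \<Longrightarrow> S = End"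
  shows "ityped etyp \<Gamma> \<rho>' P \<Delta>'"
proof (rule ityped_map[OF assms(1)])
  define K where "K = {(k, p). Pol k p \<in> \<rho> ` fc P}"
  have "K \<subseteq> dom \<Delta>" using ityped_fc[OF assms(1)] by (fastforce simp: K_def)
  then show "env_map id K \<Delta> \<Delta>'"
    using assms(2,4) by (auto simp: env_map_def K_def) (metis assms(5))
  show "chan_map id K (fc P) \<rho> \<rho>'"
    using assms(3) unfolding chan_map_def K_def by force
qed

lemma ityped_cong:
  assumes "\<And>c. c \<in> fc P \<Longrightarrow> \<rho> c = \<rho>' c"
  shows "ityped etyp \<Gamma> \<rho> P \<Delta> \<longleftrightarrow> ityped etyp \<Gamma> \<rho>' P \<Delta>"
proof -
  have "ityped etyp \<Gamma> \<rho>2 P \<Delta>"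
    if t: "ityped etyp \<Gamma> \<rho>1 P \<Delta>" and c: "\<And>c. c \<in> fc P \<Longrightarrow> \<rho>1 c = \<rho>2 c" for \<rho>1 \<rho>2
  proof (rule ityped_resize[OF t ityped_finite[OF t]])
    show "S = End" if "Pol k p \<notin> \<rho>1 ` fc P" "\<Delta> (k, p) = Some S" for k p S
      using ityped_unused[OF t that(2)] that(1) by force
  qed (use c in auto)
  then show ?thesis using assms by metis
qed

section \<open>Free choice of the endpoints introduced by binders\<close>

lemma env_map_id: "finite (dom \<Delta>) \<Longrightarrow> env_map id (dom \<Delta>) \<Delta> \<Delta>"
  by (simp add: env_map_def)

lemma chan_map_id: "(\<And>c. c \<in> X \<Longrightarrow> \<exists>k p. \<rho> c = Pol k p \<and> (k, p) \<in> dom \<Delta>) \<Longrightarrow> chan_map id (dom \<Delta>) X \<rho> \<rho>"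
  unfolding chan_map_def by fastforce

text \<open>It turns the existentially chosen endpoint of a binder rule into any endpoint of the
  same polarity outside \<open>\<Delta>\<close>: the common session name of a request and an accept,
  the endpoint received by delegation, or the name of a renamed binder.\<close>

lemma ityped_change_endpoint:
  assumes "ityped etyp \<Gamma> (\<rho>(c := Pol n p)) P (\<Delta>((n, p) \<mapsto> S))"
    and "(n, p) \<notin> dom \<Delta>" "(n', p) \<notin> dom \<Delta>" "\<forall>d \<in> fc P - {c}. \<rho> d \<noteq> Pol n p"
  shows "ityped etyp \<Gamma> (\<rho>(c := Pol n' p)) P (\<Delta>((n', p) \<mapsto> S))"
proof -
  have fin: "finite (dom \<Delta>)" using ityped_finite[OF assms(1)] by simp
  have dom: "\<exists>k r. \<rho> d = Pol k r \<and> (k, r) \<in> dom \<Delta>" if d: "d \<in> fc P - {c}" for d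
  proof -
    obtain k r where "\<rho> d = Pol k r" "(k, r) \<in> dom (\<Delta>((n, p) \<mapsto> S))"
      using ityped_fc[OF assms(1), of d] d by auto
    moreover have "\<rho> d \<noteq> Pol n p" using assms(4) d by blast
    ultimately show ?thesis by auto
  qed
  show "ityped etyp \<Gamma> (\<rho>(c := Pol n' p)) P (\<Delta>((n', p) \<mapsto> S))"
    by (rule ityped_map[OF assms(1) env_map_insert[OF env_map_id[OF fin] assms(2,3)]
          chan_map_bind[OF chan_map_id[OF dom] assms(4)]]) simp_all
qed

lemma ityped_sess_fresh:
  assumes "ityped etyp \<Gamma> \<rho> (Sess k f P) \<Delta>" "\<And>p. (n', p) \<notin> dom \<Delta>"
  obtains S\<^sub>1 S\<^sub>2 where "comply f S\<^sub>1 S\<^sub>2"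
    "ityped etyp \<Gamma> (bind_all k n' \<rho>) P (\<Delta>((n', Minus) \<mapsto> S\<^sub>1, (n', Plus) \<mapsto> S\<^sub>2))"
proof -
  obtain n S\<^sub>1 S\<^sub>2 where n: "(n, Minus) \<notin> dom \<Delta>" "(n, Plus) \<notin> dom \<Delta>"
    "\<forall>c \<in> fc P - chans k. \<forall>p. \<rho> c \<noteq> Pol n p" and f: "comply f S\<^sub>1 S\<^sub>2"
    and P: "ityped etyp \<Gamma> (bind_all k n \<rho>) P (\<Delta>((n, Minus) \<mapsto> S\<^sub>1, (n, Plus) \<mapsto> S\<^sub>2))"
    using assms(1) unfolding ityped_sess by blast
  have e: "env_map (id((n, Minus) := (n', Minus), (n, Plus) := (n', Plus)))
      (insert (n, Plus) (insert (n, Minus) (dom \<Delta>)))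
      (\<Delta>((n, Minus) \<mapsto> S\<^sub>1, (n, Plus) \<mapsto> S\<^sub>2)) (\<Delta>((n', Minus) \<mapsto> S\<^sub>1, (n', Plus) \<mapsto> S\<^sub>2))"
    using n(1,2) assms(2) ityped_finite[OF assms(1)]
    by (intro env_map_insert env_map_id) auto
  have "chan_map id (dom \<Delta>) (fc P - chans k) \<rho> \<rho>"
    by (rule chan_map_id[OF ityped_fc[OF assms(1)]]) simp
  from ityped_map[OF P e chan_map_bind_all[OF this n(3)]] f that show thesis by blast
qed

text \<open>Since the environment holds no endpoint for \<open>k\<close>, no channel of
  \<open>k\<close> is free in the body, so its interpretation there is immaterial.\<close>

lemma ityped_res_body:
  assumes "ityped etyp \<Gamma> \<rho> (Res k P) \<Delta>" "\<And>c. c \<in> fc P - chans k \<Longrightarrow> \<rho>' c = \<rho> c"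
  shows "ityped etyp \<Gamma> \<rho>' P \<Delta>"
proof -
  obtain n where n: "(n, Minus) \<notin> dom \<Delta>" "(n, Plus) \<notin> dom \<Delta>"
    and P: "ityped etyp \<Gamma> (bind_all k n \<rho>) P \<Delta>"
    using assms(1) unfolding ityped_res by blast
  have n': "\<Delta> (n, p) = None" for p using n by (cases p) auto
  have "c \<notin> chans k" if c: "c \<in> fc P" for c
  proof
    assume "c \<in> chans k"
    then show False using ityped_fc[OF P c] n' by (auto elim!: chans_cases)
  qed
  then have "bind_all k n \<rho> c = \<rho>' c" if "c \<in> fc P" for c
    using that assms(2) by simp
  then show ?thesis using P ityped_cong by metis
qed

section \<open>Channel substitution\<close>

primrec name_of :: "chan \<Rightarrow> name" where
  "name_of (Bare k) = k"
| "name_of (Pol k p) = k"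

lemma chans_iff: "c \<in> chans k \<longleftrightarrow> name_of c = k"
  by (cases c) auto

text \<open>
  A sufficient condition for \<open>csub\<close> not to capture. The last disjunct admits \<open>P{k\<^sup>p/k}\<close> even when \<open>k\<close>
  is also bound inside \<open>P\<close>: any binder that catches \<open>k\<^sup>p\<close> binds \<open>k\<close> as well.
\<close>

definition avoids :: "name set \<Rightarrow> (chan \<Rightarrow> chan) \<Rightarrow> bool" where
  "avoids B \<sigma> \<longleftrightarrow>
     (\<forall>c. \<sigma> c = c \<or> name_of (\<sigma> c) \<notin> B \<or> (\<exists>p. \<sigma> c = Pol (name_of c) p))"

lemma avoids_mono: "avoids B \<sigma> \<Longrightarrow> B' \<subseteq> B \<Longrightarrow> avoids B' \<sigma>"
  unfolding avoids_def by blast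

lemma avoids_fix_on: "avoids B \<sigma> \<Longrightarrow> avoids B (fix_on A \<sigma>)"
  unfolding avoids_def fix_on_def by auto

lemma avoids_fun_upd:
  "avoids B \<sigma> \<Longrightarrow> c' = c \<or> name_of c' \<notin> B \<or> (\<exists>p. c' = Pol (name_of c) p) \<Longrightarrow> avoids B (\<sigma>(c := c'))"
  unfolding avoids_def by auto

lemma avoids_id [simp]: "avoids B id"
  unfolding avoids_def by auto

text \<open>A channel that is moved gets a name outside \<open>B\<close> or, in the exceptional case
  of \<open>avoids\<close>, keeps its name and becomes polarized. Hence it never becomes a bare name
  of \<open>B\<close>, nor, as \<open>avoids_chans\<close> adds, a channel of a different name of
  \<open>B\<close>.\<close>

lemma avoids_Bare: "avoids B \<sigma> \<Longrightarrow> k \<in> B \<Longrightarrow> c \<noteq> Bare k \<Longrightarrow> \<sigma> c \<noteq> Bare k"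
  unfolding avoids_def by (metis chan.distinct(1) name_of.simps(1))

lemma avoids_chans: "avoids B \<sigma> \<Longrightarrow> k \<in> B \<Longrightarrow> c \<notin> chans k \<Longrightarrow> \<sigma> c \<notin> chans k"
  unfolding avoids_def chans_iff by (metis name_of.simps(2))

lemma image_fix_on_Bare:
  "avoids B \<sigma> \<Longrightarrow> k \<in> B \<Longrightarrow> fix_on {Bare k} \<sigma> ` X - {Bare k} = \<sigma> ` (X - {Bare k})"
  by (auto simp: fix_on_def dest: avoids_Bare)

lemma image_fix_on_chans:
  "avoids B \<sigma> \<Longrightarrow> k \<in> B \<Longrightarrow> fix_on (chans k) \<sigma> ` X - chans k = \<sigma> ` (X - chans k)"
  by (auto simp: fix_on_def avoids_chans)

text \<open>This identity and the next carry composition with \<open>\<sigma>\<close> past a binder: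
  the bound channel is left alone by \<open>fix_on\<close>, and no other channel is mapped onto a
  bound one.\<close>

lemma comp_fix_on_Bare:
  "avoids B \<sigma> \<Longrightarrow> k \<in> B \<Longrightarrow> \<rho>(Bare k := d) \<circ> fix_on {Bare k} \<sigma> = (\<rho> \<circ> \<sigma>)(Bare k := d)"
  by (rule ext) (auto simp: fix_on_def avoids_Bare)

lemma comp_fix_on_chans:
  assumes "avoids B \<sigma>" "k \<in> B"
  shows "bind_all k n \<rho> \<circ> fix_on (chans k) \<sigma> = bind_all k n (\<rho> \<circ> \<sigma>)"
proof
  fix c show "(bind_all k n \<rho> \<circ> fix_on (chans k) \<sigma>) c = bind_all k n (\<rho> \<circ> \<sigma>) c"
    using avoids_chans[OF assms, of c]
    by (cases "c \<in> chans k") (auto simp: fix_on_def elim!: chans_cases)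
qed

lemma bn_csub [simp]: "bn (csub P \<sigma>) = bn P"
  by (induction P arbitrary: \<sigma>) (auto simp: image_image)

lemma fc_csub: "avoids (bn P) \<sigma> \<Longrightarrow> fc (csub P \<sigma>) = \<sigma> ` fc P"
proof (induction P arbitrary: \<sigma>)
  case (Par P Q)
  then have "avoids (bn P) \<sigma>" "avoids (bn Q) \<sigma>" by (auto elim: avoids_mono)
  then show ?case using Par.IH by (simp add: image_Un)
next
  case (Request a S k P)
  then have "avoids (bn P) (fix_on {Bare k} \<sigma>)" by (auto elim: avoids_mono intro: avoids_fix_on)
  then show ?case using Request by (simp add: image_fix_on_Bare)
next
  case (Accept a S k P)
  then have "avoids (bn P) (fix_on {Bare k} \<sigma>)" by (auto elim: avoids_mono intro: avoids_fix_on)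
  then show ?case using Accept by (simp add: image_fix_on_Bare)
next
  case (Catch c k P)
  then have "avoids (bn P) (fix_on {Bare k} \<sigma>)" by (auto elim: avoids_mono intro: avoids_fix_on)
  then show ?case using Catch by (simp add: image_fix_on_Bare)
next
  case (Branch c b)
  have "avoids (bn P) \<sigma>" if "P \<in> fmran' b" for P
    using Branch.prems that by (auto elim!: avoids_mono)
  then show ?case using Branch.IH by (auto simp: image_image)
next
  case (Speculate c b)
  have "avoids (bn P) \<sigma>" if "P \<in> fmran' b" for P
    using Speculate.prems that by (auto elim!: avoids_mono)
  then show ?case using Speculate.IH by (auto simp: image_image)
next
  case (Sess k f P)
  then have "avoids (bn P) (fix_on (chans k) \<sigma>)" by (auto elim: avoids_mono intro: avoids_fix_on)
  then show ?case using Sess by (simp add: image_fix_on_chans)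
next
  case (Res k P)
  then have "avoids (bn P) (fix_on (chans k) \<sigma>)" by (auto elim: avoids_mono intro: avoids_fix_on)
  then show ?case using Res by (simp add: image_fix_on_chans)
qed simp_all

text \<open>The rules see a channel only through its interpretation, here that of
  \<open>\<sigma> c\<close>. At a binder, absence of capture yields both the composition identity
  and equality of the interpreted free channels, so that the freshness conditions on the two sides
  agree.\<close>

lemma ityped_csub:
  "avoids (bn P) \<sigma> \<Longrightarrow> ityped etyp \<Gamma> \<rho> (csub P \<sigma>) \<Delta> \<longleftrightarrow> ityped etyp \<Gamma> (\<rho> \<circ> \<sigma>) P \<Delta>"
proof (induction P arbitrary: \<Gamma> \<sigma> \<rho> \<Delta>)
  case (Par P Q)
  then have "avoids (bn P) \<sigma>" "avoids (bn Q) \<sigma>" by (auto elim: avoids_mono)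
  then show ?case using Par.IH by (simp add: ityped_par)
next
  case (Request a S k P)
  have k: "k \<in> bn (Request a S k P)" by simp
  have av: "avoids (bn P) (fix_on {Bare k} \<sigma>)"
    using Request.prems by (auto elim: avoids_mono intro: avoids_fix_on)
  note comp = comp_fix_on_Bare[OF Request.prems k]
  have img: "fc (csub P (fix_on {Bare k} \<sigma>)) - {Bare k} = \<sigma> ` (fc P - {Bare k})"
    by (simp add: fc_csub[OF av] image_fix_on_Bare[OF Request.prems k])
  show ?case
    unfolding csub.simps ityped_request Request.IH[OF av] img comp
    by (simp del: fun_upd_apply)
next
  case (Accept a S k P)
  have k: "k \<in> bn (Accept a S k P)" by simp
  have av: "avoids (bn P) (fix_on {Bare k} \<sigma>)"
    using Accept.prems by (auto elim: avoids_mono intro: avoids_fix_on)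
  note comp = comp_fix_on_Bare[OF Accept.prems k]
  have img: "fc (csub P (fix_on {Bare k} \<sigma>)) - {Bare k} = \<sigma> ` (fc P - {Bare k})"
    by (simp add: fc_csub[OF av] image_fix_on_Bare[OF Accept.prems k])
  show ?case
    unfolding csub.simps ityped_accept Accept.IH[OF av] img comp
    by (simp del: fun_upd_apply)
next
  case (Catch c k P)
  have k: "k \<in> bn (Catch c k P)" by simp
  have av: "avoids (bn P) (fix_on {Bare k} \<sigma>)"
    using Catch.prems by (auto elim: avoids_mono intro: avoids_fix_on)
  note comp = comp_fix_on_Bare[OF Catch.prems k]
  have img: "fc (csub P (fix_on {Bare k} \<sigma>)) - {Bare k} = \<sigma> ` (fc P - {Bare k})"
    by (simp add: fc_csub[OF av] image_fix_on_Bare[OF Catch.prems k])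
  show ?case
    unfolding csub.simps ityped_catch Catch.IH[OF av] img comp
    by (simp del: fun_upd_apply)
next
  case (Branch c b)
  have "ityped etyp \<Gamma> \<rho> (csub P \<sigma>) \<Delta> \<longleftrightarrow> ityped etyp \<Gamma> (\<rho> \<circ> \<sigma>) P \<Delta>"
    if "fmlookup b l = Some P" for l P \<Delta>
    by (rule Branch.IH[OF fmran'I[OF that] avoids_mono[OF Branch.prems]]) (use fmran'I[OF that] in auto)
  then have "(\<forall>l P S. fmlookup (fmmap (\<lambda>P. csub P \<sigma>) b) l = Some P \<longrightarrow> fmlookup s l = Some S \<longrightarrow>
        ityped etyp \<Gamma> \<rho> P (\<Delta>(e \<mapsto> S))) \<longleftrightarrow>
      (\<forall>l P S. fmlookup b l = Some P \<longrightarrow> fmlookup s l = Some S \<longrightarrow>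
        ityped etyp \<Gamma> (\<rho> \<circ> \<sigma>) P (\<Delta>(e \<mapsto> S)))" for s e
    by (auto simp del: fun_upd_apply; metis)
  then show ?case unfolding csub.simps ityped_branch by (simp del: fun_upd_apply)
next
  case (Speculate c b)
  have "ityped etyp \<Gamma> \<rho> (csub P \<sigma>) \<Delta> \<longleftrightarrow> ityped etyp \<Gamma> (\<rho> \<circ> \<sigma>) P \<Delta>"
    if "fmlookup b l = Some P" for l P \<Delta>
    by (rule Speculate.IH[OF fmran'I[OF that] avoids_mono[OF Speculate.prems]]) (use fmran'I[OF that] in auto)
  then have "(\<forall>l P S. fmlookup (fmmap (\<lambda>P. csub P \<sigma>) b) l = Some P \<longrightarrow> fmlookup s l = Some S \<longrightarrow>
        ityped etyp \<Gamma> \<rho> P (\<Delta>(e \<mapsto> S))) \<longleftrightarrow>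
      (\<forall>l P S. fmlookup b l = Some P \<longrightarrow> fmlookup s l = Some S \<longrightarrow>
        ityped etyp \<Gamma> (\<rho> \<circ> \<sigma>) P (\<Delta>(e \<mapsto> S)))" for s e
    by (auto simp del: fun_upd_apply; metis)
  then show ?case unfolding csub.simps ityped_speculate by (simp del: fun_upd_apply)
next
  case (Sess k f P)
  have k: "k \<in> bn (Sess k f P)" by simp
  have av: "avoids (bn P) (fix_on (chans k) \<sigma>)"
    using Sess.prems by (auto elim: avoids_mono intro: avoids_fix_on)
  note comp = comp_fix_on_chans[OF Sess.prems k]
  have img: "fc (csub P (fix_on (chans k) \<sigma>)) - chans k = \<sigma> ` (fc P - chans k)"
    by (simp add: fc_csub[OF av] image_fix_on_chans[OF Sess.prems k])
  show ?case
    unfolding csub.simps ityped_sess Sess.IH[OF av] img comp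
    by (simp del: fun_upd_apply)
next
  case (Res k P)
  have k: "k \<in> bn (Res k P)" by simp
  have av: "avoids (bn P) (fix_on (chans k) \<sigma>)"
    using Res.prems by (auto elim: avoids_mono intro: avoids_fix_on)
  note comp = comp_fix_on_chans[OF Res.prems k]
  show ?case
    unfolding csub.simps ityped_res Res.IH[OF av] comp
    ..
qed (simp_all add: ityped_simps)

section \<open>Structural congruence\<close>

text \<open>Quantifying over interpretations and environments makes the relation usable below
  binders and prefixes. Equality of \<open>fc\<close> is included because the binder rules mention
  the free channels of their bodies.\<close>

definition itype_equiv ::
  "((var \<rightharpoonup> 'g) \<Rightarrow> 'e \<Rightarrow> 'g \<Rightarrow> bool) \<Rightarrow> ('l, 'g, 'e) proc \<Rightarrow> ('l, 'g, 'e) proc \<Rightarrow> bool" where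
  "itype_equiv etyp P Q \<longleftrightarrow>
     fc P = fc Q \<and> (\<forall>\<Gamma> \<rho> \<Delta>. ityped etyp \<Gamma> \<rho> P \<Delta> \<longleftrightarrow> ityped etyp \<Gamma> \<rho> Q \<Delta>)"

section \<open>Invariance under \<alpha>-conversion\<close>

lemma avoids_rename_bare: "k' \<notin> B \<Longrightarrow> avoids B (id(Bare k := Bare k'))"
  by (auto simp: avoids_def)

lemma avoids_bind_all: "n \<notin> B \<Longrightarrow> avoids B \<sigma> \<Longrightarrow> avoids B (bind_all k n \<sigma>)"
  by (auto simp: avoids_def bind_all_def)

text \<open>The last disjunct of \<open>avoids\<close> covers this substitution for every
  \<open>B\<close>, because polarizing keeps the name.\<close>

lemma avoids_polarize: "avoids B (id(Bare k := Pol k p))"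
  by (auto simp: avoids_def)

lemma image_Diff_eq:
  assumes "\<And>c. c \<in> X \<Longrightarrow> \<tau> c \<in> B \<longleftrightarrow> c \<in> A" "\<And>c. c \<in> X - A \<Longrightarrow> \<tau> c = c"
  shows "\<tau> ` X - B = X - A"
proof
  show "\<tau> ` X - B \<subseteq> X - A" using assms by fastforce
  show "X - A \<subseteq> \<tau> ` X - B"
  proof
    fix c assume c: "c \<in> X - A"
    then have "\<tau> c \<in> \<tau> ` X" by blast
    then show "c \<in> \<tau> ` X - B" using c assms(1)[of c] assms(2)[OF c] by simp
  qed
qed

lemma fc_rename_bare:
  assumes "Bare k' \<notin> fc P" "k' \<notin> bn P"
  shows "fc (rename_bare k k' P) - {Bare k'} = fc P - {Bare k}"
  unfolding rename_bare_def fc_csub[OF avoids_rename_bare[OF assms(2)]]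
  by (rule image_Diff_eq) (use assms(1) in \<open>auto split: if_splits\<close>)

lemma fc_rename_all:
  assumes "chans k' \<inter> fc P = {}" "k' \<notin> bn P"
  shows "fc (rename_all k k' P) - chans k' = fc P - chans k"
  unfolding rename_all_bind_all fc_csub[OF avoids_bind_all[OF assms(2) avoids_id]]
proof (rule image_Diff_eq)
  fix c assume "c \<in> fc P"
  then have "c \<notin> chans k'" using assms(1) by blast
  then show "bind_all k k' id c \<in> chans k' \<longleftrightarrow> c \<in> chans k"
    by (cases "c \<in> chans k") (auto elim!: chans_cases)
qed auto

text \<open>The interpretation composed with the renaming differs from
  \<open>\<rho>(Bare k := d)\<close> at most at \<open>Bare k'\<close>, which is not free in
  \<open>P\<close>.\<close>

lemma ityped_rename_bare:
  assumes "Bare k' \<notin> fc P" "k' \<notin> bn P"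
  shows "ityped etyp \<Gamma> (\<rho>(Bare k' := d)) (rename_bare k k' P) \<Delta> \<longleftrightarrow> ityped etyp \<Gamma> (\<rho>(Bare k := d)) P \<Delta>"
  unfolding rename_bare_def ityped_csub[OF avoids_rename_bare[OF assms(2)]]
  using assms(1) by (intro ityped_cong) auto

lemma ityped_rename_all:
  assumes "chans k' \<inter> fc P = {}" "k' \<notin> bn P"
  shows "ityped etyp \<Gamma> (bind_all k' n \<rho>) (rename_all k k' P) \<Delta> \<longleftrightarrow> ityped etyp \<Gamma> (bind_all k n \<rho>) P \<Delta>"
  unfolding rename_all_bind_all ityped_csub[OF avoids_bind_all[OF assms(2) avoids_id]]
proof (rule ityped_cong)
  fix c assume "c \<in> fc P"
  then have "c \<notin> chans k'" using assms(1) by blast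
  then show "(bind_all k' n \<rho> \<circ> bind_all k k' id) c = bind_all k n \<rho> c"
    by (cases "c \<in> chans k") (auto elim!: chans_cases)
qed

lemma itype_equiv_alpha: "alpha_step P Q \<Longrightarrow> itype_equiv etyp P Q"
proof (induction rule: alpha_step.induct)
  case (alpha_request k' P a S k)
  then show ?case
    by (simp add: itype_equiv_def ityped_request fc_rename_bare ityped_rename_bare del: fun_upd_apply)
next
  case (alpha_accept k' P a S k)
  then show ?case
    by (simp add: itype_equiv_def ityped_accept fc_rename_bare ityped_rename_bare del: fun_upd_apply)
next
  case (alpha_catch k' P c k)
  then show ?case
    by (simp add: itype_equiv_def ityped_catch fc_rename_bare ityped_rename_bare del: fun_upd_apply)
next
  case (alpha_sess k' P k f)
  then show ?case
    by (simp add: itype_equiv_def ityped_sess fc_rename_all ityped_rename_all del: fun_upd_apply)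
next
  case (alpha_res k' P k)
  then show ?case
    by (simp add: itype_equiv_def ityped_res fc_rename_all ityped_rename_all del: fun_upd_apply)
qed

text \<open>The base relation is left open since it is instantiated by \<open>alpha_step\<close>, by
  \<open>struct_step\<close>, and by \<open>itype_equiv\<close> itself, the last in order to rewrite
  inside a context.\<close>

lemma itype_equiv_congr:
  assumes "congr A P Q" "\<And>P Q. A P Q \<Longrightarrow> itype_equiv etyp P Q"
  shows "itype_equiv etyp P Q"
  using assms(1)
proof (induction rule: congr.induct)
  case (congr_base P Q)
  then show ?case by (rule assms(2))
next
  case (congr_branch P P' c l b)
  then have "(\<forall>l' R S. fmlookup (fmupd l P b) l' = Some R \<longrightarrow> fmlookup s l' = Some S \<longrightarrow>
        ityped etyp \<Gamma> \<rho> R (\<Delta>(e \<mapsto> S))) \<longleftrightarrow>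
      (\<forall>l' R S. fmlookup (fmupd l P' b) l' = Some R \<longrightarrow> fmlookup s l' = Some S \<longrightarrow>
        ityped etyp \<Gamma> \<rho> R (\<Delta>(e \<mapsto> S)))" for \<Gamma> \<rho> \<Delta> s e
    by (auto simp: itype_equiv_def simp del: fun_upd_apply split: if_splits)
  moreover have "fmmap fc (fmupd l P b) = fmmap fc (fmupd l P' b)"
    using congr_branch.IH by (auto simp: itype_equiv_def intro!: fmap_ext)
  ultimately show ?case
    unfolding itype_equiv_def ityped_branch
    by (simp del: fun_upd_apply fmupd_lookup fmran'_fmmap)
next
  case (congr_speculate P P' c l b)
  then have "(\<forall>l' R S. fmlookup (fmupd l P b) l' = Some R \<longrightarrow> fmlookup s l' = Some S \<longrightarrow>
        ityped etyp \<Gamma> \<rho> R (\<Delta>(e \<mapsto> S))) \<longleftrightarrow>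
      (\<forall>l' R S. fmlookup (fmupd l P' b) l' = Some R \<longrightarrow> fmlookup s l' = Some S \<longrightarrow>
        ityped etyp \<Gamma> \<rho> R (\<Delta>(e \<mapsto> S)))" for \<Gamma> \<rho> \<Delta> s e
    by (auto simp: itype_equiv_def simp del: fun_upd_apply split: if_splits)
  moreover have "fmmap fc (fmupd l P b) = fmmap fc (fmupd l P' b)"
    using congr_speculate.IH by (auto simp: itype_equiv_def intro!: fmap_ext)
  ultimately show ?case
    unfolding itype_equiv_def ityped_speculate
    by (simp del: fun_upd_apply fmupd_lookup fmran'_fmmap)
qed (simp_all add: itype_equiv_def ityped_simps)

section \<open>Invariance under commutativity, associativity and scope extrusion\<close>

lemma itype_equiv_comm: "itype_equiv etyp (Par P Q) (Par Q P)"
proof -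
  have "ityped etyp \<Gamma> \<rho> (Par Q P) \<Delta>" if t: "ityped etyp \<Gamma> \<rho> (Par P Q) \<Delta>" for \<Gamma> \<rho> \<Delta> P Q
  proof -
    obtain A where "ityped etyp \<Gamma> \<rho> P (\<Delta> |` A)" "ityped etyp \<Gamma> \<rho> Q (\<Delta> |` (- A))"
      using t unfolding ityped_par by blast
    then show ?thesis by (intro i_par[where A = "- A"]) simp_all
  qed
  then show ?thesis by (auto simp: itype_equiv_def)
qed

lemma itype_equiv_assoc: "itype_equiv etyp (Par (Par P Q) R) (Par P (Par Q R))"
proof -
  have "ityped etyp \<Gamma> \<rho> (Par (Par P Q) R) \<Delta> \<longleftrightarrow> ityped etyp \<Gamma> \<rho> (Par P (Par Q R)) \<Delta>" for \<Gamma> \<rho> \<Delta>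
  proof
    assume "ityped etyp \<Gamma> \<rho> (Par (Par P Q) R) \<Delta>"
    then obtain A B where "ityped etyp \<Gamma> \<rho> P (\<Delta> |` (A \<inter> B))" "ityped etyp \<Gamma> \<rho> Q (\<Delta> |` (A \<inter> - B))"
      "ityped etyp \<Gamma> \<rho> R (\<Delta> |` (- A))"
      by (auto simp: ityped_par)
    moreover have "- (A \<inter> B) \<inter> A = A \<inter> - B" "- (A \<inter> B) \<inter> - A = - A" by auto
    ultimately have "ityped etyp \<Gamma> \<rho> (Par Q R) (\<Delta> |` (- (A \<inter> B)))"
      by (intro i_par[where A = A]) simp_all
    with \<open>ityped etyp \<Gamma> \<rho> P _\<close> show "ityped etyp \<Gamma> \<rho> (Par P (Par Q R)) \<Delta>"
      by (rule i_par)
  next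
    assume "ityped etyp \<Gamma> \<rho> (Par P (Par Q R)) \<Delta>"
    then obtain A B where "ityped etyp \<Gamma> \<rho> P (\<Delta> |` A)" "ityped etyp \<Gamma> \<rho> Q (\<Delta> |` (- A \<inter> B))"
      "ityped etyp \<Gamma> \<rho> R (\<Delta> |` (- A \<inter> - B))"
      by (auto simp: ityped_par)
    moreover have "(A \<union> B) \<inter> A = A" "(A \<union> B) \<inter> - A = - A \<inter> B" "- (A \<union> B) = - A \<inter> - B" by auto
    ultimately have "ityped etyp \<Gamma> \<rho> (Par P Q) (\<Delta> |` (A \<union> B))" "ityped etyp \<Gamma> \<rho> R (\<Delta> |` (- (A \<union> B)))"
      by (auto intro!: i_par[where A = A])
    then show "ityped etyp \<Gamma> \<rho> (Par (Par P Q) R) \<Delta>"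
      by (rule i_par)
  qed
  then show ?thesis by (simp add: itype_equiv_def Un_assoc)
qed

text \<open>
  The endpoints of \<open>k\<close> may have been assigned to \<open>R\<close>, which has to leave the scope of \<open>k\<close>. There they
  are unused, hence of type \<open>End\<close>, and can be handed over to \<open>Q'\<close>. With the parallel components
  swapped, the statement is its own converse.
\<close>

lemma ityped_extrude:
  assumes t: "ityped etyp \<Gamma> \<rho> (Sess k f (Par Q (Sess k' g (Par Q' R)))) \<Delta>"
    and kk': "k \<noteq> k'" and kR: "chans k \<inter> fc R = {}" and kQ: "chans k' \<inter> fc Q = {}"
  shows "ityped etyp \<Gamma> \<rho> (Sess k' g (Par R (Sess k f (Par Q' Q)))) \<Delta>"
proof -
  have kR': "c \<notin> chans k" if "c \<in> fc R" for c using kR that by blast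
  have kQ': "c \<notin> chans k'" if "c \<in> fc Q" for c using kQ that by blast
  have fin: "finite (dom \<Delta>)" by (rule ityped_finite[OF t])
  obtain n where n: "\<And>p. (n, p) \<notin> dom \<Delta>"
    using fresh_name[OF fin finite.emptyI finite.emptyI] by metis
  obtain n' where n': "\<And>p. (n', p) \<notin> dom \<Delta>" "n' \<notin> {n}"
    using fresh_name[OF fin finite.emptyI, of "{n}"] by auto
  then have nn': "n' \<noteq> n" by simp
  define \<rho>k where "\<rho>k = bind_all k n \<rho>"
  define \<rho>k' where "\<rho>k' = bind_all k' n' \<rho>"
  define \<rho>' where "\<rho>' = bind_all k n \<rho>k'"
  obtain S\<^sub>1 S\<^sub>2 where f: "comply f S\<^sub>1 S\<^sub>2"
    and body: "ityped etyp \<Gamma> \<rho>k (Par Q (Sess k' g (Par Q' R))) (\<Delta>((n, Minus) \<mapsto> S\<^sub>1, (n, Plus) \<mapsto> S\<^sub>2))"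
    using ityped_sess_fresh[OF t n] unfolding \<rho>k_def by metis
  define \<Delta>n where "\<Delta>n = \<Delta>((n, Minus) \<mapsto> S\<^sub>1, (n, Plus) \<mapsto> S\<^sub>2)"
  obtain A where Q: "ityped etyp \<Gamma> \<rho>k Q (\<Delta>n |` A)"
    and inner: "ityped etyp \<Gamma> \<rho>k (Sess k' g (Par Q' R)) (\<Delta>n |` (- A))"
    using body unfolding ityped_par \<Delta>n_def by metis
  have n'_dom: "(n', p) \<notin> dom (\<Delta>n |` (- A))" for p
    using n' by (auto simp: \<Delta>n_def)
  obtain T\<^sub>1 T\<^sub>2 where g: "comply g T\<^sub>1 T\<^sub>2"
    and inner_body: "ityped etyp \<Gamma> (bind_all k' n' \<rho>k) (Par Q' R)
      ((\<Delta>n |` (- A))((n', Minus) \<mapsto> T\<^sub>1, (n', Plus) \<mapsto> T\<^sub>2))"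
    using ityped_sess_fresh[OF inner n'_dom] by metis
  \<comment> \<open>The two bindings commute because \<open>k \<noteq> k'\<close>.\<close>
  have \<rho>'_eq: "bind_all k' n' \<rho>k = \<rho>'"
    using kk' by (auto simp: \<rho>'_def \<rho>k_def \<rho>k'_def bind_all_def fun_eq_iff)
  define E where "E = (\<Delta>n |` (- A))((n', Minus) \<mapsto> T\<^sub>1, (n', Plus) \<mapsto> T\<^sub>2)"
  obtain A' where Q': "ityped etyp \<Gamma> \<rho>' Q' (E |` A')" and R: "ityped etyp \<Gamma> \<rho>' R (E |` (- A'))"
    using inner_body unfolding ityped_par \<rho>'_eq E_def by metis
  define full where "full = \<Delta>((n', Minus) \<mapsto> T\<^sub>1, (n', Plus) \<mapsto> T\<^sub>2)"
  \<comment> \<open>\<open>B\<close> is the share of \<open>R\<close> once \<open>k'\<close> is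
    outermost: what \<open>R\<close> had before, minus the endpoints of \<open>n\<close>. The set
    \<open>A\<close> splits \<open>\<Delta>n\<close>, which contains no endpoint of
    \<open>n'\<close>, so these are sent explicitly to the side of \<open>Q'\<close> and
    \<open>R\<close>.\<close>
  define B where "B = (- A \<union> {e. fst e = n'}) \<inter> - A' \<inter> {e. fst e \<noteq> n}"
  define F where "F = (full |` (- B))((n, Minus) \<mapsto> S\<^sub>1, (n, Plus) \<mapsto> S\<^sub>2)"
  have E_n: "E (n, Minus) = (if (n, Minus) \<in> A then None else Some S\<^sub>1)"
      "E (n, Plus) = (if (n, Plus) \<in> A then None else Some S\<^sub>2)"
    and E_n': "E (n', Minus) = Some T\<^sub>1" "E (n', Plus) = Some T\<^sub>2"
    and E_other: "m \<noteq> n \<Longrightarrow> m \<noteq> n' \<Longrightarrow> E (m, p) = (if (m, p) \<in> A then None else \<Delta> (m, p))" for m p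
    using nn' by (auto simp: E_def \<Delta>n_def restrict_map_def)
  \<comment> \<open>As \<open>n\<close> lies outside \<open>\<Delta>\<close>, an interpretation can
    reach it only through \<open>k\<close>, and \<open>k\<close> is not free in
    \<open>R\<close>.\<close>
  have R_unused: "Pol n p \<notin> \<rho>' ` fc R" for p
  proof
    assume "Pol n p \<in> \<rho>' ` fc R"
    then obtain c where c: "c \<in> fc R" "\<rho>' c = Pol n p" by force
    then have "c \<notin> chans k" using kR' by blast
    with c have "\<rho>k' c = Pol n p" by (simp add: \<rho>'_def)
    moreover then have "c \<notin> chans k'" using nn' by (auto simp: \<rho>k'_def elim!: chans_cases)
    ultimately have "\<rho> c = Pol n p" by (simp add: \<rho>k'_def)
    moreover have "c \<in> fc (Sess k f (Par Q (Sess k' g (Par Q' R))))"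
      using c \<open>c \<notin> chans k\<close> \<open>c \<notin> chans k'\<close> by simp
    ultimately show False using ityped_fc[OF t] n by fastforce
  qed
  have End_n: "S = End" if "E (n, p) = Some S" "(n, p) \<notin> A'" for p S
    using ityped_unused[OF R, of n p S] R_unused[of p] that by force
  have R': "ityped etyp \<Gamma> \<rho>k' R (full |` B)"
  proof (rule ityped_resize[OF R])
    show "finite (dom (full |` B))" using fin by (simp add: full_def)
    show "\<rho>k' c = \<rho>' c" if "c \<in> fc R" for c
      using kR'[OF that] by (simp add: \<rho>'_def)
    have eq: "(full |` B) (m, p) = (E |` (- A')) (m, p)" if "m \<noteq> n" for m p
      using that E_n' E_other[of m p] by (cases p; cases "m = n'") (auto simp: full_def B_def restrict_map_def)
    show "(full |` B) (m, p) = (E |` (- A')) (m, p)" if "Pol m p \<in> \<rho>' ` fc R" for m p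
      using that R_unused eq by metis
    show "S = End" if "Pol m p \<notin> \<rho>' ` fc R" "(full |` B) (m, p) = Some S" for m p S
    proof -
      have "m \<noteq> n" using that(2) by (auto simp: B_def restrict_map_def)
      then have "(E |` (- A')) (m, p) = Some S" using that(2) eq by simp
      then show ?thesis using ityped_unused[OF R] that(1) by force
    qed
  qed
  have Q2: "ityped etyp \<Gamma> \<rho>' Q (F |` (- (- A \<union> {e. fst e = n'})))"
  proof -
    have "(F |` (- (- A \<union> {e. fst e = n'}))) (m, p) = (\<Delta>n |` A) (m, p)" for m p
      using n' nn' by (cases "m = n"; cases p)
        (auto simp: F_def full_def B_def \<Delta>n_def restrict_map_def dom_def)
    then have "F |` (- (- A \<union> {e. fst e = n'})) = \<Delta>n |` A" by auto
    moreover have "\<rho>' c = \<rho>k c" if "c \<in> fc Q" for c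
      using kQ'[OF that] by (cases "c \<in> chans k") (auto simp: \<rho>'_def \<rho>k_def \<rho>k'_def elim!: chans_cases)
    ultimately show ?thesis using Q ityped_cong by metis
  qed
  \<comment> \<open>\<open>Q'\<close> keeps its own share and takes over the endpoints of
    \<open>n\<close> formerly held by \<open>R\<close>; \<open>End_n\<close> supplies their
    type.\<close>
  have Q'2: "ityped etyp \<Gamma> \<rho>' Q' (F |` (- A \<union> {e. fst e = n'}))"
  proof (rule ityped_resize[OF Q'])
    show "finite (dom (F |` (- A \<union> {e. fst e = n'})))" using fin by (simp add: F_def full_def)
    have eq: "(F |` (- A \<union> {e. fst e = n'})) (m, p) = (E |` A') (m, p)"
      if "m \<noteq> n \<or> (m, p) \<in> A'" for m p
      using that nn' E_n E_n' E_other[of m p] by (cases p; cases "m = n'"; cases "m = n")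
        (auto simp: F_def full_def B_def restrict_map_def)
    show "(F |` (- A \<union> {e. fst e = n'})) (m, p) = (E |` A') (m, p)" if "Pol m p \<in> \<rho>' ` fc Q'" for m p
    proof -
      have "(m, p) \<in> A'" using that ityped_fc[OF Q'] by fastforce
      then show ?thesis using eq by blast
    qed
    show "S = End" if u: "Pol m p \<notin> \<rho>' ` fc Q'"
      and S: "(F |` (- A \<union> {e. fst e = n'})) (m, p) = Some S" for m p S
    proof (cases "m \<noteq> n \<or> (m, p) \<in> A'")
      case True
      then have "(E |` A') (m, p) = Some S" using eq S by simp
      then show ?thesis using ityped_unused[OF Q'] u by force
    next
      case False
      then have "E (n, p) = Some S"
        using S nn' E_n by (cases p) (auto simp: F_def restrict_map_def split: if_splits)
      then show ?thesis using End_n False by blast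
    qed
  qed simp
  have fresh_n: "\<forall>c \<in> fc (Par Q' Q) - chans k. \<forall>p. \<rho>k' c \<noteq> Pol n p"
  proof (intro ballI allI notI)
    fix c p assume c: "c \<in> fc (Par Q' Q) - chans k" "\<rho>k' c = Pol n p"
    then have "c \<notin> chans k'" using nn' by (auto simp: \<rho>k'_def elim!: chans_cases)
    with c have "\<rho> c = Pol n p" "c \<in> fc (Sess k f (Par Q (Sess k' g (Par Q' R))))"
      by (auto simp: \<rho>k'_def)
    then show False using ityped_fc[OF t] n by fastforce
  qed
  have n_dom: "(n, p) \<notin> dom (full |` (- B))" for p
    using n nn' by (auto simp: full_def)
  have "ityped etyp \<Gamma> \<rho>' (Par Q' Q) F"
    using Q'2 Q2 by (rule i_par)
  then have "ityped etyp \<Gamma> \<rho>k' (Sess k f (Par Q' Q)) (full |` (- B))"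
    unfolding F_def \<rho>'_def by (rule i_sess[OF n_dom n_dom fresh_n f])
  with R' have "ityped etyp \<Gamma> \<rho>k' (Par R (Sess k f (Par Q' Q))) full"
    by (rule i_par)
  moreover have "\<forall>c \<in> fc (Par R (Sess k f (Par Q' Q))) - chans k'. \<forall>p. \<rho> c \<noteq> Pol n' p"
  proof (intro ballI allI notI)
    fix c p assume c: "c \<in> fc (Par R (Sess k f (Par Q' Q))) - chans k'" "\<rho> c = Pol n' p"
    then have "c \<in> fc (Sess k f (Par Q (Sess k' g (Par Q' R))))"
      using kR'[of c] by auto
    then show False using ityped_fc[OF t] n' c(2) by fastforce
  qed
  ultimately show ?thesis
    unfolding full_def \<rho>k'_def using g n' by (intro i_sess[of n' \<Delta>]) auto
qed

text \<open>\<open>ityped_extrude\<close> delivers its parallel components in the reverse order; two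
  uses of commutativity inside the session restore the shape required by
  \<open>struct_extrude\<close>.\<close>

lemma itype_equiv_swap:
  "itype_equiv etyp (Sess k' g (Par R (Sess k f (Par Q' Q)))) (Sess k' g (Par (Sess k f (Par Q Q')) R))"
proof (rule itype_equiv_congr[where A = "itype_equiv etyp"])
  let ?C = "congr (itype_equiv etyp)"
  have "?C (Par R (Sess k f (Par Q' Q))) (Par (Sess k f (Par Q' Q)) R)"
    by (intro congr_base itype_equiv_comm)
  moreover have "?C (Par (Sess k f (Par Q' Q)) R) (Par (Sess k f (Par Q Q')) R)"
    by (intro congr_par congr_sess congr_refl congr_base itype_equiv_comm)
  ultimately show "?C (Sess k' g (Par R (Sess k f (Par Q' Q)))) (Sess k' g (Par (Sess k f (Par Q Q')) R))"
    by (intro congr_sess) (rule congr_trans)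
qed

lemma itype_equiv_struct: "struct_step P Q \<Longrightarrow> itype_equiv etyp P Q"
proof (induction rule: struct_step.induct)
  case (struct_alpha P Q)
  then show ?case by (rule itype_equiv_alpha)
next
  case (struct_extrude k k' R Q f g Q')
  let ?l = "Sess k f (Par Q (Sess k' g (Par Q' R)))"
  let ?m = "Sess k' g (Par R (Sess k f (Par Q' Q)))"
  have "ityped etyp \<Gamma> \<rho> ?l \<Delta> \<longleftrightarrow> ityped etyp \<Gamma> \<rho> ?m \<Delta>" for \<Gamma> \<rho> \<Delta>
    using ityped_extrude[of etyp \<Gamma> \<rho> k f Q k' g Q' R \<Delta>] ityped_extrude[of etyp \<Gamma> \<rho> k' g R k f Q' Q \<Delta>]
      struct_extrude by blast
  moreover have "fc ?l = fc ?m" using struct_extrude by auto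
  ultimately show ?case using itype_equiv_swap[of etyp k' g R k f Q' Q] by (simp add: itype_equiv_def)
next
  case (struct_comm P Q)
  then show ?case by (rule itype_equiv_comm)
next
  case (struct_assoc P Q R)
  then show ?case by (rule itype_equiv_assoc)
qed

section \<open>Reduction\<close>

lemma fc_vsub [simp]: "fc (vsub esub x v P) = fc P"
  by (induction P) (auto simp: image_image)

text \<open>Inputs on the way to an occurrence of \<open>x\<close> extend the variable environment,
  hence a hypothesis \<open>sub\<close> for all environments. An input on \<open>x\<close> itself
  shadows: the two variable environments coincide below it, and the substitution stops
  there.\<close>

lemma ityped_vsub:
  assumes "ityped etyp \<Gamma>' \<rho> P \<Delta>" "\<Gamma>' = \<Gamma>(x \<mapsto> G)"
    and sub: "\<And>\<Gamma> e G'. etyp (\<Gamma>(x \<mapsto> G)) e G' \<Longrightarrow> etyp \<Gamma> (esub e x v) G'"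
  shows "ityped etyp \<Gamma> \<rho> (vsub esub x v P) \<Delta>"
  using assms(1,2)
proof (induction arbitrary: \<Gamma> rule: ityped.induct)
  case (i_in \<rho> c k p \<Delta> G' S \<Gamma>' y P)
  have In: "ityped etyp \<Gamma> \<rho> (In c y R) \<Delta>" if "ityped etyp (\<Gamma>(y \<mapsto> G')) \<rho> R (\<Delta>((k, p) \<mapsto> S))" for R
    by (rule ityped.i_in[where \<Delta> = \<Delta> and \<rho> = \<rho>, OF i_in.hyps(1,2) that])
  show ?case
  proof (cases "y = x")
    case True
    then have "\<Gamma>'(y \<mapsto> G') = \<Gamma>(y \<mapsto> G')"
      unfolding i_in.prems by (simp del: fun_upd_apply)
    with In[of P] True i_in.hyps(3) show ?thesis by (simp del: fun_upd_apply)
  next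
    case False
    then have "\<Gamma>'(y \<mapsto> G') = (\<Gamma>(y \<mapsto> G'))(x \<mapsto> G)"
      unfolding i_in.prems by (simp add: fun_upd_twist del: fun_upd_apply)
    from In[OF i_in.IH[OF this]] False show ?thesis by simp
  qed
next
  case (i_out \<rho> c k p \<Delta> G' S \<Gamma>' e P)
  then have "etyp \<Gamma> (esub e x v) G'" using sub by blast
  from ityped.i_out[where \<Delta> = \<Delta> and \<rho> = \<rho>, OF i_out.hyps(1,2) this i_out.IH[OF i_out.prems]] show ?case by simp
next
  case (i_branch \<rho> c k p \<Delta> s' s b \<Gamma>')
  show ?case
    unfolding vsub.simps
    by (rule ityped.i_branch[where \<Delta> = \<Delta> and \<rho> = \<rho>, OF i_branch.hyps(1,2) _ i_branch.hyps(4,5)])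
      (use i_branch in \<open>auto simp del: fun_upd_apply\<close>)
next
  case (i_speculate \<rho> c k p \<Delta> s b \<Gamma>')
  show ?case
    unfolding vsub.simps
    by (rule ityped.i_speculate[where \<Delta> = \<Delta> and \<rho> = \<rho>, OF i_speculate.hyps(1,2) _ i_speculate.hyps(4)])
      (use i_speculate in \<open>auto simp del: fun_upd_apply\<close>)
next
  case (i_nil \<Delta> \<Gamma>' \<rho>)
  then show ?case by (simp add: ityped.i_nil)
next
  case (i_par \<Gamma>' \<rho> P \<Delta> A Q)
  show ?case using ityped.i_par[OF i_par.IH(1)[OF i_par.prems] i_par.IH(2)[OF i_par.prems]] by simp
next
  case (i_accept n \<Delta> P k \<rho> \<Gamma>' S a)
  show ?case
    using ityped.i_accept[OF i_accept.hyps(1) _ i_accept.IH[OF i_accept.prems]] i_accept.hyps(2) by simp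
next
  case (i_request n \<Delta> P k \<rho> \<Gamma>' S a)
  show ?case
    using ityped.i_request[OF i_request.hyps(1) _ i_request.IH[OF i_request.prems]] i_request.hyps(2)
    by simp
next
  case (i_catch \<rho> c k p \<Delta> S\<^sub>1 q S\<^sub>2 n P k' \<Gamma>')
  show ?case
    using ityped.i_catch[where \<Delta> = \<Delta> and \<rho> = \<rho>, OF i_catch.hyps(1-3) _ i_catch.IH[OF i_catch.prems]] i_catch.hyps(4) by simp
next
  case (i_throw \<rho> c k p d k' q \<Delta> S\<^sub>1 S\<^sub>2 \<Gamma>' P)
  show ?case using ityped.i_throw[where \<Delta> = \<Delta> and \<rho> = \<rho>, OF i_throw.hyps(1-5) i_throw.IH[OF i_throw.prems]] by simp
next
  case (i_select \<rho> c k p \<Delta> s l S \<Gamma>' P)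
  show ?case using ityped.i_select[where \<Delta> = \<Delta> and \<rho> = \<rho>, OF i_select.hyps(1-3) i_select.IH[OF i_select.prems]] by simp
next
  case (i_sess n \<Delta> P k \<rho> f S\<^sub>1 S\<^sub>2 \<Gamma>')
  show ?case
    using ityped.i_sess[OF i_sess.hyps(1,2) _ i_sess.hyps(4) i_sess.IH[OF i_sess.prems]] i_sess.hyps(3)
    by simp
next
  case (i_res n \<Delta> \<Gamma>' k \<rho> P)
  show ?case using ityped.i_res[OF i_res.hyps(1,2) i_res.IH[OF i_res.prems]] by simp
qed

lemma finite_fc [simp]: "finite (fc P)"
  by (induction P) auto

lemma finite_bn [simp]: "finite (bn P)"
  by (induction P) auto

section \<open>Compliance seen from either endpoint of a session\<close>

lemma co_neq [simp]: "co p \<noteq> p" "p \<noteq> co p"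
  by (cases p; simp)+

text \<open>\<open>S\<close> is the type at polarity \<open>p\<close> and \<open>S'\<close> the one
  at \<open>co p\<close>. The session rule puts the \<open>Minus\<close> type first in
  \<open>comply\<close>; reading compliance from the active endpoint treats both orientations of a
  communication at once.\<close>

definition comply_at :: "pol \<Rightarrow> 'l orch \<Rightarrow> ('l, 'g) stype \<Rightarrow> ('l, 'g) stype \<Rightarrow> bool" where
  "comply_at p f S S' = (case p of Minus \<Rightarrow> comply f S S' | Plus \<Rightarrow> comply f S' S)"

lemma ityped_sess_fresh_at:
  assumes "ityped etyp \<Gamma> \<rho> (Sess k f P) \<Delta>" "\<And>p. (n, p) \<notin> dom \<Delta>"
  obtains S S' where "comply_at p f S S'"
    "ityped etyp \<Gamma> (bind_all k n \<rho>) P (\<Delta>((n, p) \<mapsto> S, (n, co p) \<mapsto> S'))"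
proof (rule ityped_sess_fresh[OF assms])
  fix S\<^sub>1 S\<^sub>2
  assume f: "comply f S\<^sub>1 S\<^sub>2"
    and P: "ityped etyp \<Gamma> (bind_all k n \<rho>) P (\<Delta>((n, Minus) \<mapsto> S\<^sub>1, (n, Plus) \<mapsto> S\<^sub>2))"
  show thesis
  proof (cases p)
    case Plus
    have "\<Delta>((n, Minus) \<mapsto> S\<^sub>1, (n, Plus) \<mapsto> S\<^sub>2) = \<Delta>((n, Plus) \<mapsto> S\<^sub>2, (n, Minus) \<mapsto> S\<^sub>1)"
      by (rule fun_upd_twist) simp
    with Plus f P show thesis by (intro that[of S\<^sub>2 S\<^sub>1]) (simp_all add: comply_at_def)
  next
    case Minus
    with f P show thesis by (intro that[of S\<^sub>1 S\<^sub>2]) (simp_all add: comply_at_def)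
  qed
qed

lemma ityped_sess_intro_at:
  assumes "comply_at p f S S'" "\<And>r. (n, r) \<notin> dom \<Delta>" "\<And>r. Pol n r \<notin> \<rho> ` fc P"
    and "ityped etyp \<Gamma> (bind_all k n \<rho>) P (\<Delta>((n, p) \<mapsto> S, (n, co p) \<mapsto> S'))"
  shows "ityped etyp \<Gamma> \<rho> (Sess k f P) \<Delta>"
proof -
  have fresh: "\<forall>c \<in> fc P - chans k. \<forall>p. \<rho> c \<noteq> Pol n p" using assms(3) by force
  show ?thesis
  proof (cases p)
    case Plus
    have "\<Delta>((n, Minus) \<mapsto> S', (n, Plus) \<mapsto> S) = \<Delta>((n, Plus) \<mapsto> S, (n, Minus) \<mapsto> S')"
      by (rule fun_upd_twist) simp
    with Plus assms(1,4) show ?thesis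
      by (intro i_sess[OF assms(2) assms(2) fresh, of f S' S]) (simp_all add: comply_at_def)
  next
    case Minus
    with assms(1,4) show ?thesis
      by (intro i_sess[OF assms(2) assms(2) fresh, of f S S']) (simp_all add: comply_at_def)
  qed
qed

text \<open>\<open>nary\<close> is no constructor, as it collapses singletons to
  \<open>OPre\<close>, so inverting compliance leaves equations such as
  \<open>osum m = osum m'\<close>. A prefix determines its singleton map, and on the other maps
  \<open>nary C\<close> is the injective \<open>C\<close>.\<close>

lemma nary_inject:
  assumes "nary C m = nary C m'" "inj C" "\<And>m l f. C m \<noteq> OPre l f"
  shows "m = m'"
proof -
  have other: "nary C m = C m" if "\<nexists>l f. m = fmupd l f fmempty" for m
    using that unfolding nary_def by auto
  show ?thesis
    using assms other injD[OF assms(2)] by (metis nary_single orch.inject(2))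
qed

lemma osum_inject [simp]: "osum m = osum m' \<longleftrightarrow> m = m'"
  using nary_inject[of OSum m m'] by (auto simp: inj_def)

lemma oplus_inject [simp]: "oplus m = oplus m' \<longleftrightarrow> m = m'"
  using nary_inject[of OPlus m m'] by (auto simp: inj_def)

lemma comply_at_comm:
  assumes "comply_at p (Tick f) (OutG G S) (InG G' S')"
  shows "G' = G \<and> comply_at p f S S'"
  using assms by (cases p) (auto simp: comply_at_def elim: comply.cases)

lemma comply_at_deleg:
  assumes "comply_at p (Tick f) (OutS T q S) (InS T' q' S')"
  shows "T' = T \<and> q' = q \<and> comply_at p f S S'"
  using assms by (cases p) (auto simp: comply_at_def elim: comply.cases)

text \<open>On a singleton \<open>osum\<close> and \<open>oplus\<close> coincide, so the
  orchestrator alone does not tell which rule was used; the types \<open>Sel\<close> and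
  \<open>Bra\<close> do. The rule puts all labels of the selection among those of the
  branching.\<close>

lemma comply_at_select:
  assumes "comply_at p (osum m) (Sel s) (Bra s')" "fmlookup m l = Some f" "fmlookup s l = Some S"
  obtains S' where "fmlookup s' l = Some S'" "comply_at p f S S'"
proof (cases p)
  case Plus
  then have "comply (osum m) (Bra s') (Sel s)" using assms(1) by (simp add: comply_at_def)
  then show thesis
  proof cases
    case (comply_bra m')
    then have "l |\<in>| fmdom s'" using assms(3) by (metis fmdomI fsubsetD)
    then obtain S' where "fmlookup s' l = Some S'" by (metis fmlookup_dom_iff)
    with comply_bra Plus assms(2,3) show thesis by (intro that) (auto simp: comply_at_def)
  qed
next
  case Minus
  then have "comply (osum m) (Sel s) (Bra s')" using assms(1) by (simp add: comply_at_def)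
  then show thesis
  proof cases
    case (comply_sel m')
    then have "l |\<in>| fmdom s'" using assms(3) by (metis fmdomI fsubsetD)
    then obtain S' where "fmlookup s' l = Some S'" by (metis fmlookup_dom_iff)
    with comply_sel Minus assms(2,3) show thesis by (intro that) (auto simp: comply_at_def)
  qed
qed

text \<open>Here the label is chosen by the orchestrator, whose labels belong to both families; this
  yields the two continuation types together.\<close>

lemma comply_at_speculate:
  assumes "comply_at p (oplus m) (Spec s) (Bra s')" "fmlookup m l = Some f"
  obtains S S' where "fmlookup s l = Some S" "fmlookup s' l = Some S'" "comply_at p f S S'"
proof (cases p)
  case Plus
  then have "comply (oplus m) (Bra s') (Spec s)" using assms(1) by (simp add: comply_at_def)
  then show thesis
  proof cases
    case (comply_bra_spec m')
    have "m' = m" using comply_bra_spec(1) by simp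
    then have "l |\<in>| fmdom m'" using assms(2) by (simp add: fmdomI)
    then have "l |\<in>| fmdom s' |\<inter>| fmdom s" using comply_bra_spec(3) by (rule fsubsetD[rotated])
    then obtain S S' where "fmlookup s l = Some S" "fmlookup s' l = Some S'"
      by (metis finterD1 finterD2 fmlookup_dom_iff)
    with comply_bra_spec Plus assms(2) show thesis by (intro that) (auto simp: comply_at_def)
  qed
next
  case Minus
  then have "comply (oplus m) (Spec s) (Bra s')" using assms(1) by (simp add: comply_at_def)
  then show thesis
  proof cases
    case (comply_spec_bra m')
    have "m' = m" using comply_spec_bra(1) by simp
    then have "l |\<in>| fmdom m'" using assms(2) by (simp add: fmdomI)
    then have "l |\<in>| fmdom s |\<inter>| fmdom s'" using comply_spec_bra(3) by (rule fsubsetD[rotated])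
    then obtain S S' where "fmlookup s l = Some S" "fmlookup s' l = Some S'"
      by (metis finterD1 finterD2 fmlookup_dom_iff)
    with comply_spec_bra Minus assms(2) show thesis by (intro that) (auto simp: comply_at_def)
  qed
qed

section \<open>Opening a session, splitting its body and closing it again\<close>

lemma fresh_endpoints:
  fixes \<rho> :: "chan \<Rightarrow> chan"
  assumes "finite (dom (\<Delta> :: name \<times> pol \<rightharpoonup> 'a))"
  obtains n where "\<And>p. (n, p) \<notin> dom \<Delta>" "\<And>p. Pol n p \<notin> \<rho> ` fc P"
  using fresh_name[OF assms finite_imageI[OF finite_fc] finite.emptyI] by metis

text \<open>A component sees only its own endpoint of the session, so the type at the other one can
  be changed at will. Thus the continuations of both components fit shares of one common
  environment.\<close>

lemma restrict_upd_left:
  assumes "e \<in> A" "e' \<notin> A"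
  shows "((\<Delta>(e \<mapsto> S, e' \<mapsto> S')) |` A)(e \<mapsto> T) = (\<Delta>(e \<mapsto> T, e' \<mapsto> T')) |` A"
  using assms by (auto simp: restrict_map_def fun_eq_iff)

lemma restrict_upd_right:
  assumes "e \<in> A" "e' \<notin> A"
  shows "((\<Delta>(e \<mapsto> S, e' \<mapsto> S')) |` (- A))(e' \<mapsto> T') = (\<Delta>(e \<mapsto> T, e' \<mapsto> T')) |` (- A)"
  using assms by (auto simp: restrict_map_def fun_eq_iff)

text \<open>The split is arbitrary, but each of the two prefixes looks up its endpoint in its own
  share, which decides on which side that endpoint lies.\<close>

lemma restrict_endpoints:
  assumes "((\<Delta>((n, p) \<mapsto> S, (n, co p) \<mapsto> S')) |` A) (n, p) = Some U"
    and "((\<Delta>((n, p) \<mapsto> S, (n, co p) \<mapsto> S')) |` (- A)) (n, co p) = Some U'"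
  shows "(n, p) \<in> A" "(n, co p) \<notin> A" "U = S" "U' = S'"
  using assms by (auto simp: restrict_map_def split: if_splits)

text \<open>The rules for \<open>Request\<close> and \<open>Accept\<close> have picked unrelated
  names \<open>n\<^sub>1\<close> and \<open>n\<^sub>2\<close>. Both are replaced by one fresh
  \<open>n\<close>, whose two endpoints then carry the compliant types \<open>S\<close> and
  \<open>S'\<close>.\<close>

lemma red_link_ityped:
  assumes t: "ityped etyp \<Gamma> \<rho> (Par (Request a S k P) (Accept b S' k Q)) \<Delta>"
    and f: "comply f S S'" and fresh: "{Pol k Plus, Pol k Minus} \<inter> (fc P \<union> fc Q) = {}"
  shows "ityped etyp \<Gamma> \<rho> (Sess k f (Par (polarize k Minus P) (polarize k Plus Q))) \<Delta>"
proof -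
  let ?R = "Par (polarize k Minus P) (polarize k Plus Q)"
  obtain n where n: "\<And>r. (n, r) \<notin> dom \<Delta>" "\<And>r. Pol n r \<notin> \<rho> ` fc ?R"
    using fresh_endpoints[where \<rho> = \<rho> and P = "?R", OF ityped_finite[OF t]] by metis
  obtain A n\<^sub>1 n\<^sub>2 where
    n\<^sub>1: "(n\<^sub>1, Minus) \<notin> dom (\<Delta> |` A)" "\<forall>c \<in> fc P - {Bare k}. \<rho> c \<noteq> Pol n\<^sub>1 Minus"
    and P: "ityped etyp \<Gamma> (\<rho>(Bare k := Pol n\<^sub>1 Minus)) P ((\<Delta> |` A)((n\<^sub>1, Minus) \<mapsto> S))"
    and n\<^sub>2: "(n\<^sub>2, Plus) \<notin> dom (\<Delta> |` (- A))" "\<forall>c \<in> fc Q - {Bare k}. \<rho> c \<noteq> Pol n\<^sub>2 Plus"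
    and Q: "ityped etyp \<Gamma> (\<rho>(Bare k := Pol n\<^sub>2 Plus)) Q ((\<Delta> |` (- A))((n\<^sub>2, Plus) \<mapsto> S'))"
    using t unfolding ityped_par ityped_request ityped_accept by blast
  \<comment> \<open>Before \<open>n\<close> enters the environment it does not matter whether
    \<open>A\<close> contains its endpoints; now \<open>Minus\<close> must go to the requester and
    \<open>Plus\<close> to the accepter.\<close>
  define A' where "A' = insert (n, Minus) A - {(n, Plus)}"
  have nA: "(n, r) \<notin> dom (\<Delta> |` B)" for r B using n(1) by simp
  have P': "ityped etyp \<Gamma> (\<rho>(Bare k := Pol n Minus)) P ((\<Delta> |` A)((n, Minus) \<mapsto> S))"
    by (rule ityped_change_endpoint[OF P n\<^sub>1(1) nA n\<^sub>1(2)])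
  have Q': "ityped etyp \<Gamma> (\<rho>(Bare k := Pol n Plus)) Q ((\<Delta> |` (- A))((n, Plus) \<mapsto> S'))"
    by (rule ityped_change_endpoint[OF Q n\<^sub>2(1) nA n\<^sub>2(2)])
  have env: "(\<Delta>((n, Minus) \<mapsto> S, (n, Plus) \<mapsto> S')) |` A' = (\<Delta> |` A)((n, Minus) \<mapsto> S)"
    "(\<Delta>((n, Minus) \<mapsto> S, (n, Plus) \<mapsto> S')) |` (- A') = (\<Delta> |` (- A))((n, Plus) \<mapsto> S')"
    using n(1) by (auto simp: A'_def restrict_map_def fun_eq_iff dom_def)
  \<comment> \<open>The substituted \<open>Pol k p\<close> is interpreted as \<open>Pol n p\<close>.
    Other polarized occurrences of \<open>k\<close>, which \<open>bind_all\<close> would also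
    redirect, are excluded by the freshness condition of the reduction.\<close>
  have polarized: "ityped etyp \<Gamma> (bind_all k n \<rho>) (polarize k p R) D \<longleftrightarrow> ityped etyp \<Gamma> (\<rho>(Bare k := Pol n p)) R D"
    if "{Pol k Plus, Pol k Minus} \<inter> fc R = {}" for p R D
    unfolding polarize_def ityped_csub[OF avoids_polarize]
  proof (rule ityped_cong)
    fix c assume "c \<in> fc R"
    then have "c \<noteq> Pol k r" for r using that by (cases r) auto
    then show "(bind_all k n \<rho> \<circ> id(Bare k := Pol k p)) c = (\<rho>(Bare k := Pol n p)) c"
      by (cases "c \<in> chans k") (auto elim!: chans_cases)
  qed
  have "ityped etyp \<Gamma> (bind_all k n \<rho>) ?R (\<Delta>((n, Minus) \<mapsto> S, (n, Plus) \<mapsto> S'))"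
  proof (rule i_par)
    show "ityped etyp \<Gamma> (bind_all k n \<rho>) (polarize k Minus P)
        ((\<Delta>((n, Minus) \<mapsto> S, (n, Plus) \<mapsto> S')) |` A')"
      unfolding env using P' fresh by (subst polarized) auto
    show "ityped etyp \<Gamma> (bind_all k n \<rho>) (polarize k Plus Q)
        ((\<Delta>((n, Minus) \<mapsto> S, (n, Plus) \<mapsto> S')) |` (- A'))"
      unfolding env using Q' fresh by (subst polarized) auto
  qed
  then show ?thesis
    using f n by (intro ityped_sess_intro_at[of Minus f S S' n]) (simp_all add: comply_at_def)
qed

text \<open>The common frame of the communication axioms inside a session. The name \<open>n\<close>
  is chosen fresh for the interpretation of the reduct, because the session has to be closed again
  around it; only the shares of the two components are left to \<open>step\<close>.\<close>

lemma ityped_sess_step: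
  assumes t: "ityped etyp \<Gamma> \<rho> (Sess k f (Par P Q)) \<Delta>"
    and step: "\<And>n A S S'. \<lbrakk>\<And>r. (n, r) \<notin> dom \<Delta>; comply_at p f S S';
      ityped etyp \<Gamma> (bind_all k n \<rho>) P ((\<Delta>((n, p) \<mapsto> S, (n, co p) \<mapsto> S')) |` A);
      ityped etyp \<Gamma> (bind_all k n \<rho>) Q ((\<Delta>((n, p) \<mapsto> S, (n, co p) \<mapsto> S')) |` (- A))\<rbrakk> \<Longrightarrow>
      \<exists>A' T T'. comply_at p f' T T' \<and>
        ityped etyp \<Gamma> (bind_all k n \<rho>) P' ((\<Delta>((n, p) \<mapsto> T, (n, co p) \<mapsto> T')) |` A') \<and>
        ityped etyp \<Gamma> (bind_all k n \<rho>) Q' ((\<Delta>((n, p) \<mapsto> T, (n, co p) \<mapsto> T')) |` (- A'))"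
  shows "ityped etyp \<Gamma> \<rho> (Sess k f' (Par P' Q')) \<Delta>"
proof -
  obtain n where n: "\<And>r. (n, r) \<notin> dom \<Delta>" "\<And>r. Pol n r \<notin> \<rho> ` fc (Par P' Q')"
    using fresh_endpoints[where \<rho> = \<rho> and P = "Par P' Q'", OF ityped_finite[OF t]] by metis
  obtain S S' where f: "comply_at p f S S'"
    and body: "ityped etyp \<Gamma> (bind_all k n \<rho>) (Par P Q) (\<Delta>((n, p) \<mapsto> S, (n, co p) \<mapsto> S'))"
    using ityped_sess_fresh_at[where p = p, OF t n(1)] by metis
  obtain A where "ityped etyp \<Gamma> (bind_all k n \<rho>) P ((\<Delta>((n, p) \<mapsto> S, (n, co p) \<mapsto> S')) |` A)"
    "ityped etyp \<Gamma> (bind_all k n \<rho>) Q ((\<Delta>((n, p) \<mapsto> S, (n, co p) \<mapsto> S')) |` (- A))"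
    using body unfolding ityped_par by blast
  from step[OF n(1) f this] obtain A' T T' where f': "comply_at p f' T T'"
    and P': "ityped etyp \<Gamma> (bind_all k n \<rho>) P' ((\<Delta>((n, p) \<mapsto> T, (n, co p) \<mapsto> T')) |` A')"
    and Q': "ityped etyp \<Gamma> (bind_all k n \<rho>) Q' ((\<Delta>((n, p) \<mapsto> T, (n, co p) \<mapsto> T')) |` (- A'))"
    by blast
  show ?thesis
    by (rule ityped_sess_intro_at[OF f' n i_par[OF P' Q']])
qed

text \<open>In \<open>sub\<close>, \<open>\<Gamma>\<close> types the expression sent, whereas
  \<open>\<Gamma>'\<close> is the environment at an occurrence of \<open>x\<close>, possibly below
  further inputs.\<close>

lemma red_comm_ityped:
  assumes "ityped etyp \<Gamma> \<rho> (Sess k (Tick f) (Par (Out (Pol k p) e P) (In (Pol k (co p)) x Q))) \<Delta>"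
    and sub: "\<And>\<Gamma> \<Gamma>' G e' G'. etyp \<Gamma> e G \<Longrightarrow> etyp (\<Gamma>'(x \<mapsto> G)) e' G' \<Longrightarrow> etyp \<Gamma>' (esub e' x v) G'"
  shows "ityped etyp \<Gamma> \<rho> (Sess k f (Par P (vsub esub x v Q))) \<Delta>"
proof (rule ityped_sess_step[OF assms(1)])
  fix n A S S'
  let ?\<rho> = "bind_all k n \<rho>" and ?D = "\<lambda>S S'. \<Delta>((n, p) \<mapsto> S, (n, co p) \<mapsto> S')"
  assume f: "comply_at p (Tick f) S S'"
    and O: "ityped etyp \<Gamma> ?\<rho> (Out (Pol k p) e P) (?D S S' |` A)"
    and I: "ityped etyp \<Gamma> ?\<rho> (In (Pol k (co p)) x Q) (?D S S' |` (- A))"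
  obtain G T where O': "(?D S S' |` A) (n, p) = Some (OutG G T)" "etyp \<Gamma> e G"
    "ityped etyp \<Gamma> ?\<rho> P ((?D S S' |` A)((n, p) \<mapsto> T))"
    using O unfolding ityped_out bind_all_Pol chan.inject by blast
  obtain G' T' where I': "(?D S S' |` (- A)) (n, co p) = Some (InG G' T')"
    "ityped etyp (\<Gamma>(x \<mapsto> G')) ?\<rho> Q ((?D S S' |` (- A))((n, co p) \<mapsto> T'))"
    using I unfolding ityped_in bind_all_Pol chan.inject by blast
  note A = restrict_endpoints[OF O'(1) I'(1)]
  have f': "G' = G" "comply_at p f T T'"
    using comply_at_comm[of p f G T G' T'] f A(3,4) by simp_all
  have "ityped etyp \<Gamma> ?\<rho> (vsub esub x v Q) ((?D S S' |` (- A))((n, co p) \<mapsto> T'))"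
    by (rule ityped_vsub[OF I'(2) refl]) (use sub[OF O'(2)] f'(1) in blast)
  with O'(3) f'(2) show "\<exists>A' T T'. comply_at p f T T' \<and>
      ityped etyp \<Gamma> ?\<rho> P (?D T T' |` A') \<and> ityped etyp \<Gamma> ?\<rho> (vsub esub x v Q) (?D T T' |` (- A'))"
    unfolding restrict_upd_left[OF A(1,2), of \<Delta> S S' T T'] restrict_upd_right[OF A(1,2), of \<Delta> S S' T' T]
    by blast
qed

text \<open>The rule for \<open>Catch\<close> typed the receiver with some endpoint
  \<open>(n', r')\<close> of its own choice. The delegated endpoint comes from the sender's share,
  so it is new to the receiver's and can be put in that place by
  \<open>ityped_change_endpoint\<close>.\<close>

lemma red_deleg_ityped:
  assumes "ityped etyp \<Gamma> \<rho>
    (Sess k (Tick f) (Par (Throw (Pol k p) (Pol k' q) P) (Catch (Pol k (co p)) k' Q))) \<Delta>"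
  shows "ityped etyp \<Gamma> \<rho> (Sess k f (Par P (polarize k' q Q))) \<Delta>"
proof (rule ityped_sess_step[OF assms])
  fix n A S S'
  let ?\<rho> = "bind_all k n \<rho>" and ?D = "\<lambda>S S'. \<Delta>((n, p) \<mapsto> S, (n, co p) \<mapsto> S')"
  assume f: "comply_at p (Tick f) S S'"
    and O: "ityped etyp \<Gamma> ?\<rho> (Throw (Pol k p) (Pol k' q) P) (?D S S' |` A)"
    and I: "ityped etyp \<Gamma> ?\<rho> (Catch (Pol k (co p)) k' Q) (?D S S' |` (- A))"
  obtain m r U T where O': "?\<rho> (Pol k' q) = Pol m r" "(n, p) \<noteq> (m, r)"
    "(?D S S' |` A) (n, p) = Some (OutS U r T)" "(?D S S' |` A) (m, r) = Some U"
    "ityped etyp \<Gamma> ?\<rho> P ((?D S S' |` A)((n, p) \<mapsto> T, (m, r) := None))"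
    using O unfolding ityped_throw bind_all_Pol chan.inject by blast
  obtain U' r' T' n' where I': "(?D S S' |` (- A)) (n, co p) = Some (InS U' r' T')"
    "(n', r') \<notin> dom (?D S S' |` (- A))" "\<forall>d \<in> fc Q - {Bare k'}. ?\<rho> d \<noteq> Pol n' r'"
    "ityped etyp \<Gamma> (?\<rho>(Bare k' := Pol n' r')) Q
      ((?D S S' |` (- A))((n, co p) \<mapsto> T', (n', r') \<mapsto> U'))"
    using I unfolding ityped_catch bind_all_Pol chan.inject by blast
  note A = restrict_endpoints[OF O'(3) I'(1)]
  have f': "U' = U" "r' = r" "comply_at p f T T'"
    using comply_at_deleg[of p f U r T U' r' T'] f A(3,4) by simp_all
  have mA: "(m, r) \<in> A" using O'(4) by (auto simp: restrict_map_def split: if_splits)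
  then have m: "(m, r) \<noteq> (n, co p)" using A(2) by metis
  \<comment> \<open>The delegated endpoint changes sides. It is not the receiver's end of the
    session, since that one lies outside \<open>A\<close>, so it still has type \<open>U\<close>
    there.\<close>
  define A' where "A' = A - {(m, r)}"
  have "(?D S S' |` A)((n, p) \<mapsto> T, (m, r) := None) = ?D T T' |` A'"
    unfolding restrict_upd_left[OF A(1,2), of \<Delta> S S' T T'] A'_def
    by (auto simp: restrict_map_def fun_eq_iff)
  with O'(5) have P: "ityped etyp \<Gamma> ?\<rho> P (?D T T' |` A')" by metis
  have n'_dom: "(n', r) \<notin> dom ((?D S S' |` (- A))((n, co p) \<mapsto> T'))"
    using I'(1,2) f'(2) by auto
  have "(?D S S' |` (- A)) (m, r) = None" using mA by (intro restrict_out) simp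
  then have m_dom: "(m, r) \<notin> dom ((?D S S' |` (- A))((n, co p) \<mapsto> T'))"
    using m by (metis domIff fun_upd_other)
  have "ityped etyp \<Gamma> (?\<rho>(Bare k' := Pol m r)) Q
      ((?D S S' |` (- A))((n, co p) \<mapsto> T', (m, r) \<mapsto> U))"
    by (rule ityped_change_endpoint[OF I'(4)[unfolded f'(1,2)] n'_dom m_dom I'(3)[unfolded f'(2)]])
  moreover have "(?D S S' |` (- A))((n, co p) \<mapsto> T', (m, r) \<mapsto> U) = ?D T T' |` (- A')"
    unfolding restrict_upd_right[OF A(1,2), of \<Delta> S S' T' T] A'_def
    using O'(2,4) m mA by (auto simp: restrict_map_def fun_eq_iff)
  moreover have "?\<rho> \<circ> id(Bare k' := Pol k' q) = ?\<rho>(Bare k' := Pol m r)"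
    using O'(1) by auto
  ultimately have "ityped etyp \<Gamma> ?\<rho> (polarize k' q Q) (?D T T' |` (- A'))"
    unfolding polarize_def ityped_csub[OF avoids_polarize] by metis
  with P f'(3) show "\<exists>A' T T'. comply_at p f T T' \<and>
      ityped etyp \<Gamma> ?\<rho> P (?D T T' |` A') \<and> ityped etyp \<Gamma> ?\<rho> (polarize k' q Q) (?D T T' |` (- A'))"
    by blast
qed

lemma ityped_branch_lookup:
  assumes "ityped etyp \<Gamma> \<rho> (Branch c b) \<Delta>" "\<rho> c = Pol k p"
  obtains s where "\<Delta> (k, p) = Some (Bra s)"
    "\<And>l S Q. fmlookup s l = Some S \<Longrightarrow> fmlookup b l = Some Q \<Longrightarrow> ityped etyp \<Gamma> \<rho> Q (\<Delta>((k, p) \<mapsto> S))"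
proof -
  obtain s' s where "\<Delta> (k, p) = Some (Bra s')" "s' \<subseteq>\<^sub>f s"
    "\<And>l P S. fmlookup b l = Some P \<Longrightarrow> fmlookup s l = Some S \<Longrightarrow> ityped etyp \<Gamma> \<rho> P (\<Delta>((k, p) \<mapsto> S))"
    using assms unfolding ityped_branch by auto
  then show thesis by (intro that[of s']) (auto dest: fmsubset_lookup simp del: fun_upd_apply)
qed

lemma red_select_ityped:
  assumes "ityped etyp \<Gamma> \<rho> (Sess k (osum m) (Par (Select (Pol k p) l P) (Branch (Pol k (co p)) b))) \<Delta>"
    and m: "fmlookup m l = Some f" and b: "fmlookup b l = Some Q"
  shows "ityped etyp \<Gamma> \<rho> (Sess k f (Par P Q)) \<Delta>"
proof (rule ityped_sess_step[OF assms(1)])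
  fix n A S S'
  let ?\<rho> = "bind_all k n \<rho>" and ?D = "\<lambda>S S'. \<Delta>((n, p) \<mapsto> S, (n, co p) \<mapsto> S')"
  assume f: "comply_at p (osum m) S S'"
    and O: "ityped etyp \<Gamma> ?\<rho> (Select (Pol k p) l P) (?D S S' |` A)"
    and I: "ityped etyp \<Gamma> ?\<rho> (Branch (Pol k (co p)) b) (?D S S' |` (- A))"
  obtain s T where O': "(?D S S' |` A) (n, p) = Some (Sel s)" "fmlookup s l = Some T"
    "ityped etyp \<Gamma> ?\<rho> P ((?D S S' |` A)((n, p) \<mapsto> T))"
    using O unfolding ityped_select bind_all_Pol chan.inject by blast
  obtain s' where I': "(?D S S' |` (- A)) (n, co p) = Some (Bra s')"
    "\<And>T'. fmlookup s' l = Some T' \<Longrightarrow> ityped etyp \<Gamma> ?\<rho> Q ((?D S S' |` (- A))((n, co p) \<mapsto> T'))"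
    using ityped_branch_lookup[OF I bind_all_Pol] b by metis
  note A = restrict_endpoints[OF O'(1) I'(1)]
  obtain T' where T': "fmlookup s' l = Some T'" "comply_at p f T T'"
    using comply_at_select[of p m s s' l f T] f A(3,4) m O'(2) by metis
  from O'(3) I'(2)[OF T'(1)] T'(2) show "\<exists>A' T T'. comply_at p f T T' \<and>
      ityped etyp \<Gamma> ?\<rho> P (?D T T' |` A') \<and> ityped etyp \<Gamma> ?\<rho> Q (?D T T' |` (- A'))"
    unfolding restrict_upd_left[OF A(1,2), of \<Delta> S S' T T'] restrict_upd_right[OF A(1,2), of \<Delta> S S' T' T]
    by blast
qed

lemma red_speculate_ityped:
  assumes "ityped etyp \<Gamma> \<rho> (Sess k (oplus m) (Par (Speculate (Pol k p) b) (Branch (Pol k (co p)) b'))) \<Delta>"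
    and m: "fmlookup m l = Some f" and b: "fmlookup b l = Some P" "fmlookup b' l = Some Q"
  shows "ityped etyp \<Gamma> \<rho> (Sess k f (Par P Q)) \<Delta>"
proof (rule ityped_sess_step[OF assms(1)])
  fix n A S S'
  let ?\<rho> = "bind_all k n \<rho>" and ?D = "\<lambda>S S'. \<Delta>((n, p) \<mapsto> S, (n, co p) \<mapsto> S')"
  assume f: "comply_at p (oplus m) S S'"
    and O: "ityped etyp \<Gamma> ?\<rho> (Speculate (Pol k p) b) (?D S S' |` A)"
    and I: "ityped etyp \<Gamma> ?\<rho> (Branch (Pol k (co p)) b') (?D S S' |` (- A))"
  obtain s where O': "(?D S S' |` A) (n, p) = Some (Spec s)"
    "\<And>T. fmlookup s l = Some T \<Longrightarrow> ityped etyp \<Gamma> ?\<rho> P ((?D S S' |` A)((n, p) \<mapsto> T))"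
    using O b(1) unfolding ityped_speculate bind_all_Pol chan.inject by blast
  obtain s' where I': "(?D S S' |` (- A)) (n, co p) = Some (Bra s')"
    "\<And>T'. fmlookup s' l = Some T' \<Longrightarrow> ityped etyp \<Gamma> ?\<rho> Q ((?D S S' |` (- A))((n, co p) \<mapsto> T'))"
    using ityped_branch_lookup[OF I bind_all_Pol] b(2) by metis
  note A = restrict_endpoints[OF O'(1) I'(1)]
  obtain T T' where T: "fmlookup s l = Some T" "fmlookup s' l = Some T'" "comply_at p f T T'"
    using comply_at_speculate[of p m s s' l f] f A(3,4) m by metis
  from O'(2)[OF T(1)] I'(2)[OF T(2)] T(3) show "\<exists>A' T T'. comply_at p f T T' \<and>
      ityped etyp \<Gamma> ?\<rho> P (?D T T' |` A') \<and> ityped etyp \<Gamma> ?\<rho> Q (?D T T' |` (- A'))"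
    unfolding restrict_upd_left[OF A(1,2), of \<Delta> S S' T T'] restrict_upd_right[OF A(1,2), of \<Delta> S S' T' T]
    by blast
qed

text \<open>The claim ranges over all interpretations and environments because reduction below a
  session takes place where both have been extended.\<close>

lemma red_ityped:
  assumes "expression_language etyp eval esub"
  shows "red eval esub P Q \<Longrightarrow> ityped etyp \<Gamma> \<rho> P \<Delta> \<Longrightarrow> ityped etyp \<Gamma> \<rho> Q \<Delta>"
proof (induction arbitrary: \<Gamma> \<rho> \<Delta> rule: red.induct)
  case (red_link f S S' k P Q a b)
  show ?case by (rule red_link_ityped[OF red_link.prems red_link.hyps])
next
  case (red_comm e v k f p P x Q)
  interpret expression_language etyp eval esub by fact
  \<comment> \<open>Evaluation preserves the type \<open>G\<close> in \<open>\<Gamma>\<close>;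
    \<open>value_closed\<close> carries it over to \<open>\<Gamma>'\<close>, where substitution
    takes place.\<close>
  have "etyp \<Gamma>' (esub e' x v) G'" if "etyp \<Gamma> e G" "etyp (\<Gamma>'(x \<mapsto> G)) e' G'" for \<Gamma> \<Gamma>' G e' G'
    using substitution[OF red_comm.hyps _ that(2)] value_closed preservation that(1) red_comm.hyps
    by metis
  then show ?case by (rule red_comm_ityped[OF red_comm.prems])
next
  case (red_deleg k f p k' q P Q)
  then show ?case by (rule red_deleg_ityped)
next
  case (red_select m l f b Q k p P)
  show ?case by (rule red_select_ityped[OF red_select.prems red_select.hyps])
next
  case (red_speculate m l f b P b' Q k p)
  show ?case by (rule red_speculate_ityped[OF red_speculate.prems red_speculate.hyps])
next
  case (red_par P P' Q)
  then show ?case unfolding ityped_par by blast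
next
  case (red_sess P P' k f)
  \<comment> \<open>Freshness refers to the reduct \<open>P'\<close>, around which the session is
    rebuilt, so the free channels of \<open>P\<close> and \<open>P'\<close> need not be
    compared.\<close>
  obtain n where n: "\<And>r. (n, r) \<notin> dom \<Delta>" "\<And>r. Pol n r \<notin> \<rho> ` fc P'"
    using fresh_endpoints[where \<rho> = \<rho> and P = "P'", OF ityped_finite[OF red_sess.prems]] by metis
  obtain S S' where "comply_at Minus f S S'"
    "ityped etyp \<Gamma> (bind_all k n \<rho>) P (\<Delta>((n, Minus) \<mapsto> S, (n, co Minus) \<mapsto> S'))"
    using ityped_sess_fresh_at[where p = Minus, OF red_sess.prems n(1)] by metis
  then show ?case using red_sess.IH by (intro ityped_sess_intro_at[OF _ n])
next
  case (red_res P P' k)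
  then show ?case unfolding ityped_res by blast
next
  case (red_struct P P' Q' Q)
  have "itype_equiv etyp P P'"
    by (rule itype_equiv_congr[OF \<open>struct_congr P P'\<close>]) (rule itype_equiv_struct)
  moreover have "itype_equiv etyp Q' Q"
    by (rule itype_equiv_congr[OF \<open>struct_congr Q' Q\<close>]) (rule itype_equiv_struct)
  ultimately show ?case using red_struct.IH red_struct.prems by (simp add: itype_equiv_def)
qed

section \<open>Equivalence with the typing judgement\<close>

lemma fmlookup_fmupd: "fmlookup (fmupd e S \<Delta>) = (fmlookup \<Delta>)(e \<mapsto> S)"
  by (rule ext) simp

lemma notin_dom_fmlookup: "e \<notin> dom (fmlookup \<Delta>) \<longleftrightarrow> e |\<notin>| fmdom \<Delta>"
  by (metis domIff fmdom_notD fmdom_notI)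

text \<open>The rules of \<open>typed\<close> are instances in which the interpretation is the
  identity and a binder takes its own name as endpoint; \<open>t_alpha\<close> is absorbed by
  invariance under \<alpha>-conversion.\<close>

lemma typed_imp_ityped: "typed etyp \<Gamma> P \<Delta> \<Longrightarrow> ityped etyp \<Gamma> id P (fmlookup \<Delta>)"
proof (induction rule: typed.induct)
  case (t_nil \<Delta> \<Gamma>)
  then show ?case by (intro i_nil) (auto simp: ran_def fmlookup_ran'_iff)
next
  case (t_par \<Gamma> P \<Delta> Q \<Delta>')
  let ?A = "{e. fmlookup \<Delta>' e = None}"
  have disj: "fmlookup \<Delta> e = None \<or> fmlookup \<Delta>' e = None" for e
    using t_par.hyps(3) by (metis fempty_iff finterI fmdom_notI fmdom_notD)
  have "(fmlookup (\<Delta> ++\<^sub>f \<Delta>') |` ?A) e = fmlookup \<Delta> e"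
    "(fmlookup (\<Delta> ++\<^sub>f \<Delta>') |` (- ?A)) e = fmlookup \<Delta>' e" for e
    using disj[of e] by (auto simp: restrict_map_def fmlookup_dom_iff)
  then have "fmlookup (\<Delta> ++\<^sub>f \<Delta>') |` ?A = fmlookup \<Delta>" "fmlookup (\<Delta> ++\<^sub>f \<Delta>') |` (- ?A) = fmlookup \<Delta>'"
    by blast+
  with t_par.IH show ?case by (intro i_par[where A = ?A]) (simp_all only:)
next
  case (t_accept k P \<Delta> \<Gamma> S a)
  have "ityped etyp \<Gamma> (id(Bare k := Pol k Plus)) P ((fmlookup \<Delta>)((k, Plus) \<mapsto> S))"
    using t_accept.IH unfolding polarize_def ityped_csub[OF avoids_polarize] fmlookup_fmupd id_o .
  then show ?case
    by (rule i_accept[OF iffD2[OF notin_dom_fmlookup t_accept.hyps(2)], rotated]) (use t_accept.hyps(1) in auto)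
next
  case (t_request k P \<Delta> \<Gamma> S a)
  have "ityped etyp \<Gamma> (id(Bare k := Pol k Minus)) P ((fmlookup \<Delta>)((k, Minus) \<mapsto> S))"
    using t_request.IH unfolding polarize_def ityped_csub[OF avoids_polarize] fmlookup_fmupd id_o .
  then show ?case
    by (rule i_request[OF iffD2[OF notin_dom_fmlookup t_request.hyps(2)], rotated]) (use t_request.hyps(1) in auto)
next
  case (t_in k p \<Delta> \<Gamma> x G P S)
  show ?case
    unfolding fmlookup_fmupd
    by (rule i_in[of id "Pol k p" k p _ G S, OF id_apply])
      (use t_in.IH[unfolded fmlookup_fmupd] in \<open>simp_all add: fun_upd_same del: fun_upd_apply id_apply\<close>)
next
  case (t_out k p \<Delta> \<Gamma> e G P S)
  show ?case
    unfolding fmlookup_fmupd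
    by (rule i_out[of id "Pol k p" k p _ G S, OF id_apply])
      (use t_out.IH[unfolded fmlookup_fmupd] t_out.hyps in \<open>simp_all add: fun_upd_same del: fun_upd_apply id_apply\<close>)
next
  case (t_catch k' q P k p \<Delta> \<Gamma> S\<^sub>1 S\<^sub>2)
  have "ityped etyp \<Gamma> (id(Bare k' := Pol k' q)) P
      ((fmlookup \<Delta>)((k, p) \<mapsto> InS S\<^sub>1 q S\<^sub>2, (k, p) \<mapsto> S\<^sub>2, (k', q) \<mapsto> S\<^sub>1))"
    using t_catch.IH
    unfolding polarize_def ityped_csub[OF avoids_polarize] fmlookup_fmupd id_o fun_upd_upd .
  then show ?case
    unfolding fmlookup_fmupd
    by (rule i_catch[of id "Pol k p" k p _ S\<^sub>1 q S\<^sub>2 k', rotated 4])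
      (use t_catch.hyps(1-4) in \<open>auto simp: fmdom_notD fmlookup_dom'_iff\<close>)
next
  case (t_throw k p \<Delta> k' q \<Gamma> P S\<^sub>2 S\<^sub>1)
  have "(fmlookup (fmupd (k', q) S\<^sub>1 (fmupd (k, p) (OutS S\<^sub>1 q S\<^sub>2) \<Delta>)))((k, p) \<mapsto> S\<^sub>2, (k', q) := None)
      = fmlookup (fmupd (k, p) S\<^sub>2 \<Delta>)"
    using t_throw.hyps(2,3) by (auto simp: fun_eq_iff fmdom_notD)
  with t_throw.IH have "ityped etyp \<Gamma> id P
      ((fmlookup (fmupd (k', q) S\<^sub>1 (fmupd (k, p) (OutS S\<^sub>1 q S\<^sub>2) \<Delta>)))((k, p) \<mapsto> S\<^sub>2, (k', q) := None))"
    by metis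
  then show ?case
    by (rule i_throw[of id "Pol k p" k p "Pol k' q" k' q _ S\<^sub>1 S\<^sub>2, rotated 5])
      (use t_throw.hyps(3) in auto)
next
  case (t_branch k p \<Delta> s b s' \<Gamma>)
  show ?case
    unfolding fmlookup_fmupd
    by (rule i_branch[of id "Pol k p" k p _ s' s, OF id_apply])
      (use t_branch.IH[unfolded fmlookup_fmupd] t_branch.hyps in \<open>auto simp: fun_upd_same simp del: fun_upd_apply id_apply\<close>)
next
  case (t_select k p \<Delta> s l S \<Gamma> P)
  show ?case
    unfolding fmlookup_fmupd
    by (rule i_select[of id "Pol k p" k p _ s l S, OF id_apply])
      (use t_select.IH[unfolded fmlookup_fmupd] t_select.hyps in \<open>simp_all add: fun_upd_same del: fun_upd_apply id_apply\<close>)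
next
  case (t_speculate k p \<Delta> s b \<Gamma>)
  show ?case
    unfolding fmlookup_fmupd
    by (rule i_speculate[of id "Pol k p" k p _ s, OF id_apply])
      (use t_speculate.IH[unfolded fmlookup_fmupd] t_speculate.hyps in \<open>auto simp: fun_upd_same simp del: fun_upd_apply id_apply\<close>)
next
  case (t_sess k \<Delta> f S\<^sub>1 S\<^sub>2 \<Gamma> P)
  have "bind_all k k id = id" by (auto simp: bind_all_def fun_eq_iff)
  with t_sess.IH have "ityped etyp \<Gamma> (bind_all k k id) P ((fmlookup \<Delta>)((k, Minus) \<mapsto> S\<^sub>1, (k, Plus) \<mapsto> S\<^sub>2))"
    unfolding fmlookup_fmupd by (simp only:)
  then show ?case
    by (rule i_sess[OF iffD2[OF notin_dom_fmlookup t_sess.hyps(1)] iffD2[OF notin_dom_fmlookup t_sess.hyps(2)]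
          _ t_sess.hyps(3), rotated]) auto
next
  case (t_res k \<Delta> \<Gamma> P)
  have "bind_all k k id = id" by (auto simp: bind_all_def fun_eq_iff)
  with t_res show ?case by (intro i_res[of k]) (simp_all only: notin_dom_fmlookup not_False_eq_True)
next
  case (t_alpha P P' \<Gamma> \<Delta>)
  have "itype_equiv etyp P P'"
    by (rule itype_equiv_congr[OF t_alpha.hyps(1)]) (rule itype_equiv_alpha)
  with t_alpha.IH show ?case by (simp add: itype_equiv_def)
qed

text \<open>Below a binder both substitutions fix what it binds. As \<open>\<sigma>\<close> moves no
  other channel onto a bound one, \<open>\<tau>\<close> acts on the result as it does outside the
  binder.\<close>

lemma csub_csub: "avoids (bn P) \<sigma> \<Longrightarrow> csub (csub P \<sigma>) \<tau> = csub P (\<tau> \<circ> \<sigma>)"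
proof (induction P arbitrary: \<sigma> \<tau>)
  case (Par P Q)
  then have "avoids (bn P) \<sigma>" "avoids (bn Q) \<sigma>" by (auto elim: avoids_mono)
  then show ?case using Par.IH by simp
next
  case (Request a S k P)
  then have av: "avoids (bn P) (fix_on {Bare k} \<sigma>)" by (auto elim: avoids_mono intro: avoids_fix_on)
  have "fix_on {Bare k} \<tau> \<circ> fix_on {Bare k} \<sigma> = fix_on {Bare k} (\<tau> \<circ> \<sigma>)"
    using avoids_Bare[OF Request.prems, of k] by (auto simp: fix_on_def fun_eq_iff)
  then show ?case unfolding csub.simps Request.IH[OF av] by (simp only: comp_apply)
next
  case (Accept a S k P)
  then have av: "avoids (bn P) (fix_on {Bare k} \<sigma>)" by (auto elim: avoids_mono intro: avoids_fix_on)
  have "fix_on {Bare k} \<tau> \<circ> fix_on {Bare k} \<sigma> = fix_on {Bare k} (\<tau> \<circ> \<sigma>)"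
    using avoids_Bare[OF Accept.prems, of k] by (auto simp: fix_on_def fun_eq_iff)
  then show ?case unfolding csub.simps Accept.IH[OF av] by (simp only: comp_apply)
next
  case (Catch c k P)
  then have av: "avoids (bn P) (fix_on {Bare k} \<sigma>)" by (auto elim: avoids_mono intro: avoids_fix_on)
  have "fix_on {Bare k} \<tau> \<circ> fix_on {Bare k} \<sigma> = fix_on {Bare k} (\<tau> \<circ> \<sigma>)"
    using avoids_Bare[OF Catch.prems, of k] by (auto simp: fix_on_def fun_eq_iff)
  then show ?case unfolding csub.simps Catch.IH[OF av] by (simp only: comp_apply)
next
  case (Branch c b)
  have "csub (csub P \<sigma>) \<tau> = csub P (\<tau> \<circ> \<sigma>)" if "P \<in> fmran' b" for P
    by (rule Branch.IH[OF that avoids_mono[OF Branch.prems]]) (use that in auto)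
  then show ?case by (auto intro!: fmap.map_cong simp: fmap.map_comp comp_def)
next
  case (Speculate c b)
  have "csub (csub P \<sigma>) \<tau> = csub P (\<tau> \<circ> \<sigma>)" if "P \<in> fmran' b" for P
    by (rule Speculate.IH[OF that avoids_mono[OF Speculate.prems]]) (use that in auto)
  then show ?case by (auto intro!: fmap.map_cong simp: fmap.map_comp comp_def)
next
  case (Sess k f P)
  then have av: "avoids (bn P) (fix_on (chans k) \<sigma>)" by (auto elim: avoids_mono intro: avoids_fix_on)
  have "fix_on (chans k) \<tau> \<circ> fix_on (chans k) \<sigma> = fix_on (chans k) (\<tau> \<circ> \<sigma>)"
    using avoids_chans[OF Sess.prems, of k] by (auto simp: fix_on_def fun_eq_iff)
  then show ?case unfolding csub.simps Sess.IH[OF av] by (simp only: comp_apply)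
next
  case (Res k P)
  then have av: "avoids (bn P) (fix_on (chans k) \<sigma>)" by (auto elim: avoids_mono intro: avoids_fix_on)
  have "fix_on (chans k) \<tau> \<circ> fix_on (chans k) \<sigma> = fix_on (chans k) (\<tau> \<circ> \<sigma>)"
    using avoids_chans[OF Res.prems, of k] by (auto simp: fix_on_def fun_eq_iff)
  then show ?case unfolding csub.simps Res.IH[OF av] by (simp only: comp_apply)
qed simp_all

lemma csub_cong: "(\<And>c. c \<in> fc P \<Longrightarrow> \<sigma> c = \<tau> c) \<Longrightarrow> csub P \<sigma> = csub P \<tau>"
proof (induction P arbitrary: \<sigma> \<tau>)
  case (Request a S k P)
  have "csub P (fix_on {Bare k} \<sigma>) = csub P (fix_on {Bare k} \<tau>)"
    by (rule Request.IH) (use Request.prems in \<open>auto simp: fix_on_def\<close>)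
  then show ?case by simp
next
  case (Accept a S k P)
  have "csub P (fix_on {Bare k} \<sigma>) = csub P (fix_on {Bare k} \<tau>)"
    by (rule Accept.IH) (use Accept.prems in \<open>auto simp: fix_on_def\<close>)
  then show ?case by simp
next
  case (Catch c k P)
  have "csub P (fix_on {Bare k} \<sigma>) = csub P (fix_on {Bare k} \<tau>)"
    by (rule Catch.IH) (use Catch.prems in \<open>auto simp: fix_on_def\<close>)
  then show ?case using Catch.prems by simp
next
  case (Branch c b)
  have "csub P \<sigma> = csub P \<tau>" if "P \<in> fmran' b" for P
    by (rule Branch.IH[OF that Branch.prems]) (use that in auto)
  then show ?case using Branch.prems by (auto intro!: fmap.map_cong)
next
  case (Speculate c b)
  have "csub P \<sigma> = csub P \<tau>" if "P \<in> fmran' b" for P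
    by (rule Speculate.IH[OF that Speculate.prems]) (use that in auto)
  then show ?case using Speculate.prems by (auto intro!: fmap.map_cong)
next
  case (Sess k f P)
  have "csub P (fix_on (chans k) \<sigma>) = csub P (fix_on (chans k) \<tau>)"
    by (rule Sess.IH) (use Sess.prems in \<open>auto simp: fix_on_def\<close>)
  then show ?case by simp
next
  case (Res k P)
  have "csub P (fix_on (chans k) \<sigma>) = csub P (fix_on (chans k) \<tau>)"
    by (rule Res.IH) (use Res.prems in \<open>auto simp: fix_on_def\<close>)
  then show ?case by simp
next
  case (Par P Q)
  have "csub P \<sigma> = csub P \<tau>" "csub Q \<sigma> = csub Q \<tau>"
    using Par.prems by (simp_all add: Par.IH[of \<sigma> \<tau>])
  then show ?case by simp
next
  case (Out c e P)
  have "csub P \<sigma> = csub P \<tau>"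
    using Out.prems by (simp add: Out.IH[of \<sigma> \<tau>])
  then show ?case using Out.prems by simp
next
  case (In c x P)
  have "csub P \<sigma> = csub P \<tau>"
    using In.prems by (simp add: In.IH[of \<sigma> \<tau>])
  then show ?case using In.prems by simp
next
  case (Throw c d P)
  have "csub P \<sigma> = csub P \<tau>"
    using Throw.prems by (simp add: Throw.IH[of \<sigma> \<tau>])
  then show ?case using Throw.prems by simp
next
  case (Select c l P)
  have "csub P \<sigma> = csub P \<tau>"
    using Select.prems by (simp add: Select.IH[of \<sigma> \<tau>])
  then show ?case using Select.prems by simp
qed simp

lemma fix_on_ident: "fix_on A (\<lambda>c. c) = (\<lambda>c. c)"
  by (rule ext) (simp add: fix_on_def)

lemma csub_id [simp]: "csub P id = P"
proof (induction P)
  case (Branch c b)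
  then show ?case by (simp add: fmap.map_cong[where g = id] fmap.map_id)
next
  case (Speculate c b)
  then show ?case by (simp add: fmap.map_cong[where g = id] fmap.map_id)
qed (simp_all add: fix_on_ident)

text \<open>Substituting outside the binder, renaming the binder to \<open>k'\<close> and polarizing
  it amounts to a single substitution that extends \<open>\<rho>\<close>. In this form an induction
  hypothesis about the body applies.\<close>

lemma polarize_rename_csub:
  assumes "avoids (insert k (bn P)) \<rho>" "k' \<notin> bn P" "\<And>c. c \<in> fc P \<Longrightarrow> \<rho> c \<notin> chans k'"
  shows "polarize k' p (rename_bare k k' (csub P (fix_on {Bare k} \<rho>))) = csub P (\<rho>(Bare k := Pol k' p))"
proof -
  have av: "avoids (bn P) (fix_on {Bare k} \<rho>)"
    using assms(1) by (auto elim: avoids_mono intro: avoids_fix_on)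
  let ?\<sigma> = "id(Bare k := Bare k')" and ?\<tau> = "id(Bare k' := Pol k' p)"
  have "csub (csub (csub P (fix_on {Bare k} \<rho>)) ?\<sigma>) ?\<tau> = csub (csub P (fix_on {Bare k} \<rho>)) (?\<tau> \<circ> ?\<sigma>)"
    by (rule csub_csub) (use avoids_rename_bare[OF assms(2)] in simp)
  also have "\<dots> = csub P (?\<tau> \<circ> ?\<sigma> \<circ> fix_on {Bare k} \<rho>)"
    by (rule csub_csub[OF av])
  also have "\<dots> = csub P (\<rho>(Bare k := Pol k' p))"
  proof (rule csub_cong)
    fix c assume c: "c \<in> fc P"
    show "(?\<tau> \<circ> ?\<sigma> \<circ> fix_on {Bare k} \<rho>) c = (\<rho>(Bare k := Pol k' p)) c"
    proof (cases "c = Bare k")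
      case False
      then have "\<rho> c \<noteq> Bare k" "\<rho> c \<noteq> Bare k'"
        using avoids_Bare[OF assms(1), of k c] assms(3)[OF c] by auto
      with False show ?thesis by (simp add: fix_on_def)
    qed (simp add: fix_on_def)
  qed
  finally show ?thesis by (simp only: polarize_def rename_bare_def)
qed

lemma rename_all_csub:
  assumes "avoids (insert k (bn P)) \<rho>"
  shows "rename_all k k' (csub P (fix_on (chans k) \<rho>)) = csub P (bind_all k k' \<rho>)"
proof -
  have av: "avoids (bn P) (fix_on (chans k) \<rho>)"
    using assms by (auto elim: avoids_mono intro: avoids_fix_on)
  have "bind_all k k' id \<circ> fix_on (chans k) \<rho> = bind_all k k' (id \<circ> \<rho>)"
    by (rule comp_fix_on_chans[OF assms]) simp
  then show ?thesis
    unfolding rename_all_bind_all csub_csub[OF av] by simp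
qed

text \<open>One name, fresh at once for the environment, the interpreted free channels and the bound
  names, meets the side conditions of \<alpha>-conversion and of the typing rule, for both kinds of
  binder.\<close>

lemma fresh_binder:
  fixes \<rho> :: "chan \<Rightarrow> chan" and \<Delta> :: "('l, 'g) senv"
  assumes "avoids (insert k (bn P)) \<rho>"
  obtains k' where "\<And>p. (k', p) |\<notin>| fmdom \<Delta>" "\<And>p. (k', p) \<notin> dom (fmlookup \<Delta>)"
    "k' \<notin> insert k (bn P)" "avoids (bn P) (\<rho>(Bare k := Pol k' p))" "avoids (bn P) (bind_all k k' \<rho>)"
    "\<And>c. c \<in> fc P \<Longrightarrow> \<rho> c \<notin> chans k'"
    "Bare k' \<notin> fc (csub P (fix_on {Bare k} \<rho>))"
    "Pol k' p \<notin> fc (rename_bare k k' (csub P (fix_on {Bare k} \<rho>)))"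
    "chans k' \<inter> fc (csub P (fix_on (chans k) \<rho>)) = {}"
proof -
  have "finite (dom (fmlookup \<Delta>))" by simp
  moreover have "finite (\<rho> ` fc P)" "finite (insert k (bn P))" by simp_all
  ultimately obtain k' where k': "\<And>p. (k', p) \<notin> dom (fmlookup \<Delta>)" "\<And>p. Pol k' p \<notin> \<rho> ` fc P"
    "Bare k' \<notin> \<rho> ` fc P" "k' \<notin> insert k (bn P)"
    using fresh_name by metis
  have c: "\<rho> c \<notin> chans k'" if "c \<in> fc P" for c
    using k'(2,3) imageI[OF that, of \<rho>] by (metis chans_cases)
  have av: "avoids (bn P) \<rho>" "avoids (bn P) (fix_on {Bare k} \<rho>)" "avoids (bn P) (fix_on (chans k) \<rho>)"
    using assms by (auto elim: avoids_mono intro: avoids_fix_on)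
  have bare: "fix_on {Bare k} \<rho> c \<notin> chans k'" if "c \<in> fc P" for c
    using c[OF that] k'(4) by (auto simp: fix_on_def)
  have bare': "d \<notin> chans k'" if "d \<in> fc (csub P (fix_on {Bare k} \<rho>))" for d
    using that bare unfolding fc_csub[OF av(2)] by blast
  show thesis
  proof (rule that[of k'])
    show "(k', p) |\<notin>| fmdom \<Delta>" for p using k'(1) notin_dom_fmlookup by blast
    show "(k', p) \<notin> dom (fmlookup \<Delta>)" for p by (rule k'(1))
    show "k' \<notin> insert k (bn P)" by (rule k'(4))
    show "avoids (bn P) (\<rho>(Bare k := Pol k' p))"
      using av(1) k'(4) by (intro avoids_fun_upd) auto
    show "avoids (bn P) (bind_all k k' \<rho>)"
      using av(1) k'(4) by (intro avoids_bind_all) auto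
    show "\<rho> c \<notin> chans k'" if "c \<in> fc P" for c using that by (rule c)
    show "Bare k' \<notin> fc (csub P (fix_on {Bare k} \<rho>))"
      using bare'[of "Bare k'"] by auto
    have "avoids (bn (csub P (fix_on {Bare k} \<rho>))) (id(Bare k := Bare k'))"
      using k'(4) by (intro avoids_rename_bare) simp
    from fc_csub[OF this] show "Pol k' p \<notin> fc (rename_bare k k' (csub P (fix_on {Bare k} \<rho>)))"
      unfolding rename_bare_def using bare'[of "Pol k' p"] by (auto split: if_splits)
    show "chans k' \<inter> fc (csub P (fix_on (chans k) \<rho>)) = {}"
      unfolding fc_csub[OF av(3)] using c k'(4) by (auto simp: fix_on_def chans_iff)
  qed
qed

text \<open>The rules of \<open>typed\<close> present the environment as an update of one without
  the endpoint. Together with \<open>fmupd_same\<close> this brings an arbitrary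
  \<open>\<Delta>\<close> into that shape by dropping the endpoint and adding it again.\<close>

lemma fmupd_fmdrop [simp]: "fmupd e S (fmdrop e \<Delta>) = fmupd e S \<Delta>"
  by (rule fmap_ext) simp

lemma fmupd_same: "fmlookup \<Delta> e = Some S \<Longrightarrow> fmupd e S \<Delta> = \<Delta>"
  by (rule fmap_ext) auto

lemma fmdom_disjointI:
  assumes "\<And>e. fmlookup m e = None \<or> fmlookup n e = None"
  shows "fmdom m |\<inter>| fmdom n = {||}"
proof (rule ccontr)
  assume "fmdom m |\<inter>| fmdom n \<noteq> {||}"
  then obtain e where "e |\<in>| fmdom m |\<inter>| fmdom n" by blast
  then have "e |\<in>| fmdom m" "e |\<in>| fmdom n" by (rule finterD1, rule finterD2)
  then show False using assms[of e] by (auto simp: fmlookup_dom_iff)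
qed

lemma fmfilter_add_compl: "fmfilter (\<lambda>e. e \<in> A) \<Delta> ++\<^sub>f fmfilter (\<lambda>e. e \<notin> A) \<Delta> = \<Delta>"
proof (rule fmap_ext)
  fix e
  have "e |\<in>| fmdom (fmfilter (\<lambda>e. e \<notin> A) \<Delta>) \<longleftrightarrow> e \<notin> A \<and> fmlookup \<Delta> e \<noteq> None"
    by (auto simp only: fmlookup_dom_iff fmlookup_filter split: if_splits)
  then show "fmlookup (fmfilter (\<lambda>e. e \<in> A) \<Delta> ++\<^sub>f fmfilter (\<lambda>e. e \<notin> A) \<Delta>) e = fmlookup \<Delta> e"
    unfolding fmlookup_add fmlookup_filter by auto
qed

text \<open>Induction is on the process, because at a binder the given derivation is first
  transported from its own endpoint to a fresh name \<open>k'\<close>. The typing rule is applied to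
  the variant bound by \<open>k'\<close>, and \<open>t_alpha\<close> leads back to the original
  binder.\<close>

lemma ityped_imp_typed:
  "ityped etyp \<Gamma> \<rho> P (fmlookup \<Delta>) \<Longrightarrow> avoids (bn P) \<rho> \<Longrightarrow> typed etyp \<Gamma> (csub P \<rho>) \<Delta>"
proof (induction P arbitrary: \<Gamma> \<rho> \<Delta>)
  case PNil
  then show ?case by (auto simp: ityped_nil fmlookup_ran'_iff intro!: t_nil ranI)
next
  case (Par P Q)
  then obtain A where "ityped etyp \<Gamma> \<rho> P (fmlookup \<Delta> |` A)" "ityped etyp \<Gamma> \<rho> Q (fmlookup \<Delta> |` (- A))"
    by (auto simp: ityped_par)
  moreover have "fmlookup (fmfilter (\<lambda>e. e \<in> A) \<Delta>) = fmlookup \<Delta> |` A"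
    "fmlookup (fmfilter (\<lambda>e. e \<notin> A) \<Delta>) = fmlookup \<Delta> |` (- A)"
    by (auto simp: restrict_map_def fun_eq_iff)
  moreover have "avoids (bn P) \<rho>" "avoids (bn Q) \<rho>" using Par.prems(2) by (auto elim: avoids_mono)
  ultimately have "typed etyp \<Gamma> (csub P \<rho>) (fmfilter (\<lambda>e. e \<in> A) \<Delta>)"
    "typed etyp \<Gamma> (csub Q \<rho>) (fmfilter (\<lambda>e. e \<notin> A) \<Delta>)"
    using Par.IH by simp_all
  moreover have "fmdom (fmfilter (\<lambda>e. e \<in> A) \<Delta>) |\<inter>| fmdom (fmfilter (\<lambda>e. e \<notin> A) \<Delta>) = {||}"
    by (rule fmdom_disjointI) simp
  ultimately have "typed etyp \<Gamma> (Par (csub P \<rho>) (csub Q \<rho>)) \<Delta>"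
    using fmfilter_add_compl by (metis t_par)
  then show ?case by simp
next
  case (Request a S k P)
  then have av: "avoids (insert k (bn P)) \<rho>" by simp
  obtain n where n: "(n, Minus) \<notin> dom (fmlookup \<Delta>)" "\<forall>c \<in> fc P - {Bare k}. \<rho> c \<noteq> Pol n Minus"
    and P: "ityped etyp \<Gamma> (\<rho>(Bare k := Pol n Minus)) P ((fmlookup \<Delta>)((n, Minus) \<mapsto> S))"
    using Request.prems(1) unfolding ityped_request by blast
  obtain k' where k': "\<And>p. (k', p) |\<notin>| fmdom \<Delta>" "\<And>p. (k', p) \<notin> dom (fmlookup \<Delta>)"
    "k' \<notin> insert k (bn P)" "avoids (bn P) (\<rho>(Bare k := Pol k' Minus))"
    "\<And>c. c \<in> fc P \<Longrightarrow> \<rho> c \<notin> chans k'" "Bare k' \<notin> fc (csub P (fix_on {Bare k} \<rho>))"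
    "Pol k' Minus \<notin> fc (rename_bare k k' (csub P (fix_on {Bare k} \<rho>)))"
    using fresh_binder[where \<Delta> = \<Delta> and p = Minus, OF av] by metis
  have "ityped etyp \<Gamma> (\<rho>(Bare k := Pol k' Minus)) P (fmlookup (fmupd (k', Minus) S \<Delta>))"
    unfolding fmlookup_fmupd by (rule ityped_change_endpoint[OF P n(1) k'(2) n(2)])
  then have "typed etyp \<Gamma> (csub P (\<rho>(Bare k := Pol k' Minus))) (fmupd (k', Minus) S \<Delta>)"
    using k'(4) by (rule Request.IH)
  moreover have "csub P (\<rho>(Bare k := Pol k' Minus)) =
      polarize k' Minus (rename_bare k k' (csub P (fix_on {Bare k} \<rho>)))"
    by (rule polarize_rename_csub[OF av _ k'(5), symmetric]) (use k'(3) in simp_all)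
  ultimately have "typed etyp \<Gamma> (Request a S k' (rename_bare k k' (csub P (fix_on {Bare k} \<rho>)))) \<Delta>"
    using k'(1,7) by (intro t_request) simp_all
  moreover have "alpha_step (Request a S k (csub P (fix_on {Bare k} \<rho>)))
      (Request a S k' (rename_bare k k' (csub P (fix_on {Bare k} \<rho>))))"
    using k'(3,6) by (intro alpha_request) simp_all
  ultimately show ?case by (auto intro: t_alpha congr_base)
next
  case (Accept a S k P)
  then have av: "avoids (insert k (bn P)) \<rho>" by simp
  obtain n where n: "(n, Plus) \<notin> dom (fmlookup \<Delta>)" "\<forall>c \<in> fc P - {Bare k}. \<rho> c \<noteq> Pol n Plus"
    and P: "ityped etyp \<Gamma> (\<rho>(Bare k := Pol n Plus)) P ((fmlookup \<Delta>)((n, Plus) \<mapsto> S))"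
    using Accept.prems(1) unfolding ityped_accept by blast
  obtain k' where k': "\<And>p. (k', p) |\<notin>| fmdom \<Delta>" "\<And>p. (k', p) \<notin> dom (fmlookup \<Delta>)"
    "k' \<notin> insert k (bn P)" "avoids (bn P) (\<rho>(Bare k := Pol k' Plus))"
    "\<And>c. c \<in> fc P \<Longrightarrow> \<rho> c \<notin> chans k'" "Bare k' \<notin> fc (csub P (fix_on {Bare k} \<rho>))"
    "Pol k' Plus \<notin> fc (rename_bare k k' (csub P (fix_on {Bare k} \<rho>)))"
    using fresh_binder[where \<Delta> = \<Delta> and p = Plus, OF av] by metis
  have "ityped etyp \<Gamma> (\<rho>(Bare k := Pol k' Plus)) P (fmlookup (fmupd (k', Plus) S \<Delta>))"
    unfolding fmlookup_fmupd by (rule ityped_change_endpoint[OF P n(1) k'(2) n(2)])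
  then have "typed etyp \<Gamma> (csub P (\<rho>(Bare k := Pol k' Plus))) (fmupd (k', Plus) S \<Delta>)"
    using k'(4) by (rule Accept.IH)
  moreover have "csub P (\<rho>(Bare k := Pol k' Plus)) =
      polarize k' Plus (rename_bare k k' (csub P (fix_on {Bare k} \<rho>)))"
    by (rule polarize_rename_csub[OF av _ k'(5), symmetric]) (use k'(3) in simp_all)
  ultimately have "typed etyp \<Gamma> (Accept a S k' (rename_bare k k' (csub P (fix_on {Bare k} \<rho>)))) \<Delta>"
    using k'(1,7) by (intro t_accept) simp_all
  moreover have "alpha_step (Accept a S k (csub P (fix_on {Bare k} \<rho>)))
      (Accept a S k' (rename_bare k k' (csub P (fix_on {Bare k} \<rho>))))"
    using k'(3,6) by (intro alpha_accept) simp_all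
  ultimately show ?case by (auto intro: t_alpha congr_base)
next
  case (Out c e P)
  then obtain k p G S where c: "\<rho> c = Pol k p" "fmlookup \<Delta> (k, p) = Some (OutG G S)" "etyp \<Gamma> e G"
    and P: "ityped etyp \<Gamma> \<rho> P (fmlookup (fmupd (k, p) S \<Delta>))"
    unfolding ityped_out fmlookup_fmupd by blast
  have "typed etyp \<Gamma> (csub P \<rho>) (fmupd (k, p) S (fmdrop (k, p) \<Delta>))"
    using Out.IH[OF P] Out.prems(2) by (simp del: fun_upd_apply)
  from t_out[OF _ c(3) this] show ?case using c by (simp add: fmupd_same del: fun_upd_apply)
next
  case (In c x P)
  then obtain k p G S where c: "\<rho> c = Pol k p" "fmlookup \<Delta> (k, p) = Some (InG G S)"
    and P: "ityped etyp (\<Gamma>(x \<mapsto> G)) \<rho> P (fmlookup (fmupd (k, p) S \<Delta>))"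
    unfolding ityped_in fmlookup_fmupd by blast
  have "typed etyp (\<Gamma>(x \<mapsto> G)) (csub P \<rho>) (fmupd (k, p) S (fmdrop (k, p) \<Delta>))"
    using In.IH[OF P] In.prems(2) by (simp del: fun_upd_apply)
  from t_in[OF _ this] show ?case using c by (simp add: fmupd_same del: fun_upd_apply)
next
  case (Throw c d P)
  then obtain k p k' q S\<^sub>1 S\<^sub>2 where c: "\<rho> c = Pol k p" "\<rho> d = Pol k' q" "(k, p) \<noteq> (k', q)"
      "fmlookup \<Delta> (k, p) = Some (OutS S\<^sub>1 q S\<^sub>2)" "fmlookup \<Delta> (k', q) = Some S\<^sub>1"
    and P: "ityped etyp \<Gamma> \<rho> P ((fmlookup \<Delta>)((k, p) \<mapsto> S\<^sub>2, (k', q) := None))"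
    unfolding ityped_throw by blast
  \<comment> \<open>The part of the environment that \<open>t_throw\<close> leaves untouched:
    neither the carrier nor the delegated endpoint belongs to it.\<close>
  define \<Delta>0 where "\<Delta>0 = fmdrop (k, p) (fmdrop (k', q) \<Delta>)"
  have "(fmlookup \<Delta>)((k, p) \<mapsto> S\<^sub>2, (k', q) := None) = fmlookup (fmupd (k, p) S\<^sub>2 \<Delta>0)"
    using c(3) by (auto simp: \<Delta>0_def fun_eq_iff)
  with P have "ityped etyp \<Gamma> \<rho> P (fmlookup (fmupd (k, p) S\<^sub>2 \<Delta>0))" by metis
  then have "typed etyp \<Gamma> (csub P \<rho>) (fmupd (k, p) S\<^sub>2 \<Delta>0)"
    using Throw.IH Throw.prems(2) by (simp del: fun_upd_apply)
  from t_throw[OF _ _ c(3) this, of S\<^sub>1]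
  have "typed etyp \<Gamma> (Throw (Pol k p) (Pol k' q) (csub P \<rho>))
      (fmupd (k', q) S\<^sub>1 (fmupd (k, p) (OutS S\<^sub>1 q S\<^sub>2) \<Delta>0))"
    by (simp add: \<Delta>0_def)
  moreover have "fmupd (k', q) S\<^sub>1 (fmupd (k, p) (OutS S\<^sub>1 q S\<^sub>2) \<Delta>0) = \<Delta>"
    using c(4,5) by (intro fmap_ext) (auto simp: \<Delta>0_def)
  ultimately show ?case using c(1,2) by simp
next
  case (Catch c x P)
  then have av: "avoids (insert x (bn P)) \<rho>" by simp
  obtain k p S\<^sub>1 q S\<^sub>2 n where c: "\<rho> c = Pol k p" "fmlookup \<Delta> (k, p) = Some (InS S\<^sub>1 q S\<^sub>2)"
    and n: "(n, q) \<notin> dom (fmlookup \<Delta>)" "\<forall>d \<in> fc P - {Bare x}. \<rho> d \<noteq> Pol n q"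
    and P: "ityped etyp \<Gamma> (\<rho>(Bare x := Pol n q)) P ((fmlookup \<Delta>)((k, p) \<mapsto> S\<^sub>2, (n, q) \<mapsto> S\<^sub>1))"
    using Catch.prems(1) unfolding ityped_catch by blast
  obtain k' where k': "\<And>p. (k', p) |\<notin>| fmdom \<Delta>" "\<And>p. (k', p) \<notin> dom (fmlookup \<Delta>)"
    "k' \<notin> insert x (bn P)" "avoids (bn P) (\<rho>(Bare x := Pol k' q))"
    "\<And>c. c \<in> fc P \<Longrightarrow> \<rho> c \<notin> chans k'" "Bare k' \<notin> fc (csub P (fix_on {Bare x} \<rho>))"
    "Pol k' q \<notin> fc (rename_bare x k' (csub P (fix_on {Bare x} \<rho>)))"
    using fresh_binder[where \<Delta> = \<Delta> and p = q, OF av] by metis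
  have neq: "(k, p) \<noteq> (k', q)" using c(2) k'(2) by (metis domI)
  have dom: "(n, q) \<notin> dom ((fmlookup \<Delta>)((k, p) \<mapsto> S\<^sub>2))" "(k', q) \<notin> dom ((fmlookup \<Delta>)((k, p) \<mapsto> S\<^sub>2))"
    using n(1) k'(2) neq c(2) by (metis domI domIff fun_upd_other)+
  have "ityped etyp \<Gamma> (\<rho>(Bare x := Pol k' q)) P (fmlookup (fmupd (k', q) S\<^sub>1 (fmupd (k, p) S\<^sub>2 \<Delta>)))"
    unfolding fmlookup_fmupd by (rule ityped_change_endpoint[OF P dom n(2)])
  then have "typed etyp \<Gamma> (csub P (\<rho>(Bare x := Pol k' q)))
      (fmupd (k', q) S\<^sub>1 (fmupd (k, p) S\<^sub>2 (fmdrop (k, p) \<Delta>)))"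
    using Catch.IH k'(4) by (simp del: fun_upd_apply)
  moreover have "csub P (\<rho>(Bare x := Pol k' q)) =
      polarize k' q (rename_bare x k' (csub P (fix_on {Bare x} \<rho>)))"
    by (rule polarize_rename_csub[OF av _ k'(5), symmetric]) (use k'(3) in simp_all)
  ultimately have "typed etyp \<Gamma> (Catch (Pol k p) k' (rename_bare x k' (csub P (fix_on {Bare x} \<rho>))))
      (fmupd (k, p) (InS S\<^sub>1 q S\<^sub>2) (fmdrop (k, p) \<Delta>))"
    using k'(1,7) neq by (intro t_catch) simp_all
  then have "typed etyp \<Gamma> (Catch (Pol k p) k' (rename_bare x k' (csub P (fix_on {Bare x} \<rho>)))) \<Delta>"
    using c(2) by (simp add: fmupd_same)
  moreover have "alpha_step (Catch (Pol k p) x (csub P (fix_on {Bare x} \<rho>)))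
      (Catch (Pol k p) k' (rename_bare x k' (csub P (fix_on {Bare x} \<rho>))))"
    using k'(3,6) by (intro alpha_catch) simp_all
  ultimately show ?case using c(1) by (auto intro: t_alpha congr_base)
next
  case (Select c l P)
  then obtain k p s S where c: "\<rho> c = Pol k p" "fmlookup \<Delta> (k, p) = Some (Sel s)" "fmlookup s l = Some S"
    and P: "ityped etyp \<Gamma> \<rho> P (fmlookup (fmupd (k, p) S \<Delta>))"
    unfolding ityped_select fmlookup_fmupd by blast
  have "typed etyp \<Gamma> (csub P \<rho>) (fmupd (k, p) S (fmdrop (k, p) \<Delta>))"
    using Select.IH[OF P] Select.prems(2) by (simp del: fun_upd_apply)
  from t_select[OF _ c(3) this] show ?case using c by (simp add: fmupd_same del: fun_upd_apply)
next
  case (Branch c b)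
  then obtain k p s' s where c: "\<rho> c = Pol k p" "fmlookup \<Delta> (k, p) = Some (Bra s')"
      "fmdom s = fmdom b" "s' \<noteq> fmempty" "s' \<subseteq>\<^sub>f s"
    and P: "\<And>l P S. fmlookup b l = Some P \<Longrightarrow> fmlookup s l = Some S \<Longrightarrow>
      ityped etyp \<Gamma> \<rho> P (fmlookup (fmupd (k, p) S \<Delta>))"
    unfolding ityped_branch fmlookup_fmupd by blast
  have "typed etyp \<Gamma> (csub P \<rho>) (fmupd (k, p) S (fmdrop (k, p) \<Delta>))"
    if l: "fmlookup b l = Some P" "fmlookup s l = Some S" for l P S
  proof -
    have "avoids (bn P) \<rho>"
      by (rule avoids_mono[OF Branch.prems(2)]) (use fmran'I[OF l(1)] in auto)
    then show ?thesis using Branch.IH[OF fmran'I[OF l(1)] P[OF l]] by simp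
  qed
  then have "typed etyp \<Gamma> (Branch (Pol k p) (fmmap (\<lambda>P. csub P \<rho>) b)) (fmupd (k, p) (Bra s') (fmdrop (k, p) \<Delta>))"
    using c(3-5) by (intro t_branch[where s = s]) auto
  then show ?case using c by (simp add: fmupd_same del: fun_upd_apply)
next
  case (Speculate c b)
  then obtain k p s where c: "\<rho> c = Pol k p" "fmlookup \<Delta> (k, p) = Some (Spec s)"
      "fmdom s = fmdom b" "s \<noteq> fmempty"
    and P: "\<And>l P S. fmlookup b l = Some P \<Longrightarrow> fmlookup s l = Some S \<Longrightarrow>
      ityped etyp \<Gamma> \<rho> P (fmlookup (fmupd (k, p) S \<Delta>))"
    unfolding ityped_speculate fmlookup_fmupd by blast
  have "typed etyp \<Gamma> (csub P \<rho>) (fmupd (k, p) S (fmdrop (k, p) \<Delta>))"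
    if l: "fmlookup b l = Some P" "fmlookup s l = Some S" for l P S
  proof -
    have "avoids (bn P) \<rho>"
      by (rule avoids_mono[OF Speculate.prems(2)]) (use fmran'I[OF l(1)] in auto)
    then show ?thesis using Speculate.IH[OF fmran'I[OF l(1)] P[OF l]] by simp
  qed
  then have "typed etyp \<Gamma> (Speculate (Pol k p) (fmmap (\<lambda>P. csub P \<rho>) b)) (fmupd (k, p) (Spec s) (fmdrop (k, p) \<Delta>))"
    using c(3,4) by (intro t_speculate) auto
  then show ?case using c by (simp add: fmupd_same del: fun_upd_apply)
next
  case (Sess k f P)
  then have av: "avoids (insert k (bn P)) \<rho>" by simp
  obtain k' where k': "\<And>p. (k', p) |\<notin>| fmdom \<Delta>" "\<And>p. (k', p) \<notin> dom (fmlookup \<Delta>)"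
    "k' \<notin> insert k (bn P)" "avoids (bn P) (bind_all k k' \<rho>)"
    "chans k' \<inter> fc (csub P (fix_on (chans k) \<rho>)) = {}"
    using fresh_binder[where \<Delta> = \<Delta>, OF av] by metis
  obtain S\<^sub>1 S\<^sub>2 where f: "comply f S\<^sub>1 S\<^sub>2"
    and P: "ityped etyp \<Gamma> (bind_all k k' \<rho>) P (fmlookup (fmupd (k', Plus) S\<^sub>2 (fmupd (k', Minus) S\<^sub>1 \<Delta>)))"
    unfolding fmlookup_fmupd using ityped_sess_fresh[OF Sess.prems(1) k'(2)] by metis
  have "typed etyp \<Gamma> (Sess k' f (rename_all k k' (csub P (fix_on (chans k) \<rho>)))) \<Delta>"
    unfolding rename_all_csub[OF av] using Sess.IH[OF P k'(4)] f k'(1) by (intro t_sess) simp_all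
  moreover have "alpha_step (Sess k f (csub P (fix_on (chans k) \<rho>)))
      (Sess k' f (rename_all k k' (csub P (fix_on (chans k) \<rho>))))"
    using k'(3,5) by (intro alpha_sess) simp_all
  ultimately show ?case by (auto intro: t_alpha congr_base)
next
  case (Res k P)
  then have av: "avoids (insert k (bn P)) \<rho>" by simp
  obtain k' where k': "\<And>p. (k', p) |\<notin>| fmdom \<Delta>"
    "k' \<notin> insert k (bn P)" "avoids (bn P) (bind_all k k' \<rho>)"
    "chans k' \<inter> fc (csub P (fix_on (chans k) \<rho>)) = {}"
    using fresh_binder[where \<Delta> = \<Delta>, OF av] by metis
  have "ityped etyp \<Gamma> (bind_all k k' \<rho>) P (fmlookup \<Delta>)"
    by (rule ityped_res_body[OF Res.prems(1)]) simp
  from Res.IH[OF this k'(3)] have "typed etyp \<Gamma> (Res k' (rename_all k k' (csub P (fix_on (chans k) \<rho>)))) \<Delta>"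
    unfolding rename_all_csub[OF av] using k'(1) by (intro t_res) simp_all
  moreover have "alpha_step (Res k (csub P (fix_on (chans k) \<rho>)))
      (Res k' (rename_all k k' (csub P (fix_on (chans k) \<rho>))))"
    using k'(2,4) by (intro alpha_res) simp_all
  ultimately show ?case by (auto intro: t_alpha congr_base)
qed

lemma typed_iff_ityped: "typed etyp \<Gamma> P \<Delta> \<longleftrightarrow> ityped etyp \<Gamma> id P (fmlookup \<Delta>)"
  using typed_imp_ityped ityped_imp_typed[where \<rho> = id] by (metis avoids_id csub_id)

theorem theorem1:
  fixes etyp :: "(var \<rightharpoonup> 'g) \<Rightarrow> 'e \<Rightarrow> 'g \<Rightarrow> bool"
    and eval :: "'e \<Rightarrow> 'e \<Rightarrow> bool"
    and esub :: "'e \<Rightarrow> var \<Rightarrow> 'e \<Rightarrow> 'e"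
    and \<Gamma> :: "var \<rightharpoonup> 'g"
    and \<Delta> :: "('l, 'g) senv"
    and P Q :: "('l, 'g, 'e) proc"
  assumes "expression_language etyp eval esub"
    and "process P"
    and "typed etyp \<Gamma> P \<Delta>"
    and "red eval esub P Q"
  shows "typed etyp \<Gamma> Q \<Delta>"
  using assms(3) red_ityped[OF assms(1,4)] unfolding typed_iff_ityped by blast

end
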